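(* Let $G\rightrightarrows M$ be a regular Lie groupoid whose Lie algebroid $(AG,\rho,[\cdot,\cdot])$ has non-zero bracket, and let $\mathcal G=O(\xi)\rightrightarrows M$ be its co-adjoint Lie groupoid associated to $\xi\neq0$, with co-adjoint Lie algebroid $A\mathcal G$. Let $(x^i)$ be local coordinates on $M$, $\{e_\alpha\}$ a local basis of sections of $AG$ with structure functions $\rho^i_\alpha, C^\gamma_{\alpha\beta}$, let $\tilde e_\alpha=\mathrm{ad}^*_{e_\alpha}\xi$ be the corresponding local basis of sections of $A\mathcal G$, and let $(x^i,\eta_\alpha)$ be the associated coordinates on $A^*\mathcal G$. Let $f:C\to A\mathcal G$ be a control system on $A\mathcal G$ with control space a vector bundle $\pi:C\to M$ with coordinates $(x^i,u^c)$, let $L\in C^\infty(C)$ be a cost function, and let $H\in C^\infty(A^*\mathcal G\times_MC)$ be $H(\eta,c)=\langle\eta,f(c)\rangle-L(c)$. Then the critical trajectories are the solutions of the differential equations $$\dot x^i=\rho^i_\alpha\frac{\partial H}{\partial\eta_\alpha},\qquad \dot\eta_\alpha=-\Big(\rho^i_\alpha\frac{\partial H}{\partial x^i}+\eta_\gamma C^\gamma_{\alpha\beta}\frac{\partial H}{\partial\eta_\beta}\Big),\qquad 0=\frac{\partial H}{\partial u^c}.$$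
   Context: Structure functions. For a Lie algebroid $A\to M$ with anchor $\rho$ and bracket $[\cdot,\cdot]$: $\rho(e_\alpha)=\rho^i_\alpha\frac{\partial}{\partial x^i}$, $[e_\alpha,e_\beta]=C^\gamma_{\alpha\beta}e_\gamma$ (summation convention). Co-adjoint Lie groupoid and Lie algebroid. $G\rightrightarrows M$ has source $\alpha$, target $\beta$, units $1_p$; it is regular if $(\beta,\alpha):G\to M\times M$ has constant rank. $I_G=\bigcup_pI_p$, $I_p=\alpha^{-1}(p)\cap\beta^{-1}(p)$, is the isotropy Lie groupoid, $AI_G$ its Lie algebroid and $A^*I_G$ the dual bundle. $\mathrm{Ad}_gX=\frac{d}{dt}|_{t=0}\,g\,\mathrm{Exp}(tX)\,g^{-1}$, $\langle\mathrm{Ad}^*_g\xi,X\rangle=\langle\xi,\mathrm{Ad}_{g^{-1}}X\rangle$ and $\langle\mathrm{ad}^*_X\xi,Y\rangle=\langle\xi,[Y,X]\rangle$ for $X\in AG$. For $\xi\in(A^*I_G)_p$ such that $G_\xi=\{g:\mathrm{Ad}^*_g\xi=\xi\}$ is a normal Lie subgroupoid of $G$, $\mathcal G=O(\xi)=\{\mathrm{Ad}^*_g\xi:g\in G\}$ is a Lie groupoid over $M$ with source $\mathrm{Ad}^*_g\xi\mapsto\alpha(g)$, target $\mathrm{Ad}^*_g\xi\mapsto\beta(g)$, product $\mathrm{Ad}^*_g\xi\cdot\mathrm{Ad}^*_h\xi=\mathrm{Ad}^*_{gh}\xi$, units $\mathrm{Ad}^*_{1_p}\xi$, inverse $\mathrm{Ad}^*_g\xi\mapsto\mathrm{Ad}^*_{g^{-1}}\xi$.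 Its Lie algebroid is $A\mathcal G=\{\mathrm{ad}^*_{X_p}\xi:X_p\in(AG)_p\}$. Facts taken from earlier work: the bracket of $A\mathcal G$ is $[\mathrm{ad}^*_X\xi,\mathrm{ad}^*_Y\xi]=\mathrm{ad}^*_{[X,Y]}\xi$; for $\xi\ne0$ the $\tilde e_\alpha=\mathrm{ad}^*_{e_\alpha}\xi$ form a basis of sections of $A\mathcal G$; and the structure functions of $A\mathcal G$ in this basis equal those of $AG$ in the basis $\{e_\alpha\}$. Prolongation. For a Lie algebroid $A\to M$ and a fiber bundle $\mu:E\to M$, the prolongation $\mathcal TE\to E$ has fibers $\mathcal T_pE=\{(X,V)\in A_{\mu(p)}\times T_pE:\rho(X)=T_p\mu(V)\}$, elements written $(p,X,V)$. It is a Lie algebroid with anchor $\rho'(p,X,V)=V$ and bracket of projectable sections $Z_k(p)=(p,\sigma_k(\mu(p)),V_k(p))$ given by $[Z_1,Z_2](p)=(p,[\sigma_1,\sigma_2](\mu(p)),[V_1,V_2](p))$; $d$ is its Lie algebroid differential. On $\mathcal TA^*$ the canonical 1-form is $\langle\theta,(\eta,X,V)\rangle=\langle\eta,X\rangle$ and the canonical symplectic form is $\omega=-d\theta$. Optimal control on a Lie algebroid. A control system on $A$ with control space $\pi:C\to M$ is a section $f:C\to A$ of $A$ along $\pi$; its trajectories are solutions of $\dot x(t)=\rho(f(c(t)))$, $x(t)=\pi(c(t))$. The problem is to minimize $\int L(c(t))\,dt$ over trajectories with some boundary conditions. With $H(\eta,c)=\langle\eta,f(c)\rangle-L(c)$ on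 $A^*\times_MC$, the associated Hamiltonian control system $f_H$ is the section of $\mathcal TA^*$ along $pr_1:A^*\times_MC\to A^*$, defined on a subset of $A^*\times_MC$ (where $\partial H/\partial u^c=0$), by the symplectic equation $i_{f_H}\omega=dH$ ($\omega$ pulled back along $pr_1$). The critical trajectories are the integral curves of $\rho'(f_H)$. Here $A=A\mathcal G$. *)

theory Defs
  imports "HOL-Analysis.Analysis" "HOL-Library.Function_Algebras"
begin

text \<open>Real-valued functions (tangent vectors as derivations, covectors) form a real vector space
  under the pointwise operations.\<close>

instantiation "fun" :: (type, real_vector) real_vector
begin

definition scaleR_fun :: "real \<Rightarrow> ('a \<Rightarrow> 'b) \<Rightarrow> 'a \<Rightarrow> 'b"
  where "scaleR_fun c f = (\<lambda>x. c *\<^sub>R f x)"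

instance
  by standard (auto simp: scaleR_fun_def plus_fun_def fun_eq_iff scaleR_add_right scaleR_add_left)

end


section \<open>Smooth functions on open subsets of Euclidean n-space\<close>

text \<open>Euclidean n-space is the library's \<^const>\<open>Euclidean_space\<close> \<open>n\<close>, whose points are the
  sequences vanishing from index \<open>n\<close> on.  The dimension may thus be 0, so that a Lie group is
  a Lie groupoid over a point.\<close>

definition pd :: "nat \<Rightarrow> ((nat \<Rightarrow> real) \<Rightarrow> real) \<Rightarrow> (nat \<Rightarrow> real) \<Rightarrow> real"
  where "pd i f x = deriv (\<lambda>t. f (x(i := t))) (x i)"

fun Ck_on :: "nat \<Rightarrow> nat \<Rightarrow> (nat \<Rightarrow> real) set \<Rightarrow> ((nat \<Rightarrow> real) \<Rightarrow> real) \<Rightarrow> bool" where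
  "Ck_on n 0 S f \<longleftrightarrow> continuous_map (subtopology (Euclidean_space n) S) euclideanreal f"
| "Ck_on n (Suc k) S f \<longleftrightarrow>
     continuous_map (subtopology (Euclidean_space n) S) euclideanreal f \<and>
     (\<forall>i<n. (\<forall>x\<in>S. (\<lambda>t. f (x(i := t))) differentiable (at (x i))) \<and> Ck_on n k S (pd i f))"

definition smooth_fun_on :: "nat \<Rightarrow> (nat \<Rightarrow> real) set \<Rightarrow> ((nat \<Rightarrow> real) \<Rightarrow> real) \<Rightarrow> bool"
  where "smooth_fun_on n S f \<longleftrightarrow> openin (Euclidean_space n) S \<and> (\<forall>k. Ck_on n k S f)"

text \<open>\<open>join n x y\<close> is the point of the product of Euclidean n-space with a further
  Euclidean space that has components \<open>x\<close> and \<open>y\<close>.\<close>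

definition join :: "nat \<Rightarrow> (nat \<Rightarrow> real) \<Rightarrow> (nat \<Rightarrow> real) \<Rightarrow> nat \<Rightarrow> real"
  where "join n x y = (\<lambda>i. if i < n then x i else y (i - n))"


section \<open>Smooth manifolds, tangent vectors, smooth maps\<close>

record 'p mfd =
  mdim :: nat
  charts :: "('p set \<times> ('p \<Rightarrow> nat \<Rightarrow> real)) set"

definition pts :: "'p mfd \<Rightarrow> 'p set"
  where "pts M = (\<Union>(D, \<phi>)\<in>charts M. D)"

definition mtop :: "'p mfd \<Rightarrow> 'p topology"
  where "mtop M = topology_generated_by
    {{p \<in> D. \<phi> p \<in> S} | D \<phi> S. (D, \<phi>) \<in> charts M \<and> openin (Euclidean_space (mdim M)) S}"

definition near :: "'p mfd \<Rightarrow> 'p \<Rightarrow> ('p \<Rightarrow> bool) \<Rightarrow> bool"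
  where "near M p P \<longleftrightarrow> (\<exists>W. openin (mtop M) W \<and> p \<in> W \<and> (\<forall>q\<in>W. P q))"

definition smooth_transition ::
  "nat \<Rightarrow> 'p set \<times> ('p \<Rightarrow> nat \<Rightarrow> real) \<Rightarrow> 'p set \<times> ('p \<Rightarrow> nat \<Rightarrow> real) \<Rightarrow> bool"
  where "smooth_transition n = (\<lambda>(D, \<phi>) (D', \<phi>').
    openin (Euclidean_space n) (\<phi> ` (D \<inter> D')) \<and>
    (\<forall>i<n. smooth_fun_on n (\<phi> ` (D \<inter> D')) (\<lambda>x. \<phi>' (inv_into D \<phi> x) i)))"

definition second_countable_top :: "'p topology \<Rightarrow> bool"
  where "second_countable_top X \<longleftrightarrow> (\<exists>\<B>. countable \<B> \<and> (\<forall>V\<in>\<B>. openin X V) \<and>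
    (\<forall>U x. openin X U \<and> x \<in> U \<longrightarrow> (\<exists>V\<in>\<B>. x \<in> V \<and> V \<subseteq> U)))"

definition smooth_manifold :: "'p mfd \<Rightarrow> bool"
  where "smooth_manifold M \<longleftrightarrow>
    (\<forall>(D, \<phi>)\<in>charts M. inj_on \<phi> D \<and> openin (Euclidean_space (mdim M)) (\<phi> ` D)) \<and>
    (\<forall>c\<in>charts M. \<forall>c'\<in>charts M. smooth_transition (mdim M) c c') \<and>
    Hausdorff_space (mtop M) \<and> second_countable_top (mtop M)"

text \<open>Local coordinates: charts of the maximal atlas.\<close>

definition coordinate_chart :: "'p mfd \<Rightarrow> 'p set \<Rightarrow> ('p \<Rightarrow> nat \<Rightarrow> real) \<Rightarrow> bool"
  where "coordinate_chart M D \<phi> \<longleftrightarrow>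
    D \<subseteq> pts M \<and> inj_on \<phi> D \<and> openin (Euclidean_space (mdim M)) (\<phi> ` D) \<and>
    (\<forall>c\<in>charts M. smooth_transition (mdim M) (D, \<phi>) c \<and> smooth_transition (mdim M) c (D, \<phi>))"

text \<open>\<open>smooth_at M p f\<close>: \<open>f\<close> is smooth on a neighbourhood of \<open>p\<close>.  Elsewhere \<open>f\<close> is
  arbitrary; functions, vector fields and sections defined on open subsets are
  represented in this way by total functions.\<close>

definition smooth_at :: "'p mfd \<Rightarrow> 'p \<Rightarrow> ('p \<Rightarrow> real) \<Rightarrow> bool"
  where "smooth_at M p f \<longleftrightarrow> p \<in> pts M \<and>
    (\<forall>(D, \<phi>)\<in>charts M. p \<in> D \<longrightarrow>
      (\<exists>S. \<phi> p \<in> S \<and> S \<subseteq> \<phi> ` D \<and> smooth_fun_on (mdim M) S (f \<circ> inv_into D \<phi>)))"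

text \<open>Quantifying over all \<open>h\<close> smooth near the image point (with arbitrary values elsewhere)
  also forces continuity of \<open>F\<close> at \<open>p\<close>.\<close>

definition smooth_map_at :: "'p mfd \<Rightarrow> 'q mfd \<Rightarrow> ('p \<Rightarrow> 'q) \<Rightarrow> 'p \<Rightarrow> bool"
  where "smooth_map_at N M F p \<longleftrightarrow>
    p \<in> pts N \<and> near N p (\<lambda>q. F q \<in> pts M) \<and>
    (\<forall>h. smooth_at M (F p) h \<longrightarrow> smooth_at N p (h \<circ> F))"

definition smooth_map :: "'p mfd \<Rightarrow> 'q mfd \<Rightarrow> ('p \<Rightarrow> 'q) \<Rightarrow> bool"
  where "smooth_map N M F \<longleftrightarrow> (\<forall>p\<in>pts N. smooth_map_at N M F p)"

definition real_line :: "real mfd"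
  where "real_line = \<lparr>mdim = 1, charts = {(UNIV, \<lambda>t i. if i = 0 then t else 0)}\<rparr>"

definition prod_mfd :: "'p mfd \<Rightarrow> 'q mfd \<Rightarrow> ('p \<times> 'q) mfd"
  where "prod_mfd M N = \<lparr>mdim = mdim M + mdim N,
    charts = {(D \<times> D', \<lambda>(p, q). join (mdim M) (\<phi> p) (\<psi> q)) | D \<phi> D' \<psi>.
                (D, \<phi>) \<in> charts M \<and> (D', \<psi>) \<in> charts N}\<rparr>"

text \<open>A tangent vector is the derivation \<open>f \<mapsto> (f \<circ> \<gamma>)'(t)\<close> given by a smooth curve \<open>\<gamma>\<close>.  It is
  set to 0 on functions that are not smooth near the base point, so that equality of tangent
  vectors is equality of functions.\<close>

type_synonym 'p tvec = "('p \<Rightarrow> real) \<Rightarrow> real"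

definition velocity :: "'p mfd \<Rightarrow> (real \<Rightarrow> 'p) \<Rightarrow> real \<Rightarrow> 'p tvec"
  where "velocity M \<gamma> t = (\<lambda>f. if smooth_at M (\<gamma> t) f then deriv (f \<circ> \<gamma>) t else 0)"

definition tangent_space :: "'p mfd \<Rightarrow> 'p \<Rightarrow> 'p tvec set"
  where "tangent_space M p = {velocity M \<gamma> 0 | \<gamma>. smooth_map_at real_line M \<gamma> 0 \<and> \<gamma> 0 = p}"

text \<open>The tangent map of \<open>F\<close> into \<open>M\<close>, at a point with image \<open>q\<close>.\<close>

definition tmap :: "'q mfd \<Rightarrow> ('p \<Rightarrow> 'q) \<Rightarrow> 'q \<Rightarrow> 'p tvec \<Rightarrow> 'q tvec"
  where "tmap M F q v = (\<lambda>h. if smooth_at M q h then v (h \<circ> F) else 0)"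

definition submersion :: "'p mfd \<Rightarrow> 'q mfd \<Rightarrow> ('p \<Rightarrow> 'q) \<Rightarrow> bool"
  where "submersion N M F \<longleftrightarrow> smooth_map N M F \<and>
    (\<forall>p\<in>pts N. tmap M F (F p) ` tangent_space N p = tangent_space M (F p))"

definition coord_vec :: "'p mfd \<Rightarrow> 'p set \<Rightarrow> ('p \<Rightarrow> nat \<Rightarrow> real) \<Rightarrow> nat \<Rightarrow> 'p \<Rightarrow> 'p tvec"
  where "coord_vec M D \<phi> i p =
    (\<lambda>h. if smooth_at M p h then pd i (h \<circ> inv_into D \<phi>) (\<phi> p) else 0)"

definition vector_field_at :: "'p mfd \<Rightarrow> 'p \<Rightarrow> ('p \<Rightarrow> 'p tvec) \<Rightarrow> bool"
  where "vector_field_at M p V \<longleftrightarrow> near M p (\<lambda>q. V q \<in> tangent_space M q) \<and>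
    (\<forall>f. smooth_at M p f \<longrightarrow> smooth_at M p (\<lambda>q. V q f))"

definition vf_bracket :: "'p mfd \<Rightarrow> ('p \<Rightarrow> 'p tvec) \<Rightarrow> ('p \<Rightarrow> 'p tvec) \<Rightarrow> 'p \<Rightarrow> 'p tvec"
  where "vf_bracket M V W p =
    (\<lambda>f. if smooth_at M p f then V p (\<lambda>q. W q f) - W p (\<lambda>q. V q f) else 0)"


section \<open>Vector bundles\<close>

text \<open>The fibers are subspaces of a common real vector space; points of the total space are
  pairs of a base point and a vector.  \<open>frames\<close> is an atlas of local trivializations.\<close>

record ('m, 'a) vbundle =
  vrank :: nat
  fib :: "'m \<Rightarrow> 'a set"
  frames :: "('m set \<times> (nat \<Rightarrow> 'm \<Rightarrow> 'a)) set"

definition is_basis :: "nat \<Rightarrow> (nat \<Rightarrow> 'a::real_vector) \<Rightarrow> 'a set \<Rightarrow> bool"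
  where "is_basis r b V \<longleftrightarrow>
    inj_on b {..<r} \<and> independent (b ` {..<r}) \<and> span (b ` {..<r}) = V"

definition coeffs :: "nat \<Rightarrow> (nat \<Rightarrow> 'a::real_vector) \<Rightarrow> 'a \<Rightarrow> nat \<Rightarrow> real"
  where "coeffs r b v = (THE c. (\<forall>k\<ge>r. c k = 0) \<and> v = (\<Sum>k<r. c k *\<^sub>R b k))"

definition linear_on_set :: "'a::real_vector set \<Rightarrow> ('a \<Rightarrow> 'b::real_vector) \<Rightarrow> bool"
  where "linear_on_set V f \<longleftrightarrow>
    (\<forall>v\<in>V. \<forall>w\<in>V. \<forall>a b. f (a *\<^sub>R v + b *\<^sub>R w) = a *\<^sub>R f v + b *\<^sub>R f w)"

text \<open>Covectors vanish outside the subspace, so that the dual is a set of functions.\<close>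

definition dual_of :: "'a::real_vector set \<Rightarrow> ('a \<Rightarrow> real) set"
  where "dual_of V = {\<eta>. linear_on_set V \<eta> \<and> (\<forall>v. v \<notin> V \<longrightarrow> \<eta> v = 0)}"

definition smooth_section_at ::
  "'m mfd \<Rightarrow> ('m, 'a::real_vector, 'z) vbundle_scheme \<Rightarrow> 'm \<Rightarrow> ('m \<Rightarrow> 'a) \<Rightarrow> bool"
  where "smooth_section_at M E p \<sigma> \<longleftrightarrow> p \<in> pts M \<and> near M p (\<lambda>q. \<sigma> q \<in> fib E q) \<and>
    (\<forall>(U, e)\<in>frames E. p \<in> U \<longrightarrow>
      (\<forall>k<vrank E. smooth_at M p (\<lambda>q. coeffs (vrank E) (\<lambda>j. e j q) (\<sigma> q) k)))"

text \<open>A local basis of sections; the transition functions to and from the atlas are smooth (smoothness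
  in one direction implies it in the other).\<close>

definition local_frame ::
  "'m mfd \<Rightarrow> ('m, 'a::real_vector, 'z) vbundle_scheme \<Rightarrow> nat \<Rightarrow> 'm set \<Rightarrow> (nat \<Rightarrow> 'm \<Rightarrow> 'a) \<Rightarrow> bool"
  where "local_frame M E r U e \<longleftrightarrow> vrank E = r \<and> openin (mtop M) U \<and>
    (\<forall>p\<in>U. is_basis r (\<lambda>k. e k p) (fib E p) \<and> (\<forall>k<r. smooth_section_at M E p (e k)) \<and>
       (\<forall>(U', e')\<in>frames E. p \<in> U' \<longrightarrow>
          (\<forall>j<r. \<forall>k<r. smooth_at M p (\<lambda>q. coeffs r (\<lambda>i. e i q) (e' j q) k))))"

definition vector_bundle :: "'m mfd \<Rightarrow> ('m, 'a::real_vector, 'z) vbundle_scheme \<Rightarrow> bool"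
  where "vector_bundle M E \<longleftrightarrow>
    (\<Union>(U, e)\<in>frames E. U) = pts M \<and>
    (\<forall>(U, e)\<in>frames E. local_frame M E (vrank E) U e)"

definition total_mfd :: "'m mfd \<Rightarrow> ('m, 'a::real_vector, 'z) vbundle_scheme \<Rightarrow> ('m \<times> 'a) mfd"
  where "total_mfd M E = \<lparr>mdim = mdim M + vrank E,
    charts = {({(p, v). p \<in> D \<inter> U \<and> v \<in> fib E p},
               \<lambda>(p, v). join (mdim M) (\<phi> p) (coeffs (vrank E) (\<lambda>k. e k p) v)) | D \<phi> U e.
               (D, \<phi>) \<in> charts M \<and> (U, e) \<in> frames E}\<rparr>"

definition dual_coords :: "nat \<Rightarrow> (nat \<Rightarrow> 'a) \<Rightarrow> ('a \<Rightarrow> real) \<Rightarrow> nat \<Rightarrow> real"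
  where "dual_coords r b \<eta> = (\<lambda>k. if k < r then \<eta> (b k) else 0)"

definition dual_mfd ::
  "'m mfd \<Rightarrow> ('m, 'a::real_vector, 'z) vbundle_scheme \<Rightarrow> ('m \<times> ('a \<Rightarrow> real)) mfd"
  where "dual_mfd M E = \<lparr>mdim = mdim M + vrank E,
    charts = {({(p, \<eta>). p \<in> D \<inter> U \<and> \<eta> \<in> dual_of (fib E p)},
               \<lambda>(p, \<eta>). join (mdim M) (\<phi> p) (dual_coords (vrank E) (\<lambda>k. e k p) \<eta>)) | D \<phi> U e.
               (D, \<phi>) \<in> charts M \<and> (U, e) \<in> frames E}\<rparr>"

text \<open>The fibered product of the dual of \<open>E\<close> with a vector bundle \<open>C\<close>; the point
  \<open>(p, \<eta>, u)\<close> stands for the pair of \<open>(p, \<eta>)\<close> and \<open>(p, u)\<close>.\<close>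

definition dual_times_dom ::
  "('m, 'a::real_vector, 'z) vbundle_scheme \<Rightarrow> ('m, 'c::real_vector, 'y) vbundle_scheme \<Rightarrow>
   'm set \<Rightarrow> ('m \<times> ('a \<Rightarrow> real) \<times> 'c) set"
  where "dual_times_dom E C U = {(p, \<eta>, u). p \<in> U \<and> \<eta> \<in> dual_of (fib E p) \<and> u \<in> fib C p}"

definition dual_times_chart ::
  "nat \<Rightarrow> nat \<Rightarrow> nat \<Rightarrow> ('m \<Rightarrow> nat \<Rightarrow> real) \<Rightarrow> (nat \<Rightarrow> 'm \<Rightarrow> 'a) \<Rightarrow> (nat \<Rightarrow> 'm \<Rightarrow> 'c) \<Rightarrow>
   'm \<times> ('a::real_vector \<Rightarrow> real) \<times> 'c::real_vector \<Rightarrow> nat \<Rightarrow> real"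
  where "dual_times_chart n r m \<phi> e s = (\<lambda>(p, \<eta>, u).
    join n (\<phi> p) (join r (dual_coords r (\<lambda>k. e k p) \<eta>) (coeffs m (\<lambda>k. s k p) u)))"

definition dual_times_mfd ::
  "'m mfd \<Rightarrow> ('m, 'a::real_vector, 'z) vbundle_scheme \<Rightarrow> ('m, 'c::real_vector, 'y) vbundle_scheme \<Rightarrow>
   ('m \<times> ('a \<Rightarrow> real) \<times> 'c) mfd"
  where "dual_times_mfd M E C = \<lparr>mdim = mdim M + (vrank E + vrank C),
    charts = {(dual_times_dom E C (D \<inter> U \<inter> U'),
               dual_times_chart (mdim M) (vrank E) (vrank C) \<phi> e s) | D \<phi> U e U' s.
               (D, \<phi>) \<in> charts M \<and> (U, e) \<in> frames E \<and> (U', s) \<in> frames C}\<rparr>"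


section \<open>Lie algebroids\<close>

text \<open>The bracket acts on germs: \<open>brac A \<sigma> \<tau> p\<close> is the value at \<open>p\<close> of the bracket of two
  sections that are smooth near \<open>p\<close>.\<close>

record ('m, 'a) algebroid = "('m, 'a) vbundle" +
  anchor :: "'m \<Rightarrow> 'a \<Rightarrow> 'm tvec"
  brac :: "('m \<Rightarrow> 'a) \<Rightarrow> ('m \<Rightarrow> 'a) \<Rightarrow> 'm \<Rightarrow> 'a"

definition lie_algebroid :: "'m mfd \<Rightarrow> ('m, 'a::real_vector) algebroid \<Rightarrow> bool"
  where "lie_algebroid M A \<longleftrightarrow>
    smooth_manifold M \<and> vector_bundle M A \<and>
    (\<forall>p\<in>pts M. linear_on_set (fib A p) (anchor A p) \<and>
       anchor A p ` fib A p \<subseteq> tangent_space M p) \<and>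
    (\<forall>p \<sigma>. smooth_section_at M A p \<sigma> \<longrightarrow> vector_field_at M p (\<lambda>q. anchor A q (\<sigma> q))) \<and>
    (\<forall>p \<sigma> \<tau>. smooth_section_at M A p \<sigma> \<and> smooth_section_at M A p \<tau> \<longrightarrow>
       smooth_section_at M A p (brac A \<sigma> \<tau>) \<and>
       brac A \<sigma> \<tau> p = - brac A \<tau> \<sigma> p \<and>
       anchor A p (brac A \<sigma> \<tau> p) =
         vf_bracket M (\<lambda>q. anchor A q (\<sigma> q)) (\<lambda>q. anchor A q (\<tau> q)) p \<and>
       (\<forall>\<sigma>'. near M p (\<lambda>q. \<sigma> q = \<sigma>' q) \<longrightarrow> brac A \<sigma> \<tau> p = brac A \<sigma>' \<tau> p) \<and>
       (\<forall>h. smooth_at M p h \<longrightarrow> brac A \<sigma> (\<lambda>q. h q *\<^sub>R \<tau> q) p =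
          h p *\<^sub>R brac A \<sigma> \<tau> p + anchor A p (\<sigma> p) h *\<^sub>R \<tau> p)) \<and>
    (\<forall>p \<sigma> \<tau> \<upsilon>. smooth_section_at M A p \<sigma> \<and> smooth_section_at M A p \<tau> \<and>
       smooth_section_at M A p \<upsilon> \<longrightarrow>
       brac A \<sigma> (\<lambda>q. \<tau> q + \<upsilon> q) p = brac A \<sigma> \<tau> p + brac A \<sigma> \<upsilon> p \<and>
       brac A \<sigma> (brac A \<tau> \<upsilon>) p + brac A \<tau> (brac A \<upsilon> \<sigma>) p + brac A \<upsilon> (brac A \<sigma> \<tau>) p = 0)"

definition algebroid_iso ::
  "'m mfd \<Rightarrow> ('m, 'a::real_vector) algebroid \<Rightarrow> ('m, 'b::real_vector) algebroid \<Rightarrow>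
   ('m \<Rightarrow> 'a \<Rightarrow> 'b) \<Rightarrow> bool"
  where "algebroid_iso M A B \<Psi> \<longleftrightarrow>
    (\<forall>p\<in>pts M. linear_on_set (fib A p) (\<Psi> p) \<and> bij_betw (\<Psi> p) (fib A p) (fib B p) \<and>
       (\<forall>a\<in>fib A p. anchor B p (\<Psi> p a) = anchor A p a)) \<and>
    (\<forall>p \<sigma>. near M p (\<lambda>q. \<sigma> q \<in> fib A q) \<longrightarrow>
       (smooth_section_at M B p (\<lambda>q. \<Psi> q (\<sigma> q)) \<longleftrightarrow> smooth_section_at M A p \<sigma>)) \<and>
    (\<forall>p \<sigma> \<tau>. smooth_section_at M A p \<sigma> \<and> smooth_section_at M A p \<tau> \<longrightarrow>
       brac B (\<lambda>q. \<Psi> q (\<sigma> q)) (\<lambda>q. \<Psi> q (\<tau> q)) p = \<Psi> p (brac A \<sigma> \<tau> p))"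


section \<open>Lie groupoids and their Lie algebroids\<close>

text \<open>\<open>gmult G g h\<close> is defined for \<open>src G g = tgt G h\<close>.\<close>

record ('g, 'm) groupoid =
  arr :: "'g mfd"
  base :: "'m mfd"
  src :: "'g \<Rightarrow> 'm"
  tgt :: "'g \<Rightarrow> 'm"
  gunit :: "'m \<Rightarrow> 'g"
  gmult :: "'g \<Rightarrow> 'g \<Rightarrow> 'g"
  ginv :: "'g \<Rightarrow> 'g"

definition composable :: "('g, 'm) groupoid \<Rightarrow> ('g \<times> 'g) set"
  where "composable G = {(g, h). g \<in> pts (arr G) \<and> h \<in> pts (arr G) \<and> src G g = tgt G h}"

text \<open>The composable pairs form an embedded submanifold of the product; smoothness of the
  multiplication on it is the existence of local smooth extensions.\<close>

definition lie_groupoid :: "('g, 'm) groupoid \<Rightarrow> bool"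
  where "lie_groupoid G \<longleftrightarrow>
    smooth_manifold (arr G) \<and> smooth_manifold (base G) \<and>
    submersion (arr G) (base G) (src G) \<and> src G ` pts (arr G) = pts (base G) \<and>
    submersion (arr G) (base G) (tgt G) \<and> tgt G ` pts (arr G) = pts (base G) \<and>
    smooth_map (base G) (arr G) (gunit G) \<and> smooth_map (arr G) (arr G) (ginv G) \<and>
    (\<forall>(g, h)\<in>composable G. \<forall>f. smooth_at (arr G) (gmult G g h) f \<longrightarrow>
       (\<exists>F. smooth_at (prod_mfd (arr G) (arr G)) (g, h) F \<and>
            near (prod_mfd (arr G) (arr G)) (g, h)
              (\<lambda>(g', h'). (g', h') \<in> composable G \<longrightarrow> F (g', h') = f (gmult G g' h')))) \<and>
    (\<forall>p\<in>pts (base G). gunit G p \<in> pts (arr G) \<and>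
       src G (gunit G p) = p \<and> tgt G (gunit G p) = p) \<and>
    (\<forall>(g, h)\<in>composable G. gmult G g h \<in> pts (arr G) \<and>
       src G (gmult G g h) = src G h \<and> tgt G (gmult G g h) = tgt G g) \<and>
    (\<forall>g h k. (g, h) \<in> composable G \<and> (h, k) \<in> composable G \<longrightarrow>
       gmult G (gmult G g h) k = gmult G g (gmult G h k)) \<and>
    (\<forall>g\<in>pts (arr G). gmult G g (gunit G (src G g)) = g \<and> gmult G (gunit G (tgt G g)) g = g \<and>
       ginv G g \<in> pts (arr G) \<and> src G (ginv G g) = tgt G g \<and> tgt G (ginv G g) = src G g \<and>
       gmult G g (ginv G g) = gunit G (tgt G g) \<and> gmult G (ginv G g) g = gunit G (src G g))"

definition regular_groupoid :: "('g, 'm) groupoid \<Rightarrow> bool"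
  where "regular_groupoid G \<longleftrightarrow> (\<exists>k. \<forall>g\<in>pts (arr G).
    dim ((\<lambda>v. (tmap (base G) (tgt G) (tgt G g) v, tmap (base G) (src G) (src G g) v)) `
           tangent_space (arr G) g) = k)"

text \<open>The derivative of \<open>f\<close> at \<open>g\<close> along the right-invariant vector field of \<open>\<sigma>\<close>: the right
  translation by \<open>g\<close> is only defined on a source fiber, hence the curve in that fiber.\<close>

definition right_inv_deriv ::
  "('g, 'm) groupoid \<Rightarrow> ('m \<Rightarrow> 'g tvec) \<Rightarrow> ('g \<Rightarrow> real) \<Rightarrow> 'g \<Rightarrow> real"
  where "right_inv_deriv G \<sigma> f g = (THE r. \<forall>\<gamma>.
    smooth_map_at real_line (arr G) \<gamma> 0 \<and> \<gamma> 0 = gunit G (tgt G g) \<and>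
    (\<forall>t. src G (\<gamma> t) = tgt G g) \<and> velocity (arr G) \<gamma> 0 = \<sigma> (tgt G g) \<longrightarrow>
    r = deriv (\<lambda>t. f (gmult G (\<gamma> t) g)) 0)"

text \<open>\<open>A\<close> is the Lie algebroid of \<open>G\<close>: the kernel of the tangent map of the source along the
  units, the tangent map of the target as anchor, and the bracket of right-invariant
  vector fields.\<close>

definition lie_algebroid_of :: "('g, 'm) groupoid \<Rightarrow> ('m, 'g tvec) algebroid \<Rightarrow> bool"
  where "lie_algebroid_of G A \<longleftrightarrow>
    lie_algebroid (base G) A \<and>
    (\<forall>p\<in>pts (base G).
       fib A p = {v \<in> tangent_space (arr G) (gunit G p). tmap (base G) (src G) p v = 0} \<and>
       (\<forall>v\<in>fib A p. anchor A p v = tmap (base G) (tgt G) p v)) \<and>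
    (\<forall>p\<in>pts (base G). \<forall>\<sigma>. smooth_section_at (base G) A p \<sigma> \<longleftrightarrow>
       near (base G) p (\<lambda>q. \<sigma> q \<in> fib A q) \<and>
       (\<forall>f. smooth_at (arr G) (gunit G p) f \<longrightarrow> smooth_at (base G) p (\<lambda>q. \<sigma> q f))) \<and>
    (\<forall>p \<sigma> \<tau>. smooth_section_at (base G) A p \<sigma> \<and> smooth_section_at (base G) A p \<tau> \<longrightarrow>
       (\<forall>f. smooth_at (arr G) (gunit G p) f \<longrightarrow>
          brac A \<sigma> \<tau> p f =
            \<sigma> p (right_inv_deriv G \<tau> f) - \<tau> p (right_inv_deriv G \<sigma> f)))"

definition nonzero_bracket :: "'m mfd \<Rightarrow> ('m, 'a::real_vector) algebroid \<Rightarrow> bool"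
  where "nonzero_bracket M A \<longleftrightarrow> (\<exists>p \<sigma> \<tau>.
    smooth_section_at M A p \<sigma> \<and> smooth_section_at M A p \<tau> \<and> brac A \<sigma> \<tau> p \<noteq> 0)"


section \<open>Isotropy and the co-adjoint action\<close>

definition isotropy :: "('g, 'm) groupoid \<Rightarrow> 'm \<Rightarrow> 'g set"
  where "isotropy G p = {g \<in> pts (arr G). src G g = p \<and> tgt G g = p}"

text \<open>The fiber at \<open>p\<close> of the Lie algebroid of the isotropy groupoid.\<close>

definition iso_alg :: "('g, 'm) groupoid \<Rightarrow> 'm \<Rightarrow> 'g tvec set"
  where "iso_alg G p = {velocity (arr G) \<gamma> 0 | \<gamma>. smooth_map_at real_line (arr G) \<gamma> 0 \<and>
     \<gamma> 0 = gunit G p \<and> (\<forall>t. \<gamma> t \<in> isotropy G p)}"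

definition iso_section_at ::
  "('g, 'm) groupoid \<Rightarrow> ('m, 'g tvec) algebroid \<Rightarrow> 'm \<Rightarrow> ('m \<Rightarrow> 'g tvec) \<Rightarrow> bool"
  where "iso_section_at G A p Y \<longleftrightarrow>
    smooth_section_at (base G) A p Y \<and> near (base G) p (\<lambda>q. Y q \<in> iso_alg G q)"

definition Exp :: "('g, 'm) groupoid \<Rightarrow> 'm \<Rightarrow> 'g tvec \<Rightarrow> 'g"
  where "Exp G p X = (THE \<gamma>. (\<forall>t. smooth_map_at real_line (arr G) \<gamma> t \<and> \<gamma> t \<in> isotropy G p) \<and>
     (\<forall>s t. \<gamma> (s + t) = gmult G (\<gamma> s) (\<gamma> t)) \<and> velocity (arr G) \<gamma> 0 = X) 1"

definition Ad :: "('g, 'm) groupoid \<Rightarrow> 'g \<Rightarrow> 'g tvec \<Rightarrow> 'g tvec"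
  where "Ad G g X =
    velocity (arr G) (\<lambda>t. gmult G g (gmult G (Exp G (src G g) (t *\<^sub>R X)) (ginv G g))) 0"

text \<open>\<open>Ad_star G g\<close> maps covectors at the source of \<open>g\<close> to covectors at its target.\<close>

definition Ad_star :: "('g, 'm) groupoid \<Rightarrow> 'g \<Rightarrow> ('g tvec \<Rightarrow> real) \<Rightarrow> 'g tvec \<Rightarrow> real"
  where "Ad_star G g \<xi> = (\<lambda>X. if X \<in> iso_alg G (tgt G g) then \<xi> (Ad G (ginv G g) X) else 0)"

text \<open>The element \<open>\<xi>\<close> that defines the orbit has to be given at every point of the base (there is
  a unit \<open>Ad\<^sup>*\<xi>\<close> over each point), so it is a nowhere vanishing smooth section of the dual of the
  isotropy algebroid.\<close>

definition coadjoint_element ::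
  "('g, 'm) groupoid \<Rightarrow> ('m, 'g tvec) algebroid \<Rightarrow> ('m \<Rightarrow> 'g tvec \<Rightarrow> real) \<Rightarrow> bool"
  where "coadjoint_element G A \<xi> \<longleftrightarrow>
    (\<forall>p\<in>pts (base G). \<xi> p \<in> dual_of (iso_alg G p) \<and> \<xi> p \<noteq> 0) \<and>
    (\<forall>p Y. iso_section_at G A p Y \<longrightarrow> smooth_at (base G) p (\<lambda>q. \<xi> q (Y q)))"

definition stabilizer :: "('g, 'm) groupoid \<Rightarrow> ('m \<Rightarrow> 'g tvec \<Rightarrow> real) \<Rightarrow> 'g set"
  where "stabilizer G \<xi> = {g \<in> pts (arr G). Ad_star G g (\<xi> (src G g)) = \<xi> (tgt G g)}"

text \<open>A (wide) Lie subgroupoid, i.e. an injectively immersed one, is normal if it is stable under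
  conjugation of its isotropy elements.\<close>

definition normal_lie_subgroupoid :: "('g, 'm) groupoid \<Rightarrow> 'g set \<Rightarrow> bool"
  where "normal_lie_subgroupoid G K \<longleftrightarrow>
    K \<subseteq> pts (arr G) \<and>
    (\<exists>N. pts N = K \<and> lie_groupoid (G\<lparr>arr := N\<rparr>) \<and> smooth_map N (arr G) (\<lambda>g. g) \<and>
       (\<forall>g\<in>K. inj_on (tmap (arr G) (\<lambda>g. g) g) (tangent_space N g))) \<and>
    (\<forall>g\<in>pts (arr G). \<forall>k\<in>K \<inter> isotropy G (src G g). gmult G g (gmult G k (ginv G g)) \<in> K)"

text \<open>The arrow \<open>Ad\<^sup>*_g \<xi>\<close> of the co-adjoint groupoid.  It carries its source and target, as
  required for the source map \<open>Ad\<^sup>*_g \<xi> \<mapsto> \<alpha>(g)\<close> to be well defined; the covector alone need not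
  determine the source.\<close>

type_synonym ('g, 'm) coarrow = "'m \<times> 'm \<times> ('g tvec \<Rightarrow> real)"

definition coadj :: "('g, 'm) groupoid \<Rightarrow> ('m \<Rightarrow> 'g tvec \<Rightarrow> real) \<Rightarrow> 'g \<Rightarrow> ('g, 'm) coarrow"
  where "coadj G \<xi> g = (src G g, tgt G g, Ad_star G g (\<xi> (src G g)))"

text \<open>The smooth structure on the orbit is the quotient one, i.e. the one making
  \<open>g \<mapsto> Ad\<^sup>*_g \<xi>\<close> a submersion.\<close>

definition coadjoint_groupoid ::
  "('g, 'm) groupoid \<Rightarrow> ('m \<Rightarrow> 'g tvec \<Rightarrow> real) \<Rightarrow> (('g, 'm) coarrow, 'm) groupoid \<Rightarrow> bool"
  where "coadjoint_groupoid G \<xi> Q \<longleftrightarrow>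
    lie_groupoid Q \<and> base Q = base G \<and>
    pts (arr Q) = coadj G \<xi> ` pts (arr G) \<and> submersion (arr G) (arr Q) (coadj G \<xi>) \<and>
    (\<forall>g\<in>pts (arr G). src Q (coadj G \<xi> g) = src G g \<and> tgt Q (coadj G \<xi> g) = tgt G g \<and>
       ginv Q (coadj G \<xi> g) = coadj G \<xi> (ginv G g)) \<and>
    (\<forall>(g, h)\<in>composable G. gmult Q (coadj G \<xi> g) (coadj G \<xi> h) = coadj G \<xi> (gmult G g h)) \<and>
    (\<forall>p\<in>pts (base G). gunit Q p = coadj G \<xi> (gunit G p))"

text \<open>\<open>\<langle>ad\<^sup>*_X \<xi>, Y\<rangle> = \<langle>\<xi>, [Y, X]\<rangle>\<close>.  The right-hand side at \<open>p\<close> depends on \<open>X\<close> only through its value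
  at \<open>p\<close>, but on the first-order jet of \<open>Y\<close> when the anchor of \<open>X\<close> does not vanish; hence
  \<open>ad\<^sup>*_X \<xi>\<close> at \<open>p\<close> is a functional on (germs of) sections \<open>Y\<close> of the isotropy algebroid.\<close>

definition ad_star ::
  "('g, 'm) groupoid \<Rightarrow> ('m, 'g tvec) algebroid \<Rightarrow> ('m \<Rightarrow> 'g tvec \<Rightarrow> real) \<Rightarrow>
   ('m \<Rightarrow> 'g tvec) \<Rightarrow> 'm \<Rightarrow> ('m \<Rightarrow> 'g tvec) \<Rightarrow> real"
  where "ad_star G A \<xi> X p = (\<lambda>Y. if iso_section_at G A p Y then \<xi> p (brac A Y X p) else 0)"

text \<open>\<open>B\<close> is the co-adjoint Lie algebroid: its fibers consist of the \<open>ad\<^sup>*_X \<xi>\<close>, and it is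
  the Lie algebroid of the co-adjoint groupoid \<open>Q\<close> when \<open>ad\<^sup>*_X \<xi>\<close> is identified with the image
  of \<open>X\<close> under the tangent map of \<open>g \<mapsto> Ad\<^sup>*_g \<xi>\<close>.  The bracket and anchor formulas are the known
  description of this structure.\<close>

definition coadjoint_algebroid ::
  "('g, 'm) groupoid \<Rightarrow> ('m, 'g tvec) algebroid \<Rightarrow> ('m \<Rightarrow> 'g tvec \<Rightarrow> real) \<Rightarrow>
   (('g, 'm) coarrow, 'm) groupoid \<Rightarrow> ('m, ('m \<Rightarrow> 'g tvec) \<Rightarrow> real) algebroid \<Rightarrow> bool"
  where "coadjoint_algebroid G A \<xi> Q B \<longleftrightarrow>
    lie_algebroid (base G) B \<and>
    (\<forall>p\<in>pts (base G). fib B p = {ad_star G A \<xi> X p | X. smooth_section_at (base G) A p X}) \<and>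
    (\<exists>A' \<Psi>. lie_algebroid_of Q A' \<and> algebroid_iso (base G) A' B \<Psi> \<and>
       (\<forall>p X. smooth_section_at (base G) A p X \<longrightarrow>
          \<Psi> p (tmap (arr Q) (coadj G \<xi>) (gunit Q p) (X p)) = ad_star G A \<xi> X p)) \<and>
    (\<forall>p X Y. smooth_section_at (base G) A p X \<and> smooth_section_at (base G) A p Y \<longrightarrow>
       anchor B p (ad_star G A \<xi> X p) = anchor A p (X p) \<and>
       brac B (ad_star G A \<xi> X) (ad_star G A \<xi> Y) p = ad_star G A \<xi> (brac A X Y) p)"


section \<open>Prolongations\<close>

definition prolongation ::
  "'m mfd \<Rightarrow> ('m, 'a::real_vector) algebroid \<Rightarrow> 'e mfd \<Rightarrow> ('e \<Rightarrow> 'm) \<Rightarrow> 'e \<Rightarrow> ('a \<times> 'e tvec) set"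
  where "prolongation M A E \<mu> q = {(X, V). X \<in> fib A (\<mu> q) \<and> V \<in> tangent_space E q \<and>
    anchor A (\<mu> q) X = tmap M \<mu> (\<mu> q) V}"

definition projectable_at ::
  "'m mfd \<Rightarrow> ('m, 'a::real_vector) algebroid \<Rightarrow> 'e mfd \<Rightarrow> ('e \<Rightarrow> 'm) \<Rightarrow> 'e \<Rightarrow>
   ('m \<Rightarrow> 'a) \<times> ('e \<Rightarrow> 'e tvec) \<Rightarrow> bool"
  where "projectable_at M A E \<mu> q = (\<lambda>(\<sigma>, V).
    smooth_section_at M A (\<mu> q) \<sigma> \<and> vector_field_at E q V \<and>
    near E q (\<lambda>q'. (\<sigma> (\<mu> q'), V q') \<in> prolongation M A E \<mu> q'))"

definition prol_value ::
  "('e \<Rightarrow> 'm) \<Rightarrow> ('m \<Rightarrow> 'a) \<times> ('e \<Rightarrow> 'e tvec) \<Rightarrow> 'e \<Rightarrow> 'a \<times> 'e tvec"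
  where "prol_value \<mu> = (\<lambda>(\<sigma>, V) q. (\<sigma> (\<mu> q), V q))"

definition prol_anchor :: "'a \<times> 'e tvec \<Rightarrow> 'e tvec"
  where "prol_anchor z = snd z"

definition prol_bracket ::
  "('m, 'a::real_vector) algebroid \<Rightarrow> 'e mfd \<Rightarrow>
   ('m \<Rightarrow> 'a) \<times> ('e \<Rightarrow> 'e tvec) \<Rightarrow> ('m \<Rightarrow> 'a) \<times> ('e \<Rightarrow> 'e tvec) \<Rightarrow> ('m \<Rightarrow> 'a) \<times> ('e \<Rightarrow> 'e tvec)"
  where "prol_bracket A E = (\<lambda>(\<sigma>\<^sub>1, V\<^sub>1) (\<sigma>\<^sub>2, V\<^sub>2). (brac A \<sigma>\<^sub>1 \<sigma>\<^sub>2, vf_bracket E V\<^sub>1 V\<^sub>2))"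

text \<open>The Lie algebroid differential on the prolongation, on functions and on 1-forms.  The value of
  \<open>d\<Theta>\<close> on two elements is computed from any projectable sections extending them.\<close>

definition prol_d0 :: "('e \<Rightarrow> real) \<Rightarrow> 'a \<times> 'e tvec \<Rightarrow> real"
  where "prol_d0 h z = prol_anchor z h"

definition prol_d1 ::
  "'m mfd \<Rightarrow> ('m, 'a::real_vector) algebroid \<Rightarrow> 'e mfd \<Rightarrow> ('e \<Rightarrow> 'm) \<Rightarrow>
   ('e \<Rightarrow> 'a \<times> 'e tvec \<Rightarrow> real) \<Rightarrow> 'e \<Rightarrow> 'a \<times> 'e tvec \<Rightarrow> 'a \<times> 'e tvec \<Rightarrow> real"
  where "prol_d1 M A E \<mu> \<Theta> q z\<^sub>1 z\<^sub>2 = (THE r. \<forall>Z\<^sub>1 Z\<^sub>2.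
    projectable_at M A E \<mu> q Z\<^sub>1 \<and> projectable_at M A E \<mu> q Z\<^sub>2 \<and>
    prol_value \<mu> Z\<^sub>1 q = z\<^sub>1 \<and> prol_value \<mu> Z\<^sub>2 q = z\<^sub>2 \<longrightarrow>
    r = prol_anchor z\<^sub>1 (\<lambda>q'. \<Theta> q' (prol_value \<mu> Z\<^sub>2 q'))
      - prol_anchor z\<^sub>2 (\<lambda>q'. \<Theta> q' (prol_value \<mu> Z\<^sub>1 q'))
      - \<Theta> q (prol_value \<mu> (prol_bracket A E Z\<^sub>1 Z\<^sub>2) q))"

definition canonical_form :: "'m \<times> ('a \<Rightarrow> real) \<Rightarrow> 'a \<times> ('m \<times> ('a \<Rightarrow> real)) tvec \<Rightarrow> real"
  where "canonical_form q z = snd q (fst z)"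

definition canonical_symplectic ::
  "'m mfd \<Rightarrow> ('m, 'a::real_vector) algebroid \<Rightarrow> 'm \<times> ('a \<Rightarrow> real) \<Rightarrow>
   'a \<times> ('m \<times> ('a \<Rightarrow> real)) tvec \<Rightarrow> 'a \<times> ('m \<times> ('a \<Rightarrow> real)) tvec \<Rightarrow> real"
  where "canonical_symplectic M A q z\<^sub>1 z\<^sub>2 = - prol_d1 M A (dual_mfd M A) fst canonical_form q z\<^sub>1 z\<^sub>2"


section \<open>Optimal control on a Lie algebroid\<close>

definition pr1 :: "'m \<times> ('a \<Rightarrow> real) \<times> 'c \<Rightarrow> 'm \<times> ('a \<Rightarrow> real)"
  where "pr1 = (\<lambda>(p, \<eta>, u). (p, \<eta>))"

definition control_system ::
  "'m mfd \<Rightarrow> ('m, 'a::real_vector) algebroid \<Rightarrow> ('m, 'c::real_vector) vbundle \<Rightarrow>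
   ('m \<times> 'c \<Rightarrow> 'a) \<Rightarrow> bool"
  where "control_system M A C f \<longleftrightarrow>
    (\<forall>(p, u)\<in>pts (total_mfd M C). f (p, u) \<in> fib A p) \<and>
    smooth_map (total_mfd M C) (total_mfd M A) (\<lambda>(p, u). (p, f (p, u)))"

definition control_hamiltonian ::
  "('m \<times> 'c \<Rightarrow> 'a) \<Rightarrow> ('m \<times> 'c \<Rightarrow> real) \<Rightarrow> 'm \<times> ('a \<Rightarrow> real) \<times> 'c \<Rightarrow> real"
  where "control_hamiltonian f L = (\<lambda>(p, \<eta>, u). \<eta> (f (p, u)) - L (p, u))"

text \<open>\<open>z\<close> is the value at \<open>w\<close> of the Hamiltonian control system: \<open>i_z \<omega> = dH\<close> at \<open>w\<close>, an equation on
  the prolongation of the fibered product, to which \<open>\<omega>\<close> is pulled back along \<open>pr1\<close>.  It is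
  defined at those \<open>w\<close> where such a \<open>z\<close> exists.\<close>

definition hamiltonian_control_system ::
  "'m mfd \<Rightarrow> ('m, 'a::real_vector) algebroid \<Rightarrow> ('m, 'c::real_vector) vbundle \<Rightarrow>
   ('m \<times> ('a \<Rightarrow> real) \<times> 'c \<Rightarrow> real) \<Rightarrow> 'm \<times> ('a \<Rightarrow> real) \<times> 'c \<Rightarrow>
   'a \<times> ('m \<times> ('a \<Rightarrow> real)) tvec \<Rightarrow> bool"
  where "hamiltonian_control_system M A C H w z \<longleftrightarrow>
    z \<in> prolongation M A (dual_mfd M A) fst (pr1 w) \<and>
    (\<forall>(X, W) \<in> prolongation M A (dual_times_mfd M A C) fst w.
       canonical_symplectic M A (pr1 w) z (X, tmap (dual_mfd M A) pr1 (pr1 w) W) = prol_d0 H (X, W))"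

text \<open>\<open>\<gamma>\<close> is an integral curve, on the time domain \<open>J\<close>, of the image of the Hamiltonian control system
  under the anchor: the velocity of \<open>pr1 \<circ> \<gamma>\<close> is the anchor of its value along \<open>\<gamma>\<close>.\<close>

definition critical_trajectory ::
  "'m mfd \<Rightarrow> ('m, 'a::real_vector) algebroid \<Rightarrow> ('m, 'c::real_vector) vbundle \<Rightarrow>
   ('m \<times> 'c \<Rightarrow> 'a) \<Rightarrow> ('m \<times> 'c \<Rightarrow> real) \<Rightarrow> real set \<Rightarrow>
   (real \<Rightarrow> 'm \<times> ('a \<Rightarrow> real) \<times> 'c) \<Rightarrow> bool"
  where "critical_trajectory M A C f L J \<gamma> \<longleftrightarrow>
    (\<forall>t\<in>J. \<gamma> t \<in> pts (dual_times_mfd M A C) \<and>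
       (\<exists>z. hamiltonian_control_system M A C (control_hamiltonian f L) (\<gamma> t) z \<and>
          (\<forall>h. smooth_at (dual_mfd M A) (pr1 (\<gamma> t)) h \<longrightarrow>
             ((h \<circ> pr1 \<circ> \<gamma>) has_real_derivative prol_anchor z h) (at t))))"

end

(* The co-adjoint Lie algebroid has the same structure functions as AG: its anchor and bracket on the
   sections ad* e_alpha are known, and X(p) -> (ad* X xi)(p) is linear because it factors through the
   tangent map of g -> Ad*_g xi.  So it suffices to treat an arbitrary Lie algebroid A in a chart
   and a local frame.

   There d theta is computed from the bracket alone: for projectable sections Z_k = (sigma_k, V_k),
   theta(Z_k) = <eta, sigma_k>, and expanding sigma_k in the frame the derivatives of the coefficients
   cancel, leaving V_1(eta_a) X_2^a - V_2(eta_a) X_1^a - eta_c C^c_ab X_1^a X_2^b; the bracket of the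
   vector fields V_k never enters.  Comparing the coefficients of X', of the fiber components and of
   the control components in omega(z, .) = dH gives the value of z and the condition dH/du = 0, and a
   curve is an integral curve of z iff its coordinates are.

   Smoothness is expressed by iterated partial derivatives, so the chain rule comes from the mean value
   theorem applied to one coordinate after the other. *)

theory Submission
  imports Defs
begin

section \<open>Calculus on Euclidean n-space\<close>

text \<open>The chart \<open>x\<close> and the frame of sections need not belong to the atlases from
  which the total spaces are built, so the coordinates they induce on the dual bundle and on its
  fibered product with \<open>C\<close> first have to be proved compatible with those atlases. The
  three kinds of total space share one pattern: a base chart together with fibre coordinates that
  change linearly with coefficients smooth on the base. They are therefore treated together in
  \<open>fibered_mfd\<close>. Functions, sections and vector fields are total, with arbitrary values
  away from the point considered. Identities are thus proved \<open>near\<close> a point and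
  transported by the locality of tangent vectors and brackets. The differential
  \<open>prol_d1\<close> is a definite description over all projectable extensions. Evaluating it
  takes independence of the extension and also the existence of one, which has to be constructed so
  that the anchor condition holds on a whole neighbourhood.\<close>

abbreviation EE :: "nat \<Rightarrow> (nat \<Rightarrow> real) set"
  where "EE n \<equiv> topspace (Euclidean_space n)"

text \<open>Replaces the abstract topology by a subspace of \<open>nat \<Rightarrow> real\<close>
  with its type-class topology, so that filters, \<open>continuous_on\<close> and limits of real
  functions become available.\<close>

lemma Euclidean_space_top_of_set: "Euclidean_space n = top_of_set (EE n)"
  by (simp add: Euclidean_space_def topspace_Euclidean_space euclidean_product_topology)

lemma openin_Euclidean_space_iff: "openin (Euclidean_space n) S \<longleftrightarrow> openin (top_of_set (EE n)) S"
  by (subst Euclidean_space_top_of_set) (rule refl)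

lemma EE_iff: "x \<in> EE n \<longleftrightarrow> (\<forall>i\<ge>n. x i = 0)"
  by (simp add: topspace_Euclidean_space)

lemma fun_upd_EE: "x \<in> EE n \<Longrightarrow> i < n \<Longrightarrow> x(i := t) \<in> EE n"
  by (auto simp: EE_iff)

lemma tendsto_coordinatewise:
  fixes c :: "'a \<Rightarrow> nat \<Rightarrow> real"
  assumes "\<And>i. ((\<lambda>t. c t i) \<longlongrightarrow> x i) F"
  shows "(c \<longlongrightarrow> x) F"
proof -
  have "limitin (product_topology (\<lambda>i. euclidean) UNIV) c x F"
    using assms by (auto simp: limitin_componentwise)
  then show ?thesis
    by (simp add: euclidean_product_topology)
qed

text \<open>Only the first \<open>n\<close> coordinates need a limit: from index \<open>n\<close>
  on, the limit and eventually the curve are zero.\<close>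

lemma tendsto_EE:
  assumes "x \<in> EE n" "\<And>i. i < n \<Longrightarrow> ((\<lambda>t. c t i) \<longlongrightarrow> x i) F" "\<forall>\<^sub>F t in F. c t \<in> EE n"
  shows "(c \<longlongrightarrow> x) F"
proof (rule tendsto_coordinatewise)
  fix i
  show "((\<lambda>t. c t i) \<longlongrightarrow> x i) F"
  proof (cases "i < n")
    case False
    have "\<forall>\<^sub>F t in F. c t i = x i"
      using assms(3) by eventually_elim (use False assms(1) in \<open>auto simp: EE_iff\<close>)
    then show ?thesis
      by (rule tendsto_eventually)
  qed (use assms in auto)
qed

lemma eventually_in_open:
  assumes "openin (Euclidean_space n) S" "x \<in> S"
    and "\<And>i. i < n \<Longrightarrow> ((\<lambda>t. c t i) \<longlongrightarrow> x i) F" "\<forall>\<^sub>F t in F. c t \<in> EE n"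
  shows "\<forall>\<^sub>F t in F. c t \<in> S"
proof -
  have "x \<in> EE n"
    using assms(1,2) openin_subset by blast
  then have lim: "(c \<longlongrightarrow> x) F"
    using tendsto_EE assms(3,4) by blast
  obtain T where T: "open T" "S = EE n \<inter> T"
    using assms(1)[unfolded openin_Euclidean_space_iff] by (auto simp: openin_open)
  have "\<forall>\<^sub>F t in F. c t \<in> T"
    using lim T assms(2) by (auto dest: topological_tendstoD)
  with assms(4) show ?thesis
    by eventually_elim (use T in auto)
qed

text \<open>Points outside \<open>S\<close> in boxes of half-width 1/(k+1) would converge to
  \<open>x\<close>, against openness. A box contains every point reached by moving one coordinate at
  a time, which the mean value argument needs.\<close>

lemma open_box:
  assumes "openin (Euclidean_space n) S" "x \<in> S"
  obtains \<epsilon> where "\<epsilon> > 0" "\<And>y. y \<in> EE n \<Longrightarrow> (\<And>i. i < n \<Longrightarrow> \<bar>y i - x i\<bar> < \<epsilon>) \<Longrightarrow> y \<in> S"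
proof (rule ccontr)
  assume "\<not> thesis"
  then have "\<exists>y. y \<in> EE n \<and> (\<forall>i<n. \<bar>y i - x i\<bar> < inverse (real (Suc k))) \<and> y \<notin> S" for k
    using that[of "inverse (real (Suc k))"] by (rule contrapos_np) auto
  then obtain y where y: "\<And>k. y k \<in> EE n" "\<And>k i. i < n \<Longrightarrow> \<bar>y k i - x i\<bar> < inverse (real (Suc k))"
      "\<And>k. y k \<notin> S"
    by metis
  have "(\<lambda>k. y k i) \<longlonglongrightarrow> x i" if "i < n" for i
  proof (rule LIM_zero_cancel, rule tendsto_rabs_zero_cancel, rule tendsto_sandwich[OF _ _ tendsto_const LIMSEQ_inverse_real_of_nat])
    show "\<forall>\<^sub>F k in sequentially. \<bar>y k i - x i\<bar> \<le> inverse (real (Suc k))"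
      using y(2)[OF that] by (intro always_eventually) (auto intro: less_imp_le)
  qed auto
  then have "\<forall>\<^sub>F k in sequentially. y k \<in> S"
    using y(1) by (intro eventually_in_open[OF assms] always_eventually allI) auto
  then show False
    using y(3) eventually_happens'[OF sequentially_bot] by blast
qed

lemma continuous_map_Euclidean_iff:
  "continuous_map (subtopology (Euclidean_space n) S) euclideanreal f \<longleftrightarrow> continuous_on (EE n \<inter> S) f"
  by (subst Euclidean_space_top_of_set) (simp add: subtopology_subtopology)

lemma continuous_map_tendsto:
  assumes "continuous_map (subtopology (Euclidean_space n) S) euclideanreal f"
    and "openin (Euclidean_space n) S" "x \<in> S"
    and "\<And>i. i < n \<Longrightarrow> ((\<lambda>t. c t i) \<longlongrightarrow> x i) F" "\<forall>\<^sub>F t in F. c t \<in> EE n"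
  shows "((\<lambda>t. f (c t)) \<longlongrightarrow> f x) F"
proof -
  have x: "x \<in> EE n"
    using assms openin_subset by blast
  have "\<forall>\<^sub>F t in F. c t \<in> S"
    using assms(2-5) by (rule eventually_in_open)
  with assms(5) have ev: "\<forall>\<^sub>F t in F. c t \<in> EE n \<inter> S"
    by eventually_elim auto
  show ?thesis
    using continuous_on_tendsto_compose[OF assms(1)[unfolded continuous_map_Euclidean_iff]
        tendsto_EE[OF x assms(4,5)] _ ev] x assms(3) by auto
qed

lemma eventually_fun_upd:
  assumes "openin (Euclidean_space n) S" "x \<in> S" "i < n"
  shows "\<forall>\<^sub>F t in nhds (x i). x(i := t) \<in> S"
proof (rule eventually_in_open[OF assms(1,2)])
  have "x \<in> EE n"
    using assms openin_subset by blast
  then show "\<forall>\<^sub>F t in nhds (x i). x(i := t) \<in> EE n"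
    using assms(3) by (auto intro: always_eventually fun_upd_EE)
  show "((\<lambda>t. (x(i := t)) j) \<longlongrightarrow> x j) (nhds (x i))" for j
  proof (cases "j = i")
    case True
    then show ?thesis
      using filterlim_ident[of "nhds (x i)"] by (simp only: fun_upd_same)
  next
    case False
    then show ?thesis
      by simp
  qed
qed

section \<open>Partial derivatives and the chain rule along a curve\<close>

lemma pd_cong:
  assumes "openin (Euclidean_space n) S" "x \<in> S" "i < n" "\<And>y. y \<in> S \<Longrightarrow> f y = g y"
  shows "pd i f x = pd i g x"
  unfolding pd_def
  by (rule deriv_cong_ev[OF _ refl], rule eventually_mono[OF eventually_fun_upd[OF assms(1-3)]])
    (use assms in auto)

lemma differentiable_pd:
  assumes "(\<lambda>t. f (x(i := t))) differentiable (at (x i))"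
  shows "((\<lambda>t. f (x(i := t))) has_real_derivative pd i f x) (at (x i))"
  using assms unfolding pd_def by (simp add: DERIV_deriv_iff_real_differentiable)

lemma pd_eqI: "((\<lambda>t. f (x(i := t))) has_real_derivative d) (at (x i)) \<Longrightarrow> pd i f x = d"
  unfolding pd_def by (rule DERIV_imp_deriv)

text \<open>The end point \<open>b\<close> will be a value of a moving coordinate, which may lie on
  either side of \<open>a\<close> or coincide with it; the weak inequalities cover the degenerate
  case.\<close>

lemma mvt_unordered:
  fixes g g' :: "real \<Rightarrow> real"
  assumes "\<And>u. min a b \<le> u \<Longrightarrow> u \<le> max a b \<Longrightarrow> (g has_real_derivative g' u) (at u)"
  shows "\<exists>\<zeta>. min a b \<le> \<zeta> \<and> \<zeta> \<le> max a b \<and> g b - g a = (b - a) * g' \<zeta>"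
proof -
  consider "a = b" | "a < b" | "b < a"
    by linarith
  then show ?thesis
  proof cases
    case 2
    then obtain z where "a < z" "z < b" "g b - g a = (b - a) * g' z"
      using MVT2[of a b g g'] assms by auto
    then show ?thesis
      by (intro exI[of _ z]) auto
  next
    case 3
    then obtain z where "b < z" "z < a" "g a - g b = (a - b) * g' z"
      using MVT2[of b a g g'] assms by auto
    then show ?thesis
      by (intro exI[of _ z]) (auto simp: algebra_simps)
  qed auto
qed

text \<open>The quotient is the difference quotient of \<open>w\<close> times \<open>pd k f\<close>
  at a mean value point, and continuity of \<open>pd k f\<close> gives the limit. The other
  coordinates may move with \<open>t\<close>; only their convergence to \<open>x\<close>
  enters.\<close>

lemma partial_increment:
  fixes y :: "real \<Rightarrow> nat \<Rightarrow> real" and w :: "real \<Rightarrow> real"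
  assumes S: "openin (Euclidean_space n) S" "x \<in> S" and f: "Ck_on n (Suc 0) S f" and k: "k < n"
    and y: "\<forall>\<^sub>F t in at t0. y t \<in> EE n" "\<And>i. i < n \<Longrightarrow> ((\<lambda>t. y t i) \<longlongrightarrow> x i) (at t0)"
    and yk: "\<And>t. y t k = x k" and w: "(w has_real_derivative w') (at t0)" "w t0 = x k"
  shows "((\<lambda>t. (f ((y t)(k := w t)) - f (y t)) / (t - t0)) \<longlongrightarrow> w' * pd k f x) (at t0)"
proof -
  obtain \<epsilon> where \<epsilon>: "\<epsilon> > 0" "\<And>y. y \<in> EE n \<Longrightarrow> (\<And>i. i < n \<Longrightarrow> \<bar>y i - x i\<bar> < \<epsilon>) \<Longrightarrow> y \<in> S"
    using open_box[OF S] by blast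
  have wlim: "(w \<longlongrightarrow> x k) (at t0)"
    using DERIV_isCont[OF w(1)] w(2) by (simp add: isCont_def)
  define P where "P t \<zeta> \<longleftrightarrow> \<bar>\<zeta> - x k\<bar> \<le> \<bar>w t - x k\<bar> \<and>
    f ((y t)(k := w t)) - f (y t) = (w t - x k) * pd k f ((y t)(k := \<zeta>))" for t \<zeta>
  have "\<forall>\<^sub>F t in at t0. dist (w t) (x k) < \<epsilon>"
    using wlim \<epsilon>(1) by (rule tendstoD)
  moreover have "\<forall>\<^sub>F t in at t0. \<forall>i\<in>{..<n}. dist (y t i) (x i) < \<epsilon>"
    using y(2) \<epsilon>(1) by (intro eventually_ball_finite) (auto intro: tendstoD)
  ultimately have ev: "\<forall>\<^sub>F t in at t0. \<exists>\<zeta>. P t \<zeta>"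
    using y(1)
  proof eventually_elim
    case (elim t)
    let ?g = "\<lambda>u. f ((y t)(k := u))"
    have "(?g has_real_derivative pd k f ((y t)(k := u))) (at u)"
      if "min (x k) (w t) \<le> u" "u \<le> max (x k) (w t)" for u
    proof -
      have "\<bar>u - x k\<bar> < \<epsilon>"
        using that elim(1) by (auto simp: dist_real_def)
      then have "(y t)(k := u) \<in> S"
        using elim k by (intro \<epsilon>(2) fun_upd_EE) (auto simp: dist_real_def)
      moreover have "\<forall>x\<in>S. (\<lambda>v. f (x(k := v))) differentiable (at (x k))"
        using f k by simp
      ultimately have "(\<lambda>v. f (((y t)(k := u))(k := v))) differentiable (at (((y t)(k := u)) k))"
        by (rule bspec[rotated])
      from differentiable_pd[OF this] show ?thesis
        by (simp only: fun_upd_upd fun_upd_same)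
    qed
    then obtain \<zeta> where "min (x k) (w t) \<le> \<zeta>" "\<zeta> \<le> max (x k) (w t)"
      "?g (w t) - ?g (x k) = (w t - x k) * pd k f ((y t)(k := \<zeta>))"
      using mvt_unordered[of "x k" "w t" ?g "\<lambda>u. pd k f ((y t)(k := u))"] by blast
    moreover have "(y t)(k := x k) = y t"
      using yk by (auto simp: fun_eq_iff)
    ultimately show ?case
      unfolding P_def by (intro exI[of _ \<zeta>]) auto
  qed
  \<comment> \<open>The mean value points are picked separately for each \<open>t\<close>. No
    regularity in \<open>t\<close> is required, since \<open>P\<close> bounds the distance of
    \<open>z t\<close> from \<open>x k\<close> by that of \<open>w t\<close>.\<close>
  define z where "z t = (SOME \<zeta>. P t \<zeta>)" for t
  have evz: "\<forall>\<^sub>F t in at t0. P t (z t)"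
    using ev unfolding z_def by eventually_elim (rule someI_ex)
  have wlim0: "((\<lambda>t. \<bar>w t - x k\<bar>) \<longlongrightarrow> 0) (at t0)"
    by (rule tendsto_rabs_zero[OF LIM_zero[OF wlim]])
  have "((\<lambda>t. \<bar>z t - x k\<bar>) \<longlongrightarrow> 0) (at t0)"
  proof (rule tendsto_sandwich[OF _ _ tendsto_const wlim0])
    show "\<forall>\<^sub>F t in at t0. 0 \<le> \<bar>z t - x k\<bar>"
      by simp
    show "\<forall>\<^sub>F t in at t0. \<bar>z t - x k\<bar> \<le> \<bar>w t - x k\<bar>"
      using evz by (rule eventually_mono) (simp add: P_def)
  qed
  then have zlim: "(z \<longlongrightarrow> x k) (at t0)"
    by (rule LIM_zero_cancel[OF tendsto_rabs_zero_cancel])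
  have "((\<lambda>t. pd k f ((y t)(k := z t))) \<longlongrightarrow> pd k f x) (at t0)"
  proof (rule continuous_map_tendsto[OF _ S])
    show "continuous_map (subtopology (Euclidean_space n) S) euclideanreal (pd k f)"
      using f k by auto
    show "\<forall>\<^sub>F t in at t0. (y t)(k := z t) \<in> EE n"
      using y(1) by eventually_elim (use k in \<open>auto intro: fun_upd_EE\<close>)
    show "((\<lambda>t. ((y t)(k := z t)) i) \<longlongrightarrow> x i) (at t0)" if "i < n" for i
      using y(2)[OF that] zlim by (cases "i = k") auto
  qed
  moreover have "((\<lambda>t. (w t - w t0) / (t - t0)) \<longlongrightarrow> w') (at t0)"
    using w(1) by (simp add: has_field_derivative_iff)
  ultimately have "((\<lambda>t. (w t - w t0) / (t - t0) * pd k f ((y t)(k := z t))) \<longlongrightarrow> w' * pd k f x) (at t0)"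
    by (intro tendsto_mult)
  moreover have "\<forall>\<^sub>F t in at t0. (w t - w t0) / (t - t0) * pd k f ((y t)(k := z t))
      = (f ((y t)(k := w t)) - f (y t)) / (t - t0)"
    using evz by eventually_elim (auto simp: P_def w(2))
  ultimately show ?thesis
    by (rule Lim_transform_eventually)
qed

lemma DERIV_along_curve:
  assumes S: "openin (Euclidean_space n) S" "c t0 \<in> S" and f: "Ck_on n (Suc 0) S f"
    and c: "\<forall>\<^sub>F t in at t0. c t \<in> EE n" "\<And>i. i < n \<Longrightarrow> ((\<lambda>t. c t i) has_real_derivative c' i) (at t0)"
  shows "((\<lambda>t. f (c t)) has_real_derivative (\<Sum>i<n. c' i * pd i f (c t0))) (at t0)"
proof -
  \<comment> \<open>A staircase from \<open>c t0\<close> to \<open>c t\<close>: the first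
    \<open>k\<close> coordinates have already moved. Consecutive stages differ in one coordinate, so
    \<open>partial_increment\<close> applies to each of them and the increments telescope.\<close>
  define y where "y k t = (\<lambda>i. if i < k then c t i else c t0 i)" for k t
  have x: "c t0 \<in> EE n"
    using S openin_subset by blast
  have upd: "(y k t)(k := c t k) = y (Suc k) t" for k t
    by (auto simp: y_def fun_eq_iff)
  have clim: "((\<lambda>t. c t i) \<longlongrightarrow> c t0 i) (at t0)" if "i < n" for i
    using DERIV_isCont[OF c(2)[OF that]] by (simp add: isCont_def)
  have "((\<lambda>t. (f (y (Suc k) t) - f (y k t)) / (t - t0)) \<longlongrightarrow> c' k * pd k f (c t0)) (at t0)"
    if k: "k < n" for k
    unfolding upd[symmetric]
  proof (rule partial_increment[OF S f k])
    show "\<forall>\<^sub>F t in at t0. y k t \<in> EE n"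
      using c(1) by eventually_elim (use x k in \<open>auto simp: y_def EE_iff\<close>)
    show "((\<lambda>t. y k t i) \<longlongrightarrow> c t0 i) (at t0)" if "i < n" for i
      using clim[OF that] by (cases "i < k") (simp_all add: y_def)
  qed (use c k in \<open>auto simp: y_def\<close>)
  then have "((\<lambda>t. \<Sum>k<n. (f (y (Suc k) t) - f (y k t)) / (t - t0)) \<longlongrightarrow> (\<Sum>k<n. c' k * pd k f (c t0))) (at t0)"
    by (intro tendsto_sum) auto
  moreover have "\<forall>\<^sub>F t in at t0. (\<Sum>k<n. (f (y (Suc k) t) - f (y k t)) / (t - t0)) = (f (c t) - f (c t0)) / (t - t0)"
    using c(1)
  proof eventually_elim
    case (elim t)
    have "y n t = c t" "y 0 t = c t0"
      using elim x by (auto simp: y_def EE_iff fun_eq_iff)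
    then show ?case
      using sum_lessThan_telescope[of "\<lambda>k. f (y k t)" n] by (simp add: sum_divide_distrib[symmetric])
  qed
  ultimately show ?thesis
    unfolding has_field_derivative_iff by (rule Lim_transform_eventually)
qed

section \<open>Functions of class C^k: closure properties, composition and locality\<close>

lemma Ck_on_cong:
  assumes "openin (Euclidean_space n) S" "\<And>x. x \<in> S \<Longrightarrow> f x = g x" "Ck_on n k S f"
  shows "Ck_on n k S g"
  using assms(2,3)
proof (induction k arbitrary: f g)
  case 0
  then show ?case
    by (auto simp: continuous_map_Euclidean_iff elim: continuous_on_eq)
next
  case (Suc k)
  have cont: "continuous_map (subtopology (Euclidean_space n) S) euclideanreal g"
    using Suc.prems by (auto simp: continuous_map_Euclidean_iff elim: continuous_on_eq)
  have "(\<lambda>t. g (x(i := t))) differentiable (at (x i))" if "i < n" "x \<in> S" for i x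
  proof -
    have "((\<lambda>t. f (x(i := t))) has_real_derivative pd i f x) (at (x i))"
      by (rule differentiable_pd[of f x i]) (use Suc.prems that in simp)
    then have "((\<lambda>t. g (x(i := t))) has_real_derivative pd i f x) (at (x i))"
      by (rule DERIV_cong_ev[THEN iffD1, OF refl _ refl, rotated])
        (rule eventually_mono[OF eventually_fun_upd[OF assms(1) that(2,1)]], use Suc.prems in auto)
    then show ?thesis
      using real_differentiable_def by blast
  qed
  moreover have "Ck_on n k S (pd i g)" if "i < n" for i
  proof (rule Suc.IH[of "pd i f"])
    show "pd i f x = pd i g x" if "x \<in> S" for x
      using pd_cong[OF assms(1) that \<open>i < n\<close>, of f g] Suc.prems(1) by simp
    show "Ck_on n k S (pd i f)"
      using Suc.prems(2) that by simp
  qed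
  ultimately show ?case
    using cont by auto
qed

lemma Ck_on_subset:
  assumes "Ck_on n k S f" "T \<subseteq> S"
  shows "Ck_on n k T f"
  using assms(1)
proof (induction k arbitrary: f)
  case 0
  then show ?case
    using assms(2) by (auto simp: continuous_map_Euclidean_iff intro: continuous_on_subset)
next
  case (Suc k)
  then show ?case
    using assms(2) by (auto simp: continuous_map_Euclidean_iff intro: continuous_on_subset)
qed

lemma Ck_on_Suc_imp: "Ck_on n (Suc k) S f \<Longrightarrow> Ck_on n k S f"
  by (induction k arbitrary: f) auto

lemma Ck_on_continuous: "Ck_on n k S f \<Longrightarrow> continuous_map (subtopology (Euclidean_space n) S) euclideanreal f"
  by (cases k) auto

text \<open>A derivative formula is usually valid on \<open>S\<close> only, whereas
  \<open>pd i f\<close> is a fixed total function; openness of \<open>S\<close> lets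
  \<open>Ck_on_cong\<close> exchange the two.\<close>

lemma Ck_on_SucI:
  assumes "continuous_map (subtopology (Euclidean_space n) S) euclideanreal f"
    and "openin (Euclidean_space n) S"
    and "\<And>i x. i < n \<Longrightarrow> x \<in> S \<Longrightarrow> ((\<lambda>t. f (x(i := t))) has_real_derivative f' i x) (at (x i))"
    and "\<And>i. i < n \<Longrightarrow> Ck_on n k S (f' i)"
  shows "Ck_on n (Suc k) S f"
proof -
  have "Ck_on n k S (pd i f)" if "i < n" for i
    by (rule Ck_on_cong[OF assms(2) _ assms(4)[OF that]]) (rule pd_eqI[symmetric], rule assms(3)[OF that])
  moreover have "(\<lambda>t. f (x(i := t))) differentiable (at (x i))" if "i < n" "x \<in> S" for i x
    using assms(3)[OF that] real_differentiable_def by blast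
  ultimately show ?thesis
    using assms(1) by simp
qed

lemma Ck_on_DERIV:
  assumes "Ck_on n (Suc k) S f" "i < n" "x \<in> S"
  shows "((\<lambda>t. f (x(i := t))) has_real_derivative pd i f x) (at (x i))"
  by (rule differentiable_pd[of f x i]) (use assms in simp)

lemma Ck_on_pd: "Ck_on n (Suc k) S f \<Longrightarrow> i < n \<Longrightarrow> Ck_on n k S (pd i f)"
  by auto

lemma Ck_on_const: "openin (Euclidean_space n) S \<Longrightarrow> Ck_on n k S (\<lambda>x. c)"
proof (induction k arbitrary: c)
  case 0
  then show ?case
    by (auto simp: continuous_map_Euclidean_iff)
next
  case (Suc k)
  then show ?case
    by (intro Ck_on_SucI[where f' = "\<lambda>_ _. 0"]) (auto simp: continuous_map_Euclidean_iff)
qed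

lemma Ck_on_coordinate: "openin (Euclidean_space n) S \<Longrightarrow> Ck_on n k S (\<lambda>x. x j)"
proof -
  assume S: "openin (Euclidean_space n) S"
  have cont: "continuous_map (subtopology (Euclidean_space n) S) euclideanreal (\<lambda>x. x j)"
    by (auto simp: continuous_map_Euclidean_iff intro: continuous_on_product_then_coordinatewise)
  show ?thesis
  proof (cases k)
    case (Suc l)
    show ?thesis
      unfolding Suc
    proof (rule Ck_on_SucI[where f' = "\<lambda>i _. if i = j then 1 else 0", OF cont S])
      fix i and x :: "nat \<Rightarrow> real"
      show "((\<lambda>t. (x(i := t)) j) has_real_derivative (if i = j then 1 else 0)) (at (x i))"
        by (cases "i = j") (auto intro!: derivative_eq_intros)
    qed (auto intro: Ck_on_const S)
  qed (use cont in auto)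
qed

lemma Ck_on_add:
  assumes "openin (Euclidean_space n) S" "Ck_on n k S f" "Ck_on n k S g"
  shows "Ck_on n k S (\<lambda>x. f x + g x)"
  using assms(2,3)
proof (induction k arbitrary: f g)
  case 0
  then show ?case
    by (auto simp: continuous_map_Euclidean_iff intro: continuous_intros)
next
  case (Suc k)
  have "Ck_on n k S (\<lambda>x. pd i f x + pd i g x)" if "i < n" for i
    using Suc that by (intro Suc.IH) auto
  then show ?case
    using Ck_on_continuous[OF Suc.prems(1)] Ck_on_continuous[OF Suc.prems(2)]
    by (intro Ck_on_SucI[where f' = "\<lambda>i x. pd i f x + pd i g x"] DERIV_add assms(1)
        Ck_on_DERIV[OF Suc.prems(1)] Ck_on_DERIV[OF Suc.prems(2)])
      (auto simp: continuous_map_Euclidean_iff intro: continuous_intros)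
qed

lemma Ck_on_mult:
  assumes "openin (Euclidean_space n) S" "Ck_on n k S f" "Ck_on n k S g"
  shows "Ck_on n k S (\<lambda>x. f x * g x)"
  using assms(2,3)
proof (induction k arbitrary: f g)
  case 0
  then show ?case
    by (auto simp: continuous_map_Euclidean_iff intro: continuous_intros)
next
  case (Suc k)
  show ?case
  proof (rule Ck_on_SucI[where f' = "\<lambda>i x. pd i f x * g x + pd i g x * f x"])
    show "continuous_map (subtopology (Euclidean_space n) S) euclideanreal (\<lambda>x. f x * g x)"
      using Ck_on_continuous[OF Suc.prems(1)] Ck_on_continuous[OF Suc.prems(2)]
      by (auto simp: continuous_map_Euclidean_iff intro: continuous_intros)
    show "Ck_on n k S (\<lambda>x. pd i f x * g x + pd i g x * f x)" if "i < n" for i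
      by (intro Ck_on_add[OF assms(1)] Suc.IH Ck_on_pd Suc.prems that Ck_on_Suc_imp)
    fix i x assume "i < n" "x \<in> S"
    from DERIV_mult[OF Ck_on_DERIV[OF Suc.prems(1) this] Ck_on_DERIV[OF Suc.prems(2) this]]
    show "((\<lambda>t. f (x(i := t)) * g (x(i := t))) has_real_derivative pd i f x * g x + pd i g x * f x) (at (x i))"
      by (simp add: fun_upd_def)
  qed (rule assms(1))
qed

lemma Ck_on_sum:
  assumes "openin (Euclidean_space n) S" "\<And>i. i \<in> I \<Longrightarrow> Ck_on n k S (f i)"
  shows "Ck_on n k S (\<lambda>x. \<Sum>i\<in>I. f i x)"
proof (cases "finite I")
  case True
  then show ?thesis
    using assms(2) by (induction I) (auto intro: Ck_on_const Ck_on_add assms(1))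
qed (use assms(1) in \<open>auto intro: Ck_on_const\<close>)

lemma continuous_map_compose_EE:
  assumes "\<And>i. i < n \<Longrightarrow> continuous_map (subtopology (Euclidean_space m) T) euclideanreal (\<lambda>x. g x i)"
    and "g ` T \<subseteq> S" "S \<subseteq> EE n" "T \<subseteq> EE m"
    and "continuous_map (subtopology (Euclidean_space n) S) euclideanreal f"
  shows "continuous_map (subtopology (Euclidean_space m) T) euclideanreal (\<lambda>x. f (g x))"
proof -
  have "continuous_on T (\<lambda>x. g x i)" for i
  proof (cases "i < n")
    case False
    then have "\<And>x. x \<in> T \<Longrightarrow> 0 = g x i"
      using assms(2,3) by (auto simp: EE_iff image_subset_iff subset_iff)
    then show ?thesis
      using continuous_on_eq[OF continuous_on_const] by metis
  qed (use assms(1,4) in \<open>auto simp: continuous_map_Euclidean_iff Int_absorb1\<close>)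
  then have "continuous_on T g"
    by (rule continuous_on_coordinatewise_then_product)
  moreover have "continuous_on (g ` T) f"
    using assms(2,3,5) by (auto simp: continuous_map_Euclidean_iff Int_absorb1 intro: continuous_on_subset)
  ultimately show ?thesis
    using assms(4) continuous_on_compose by (fastforce simp: continuous_map_Euclidean_iff Int_absorb1 o_def)
qed

text \<open>Moving coordinate \<open>j\<close> turns the composite into \<open>f\<close> along the
  curve \<open>\<lambda>t. g (x(j := t))\<close>, so the rule for curves yields the Jacobian
  formula.\<close>

lemma DERIV_compose_EE:
  assumes S: "openin (Euclidean_space n) S" and T: "openin (Euclidean_space m) T"
    and f: "Ck_on n (Suc 0) S f" and g: "\<And>i. i < n \<Longrightarrow> Ck_on m (Suc 0) T (\<lambda>x. g x i)"
    and sub: "g ` T \<subseteq> S" and jx: "j < m" "x \<in> T"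
  shows "((\<lambda>t. f (g (x(j := t)))) has_real_derivative (\<Sum>i<n. pd j (\<lambda>x. g x i) x * pd i f (g x))) (at (x j))"
proof -
  have "\<forall>\<^sub>F t in nhds (x j). g (x(j := t)) \<in> EE n"
    using eventually_fun_upd[OF T jx(2,1)]
    by eventually_elim (use sub openin_subset[OF S] in auto)
  then have "\<forall>\<^sub>F t in at (x j). g (x(j := t)) \<in> EE n"
    by (simp add: eventually_at_filter eventually_mono)
  moreover have "g (x(j := x j)) = g x" "g x \<in> S"
    using sub jx by auto
  ultimately show ?thesis
    using DERIV_along_curve[OF S _ f, of "\<lambda>t. g (x(j := t))" "x j" "\<lambda>i. pd j (\<lambda>x. g x i) x"]
      Ck_on_DERIV[OF g jx] by simp
qed

text \<open>Induction on \<open>k\<close> with \<open>f\<close> varying and \<open>g\<close> fixed: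
  the derivative is built from derivatives of \<open>g\<close> and from the composites of
  \<open>pd i f\<close> with \<open>g\<close>, to which the induction hypothesis applies.\<close>

lemma Ck_on_compose:
  assumes "openin (Euclidean_space n) S" "openin (Euclidean_space m) T" "g ` T \<subseteq> S"
    and "Ck_on n k S f" "\<And>i. i < n \<Longrightarrow> Ck_on m k T (\<lambda>x. g x i)"
  shows "Ck_on m k T (\<lambda>x. f (g x))"
  using assms(4,5)
proof (induction k arbitrary: f)
  case 0
  show ?case
    unfolding Ck_on.simps
    by (rule continuous_map_compose_EE[of n m T g S f])
      (use 0 assms(1-3) in \<open>simp_all add: openin_subset\<close>)
next
  case (Suc k)
  have one: "Ck_on n' (Suc k) S' h \<Longrightarrow> Ck_on n' (Suc 0) S' h" for n' S' h
    by (metis Ck_on_continuous Ck_on.simps(1) Ck_on.simps(2))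
  show ?case
  proof (rule Ck_on_SucI[where f' = "\<lambda>j x. \<Sum>i<n. pd j (\<lambda>x. g x i) x * pd i f (g x)", OF _ assms(2)])
    show "continuous_map (subtopology (Euclidean_space m) T) euclideanreal (\<lambda>x. f (g x))"
      by (rule continuous_map_compose_EE[of n m T g S f, OF Ck_on_continuous[OF Suc.prems(2)]])
        (use assms(1-3) Suc.prems(1) in \<open>simp_all add: openin_subset\<close>)
    show "((\<lambda>t. f (g (x(j := t)))) has_real_derivative (\<Sum>i<n. pd j (\<lambda>x. g x i) x * pd i f (g x))) (at (x j))"
      if "j < m" "x \<in> T" for j x
      using DERIV_compose_EE[OF assms(1,2) one[OF Suc.prems(1)] one[OF Suc.prems(2)] assms(3) that] .
    show "Ck_on m k T (\<lambda>x. \<Sum>i<n. pd j (\<lambda>x. g x i) x * pd i f (g x))" if "j < m" for j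
    proof (rule Ck_on_sum[OF assms(2)])
      fix i assume i: "i \<in> {..<n}"
      show "Ck_on m k T (\<lambda>x. pd j (\<lambda>x. g x i) x * pd i f (g x))"
      proof (rule Ck_on_mult[OF assms(2)])
        show "Ck_on m k T (\<lambda>x. pd j (\<lambda>x. g x i) x)"
          using Suc.prems(2)[of i] i that by simp
        show "Ck_on m k T (\<lambda>x. pd i f (g x))"
          by (rule Suc.IH[OF Ck_on_pd[OF Suc.prems(1)]], use i in simp)
            (rule Ck_on_Suc_imp[OF Suc.prems(2)], simp)
      qed
    qed
  qed
qed

lemma Ck_on_0_local:
  assumes "openin (Euclidean_space n) S"
    and "\<And>x. x \<in> S \<Longrightarrow> \<exists>T. x \<in> T \<and> openin (Euclidean_space n) T \<and> Ck_on n 0 T f"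
  shows "Ck_on n 0 S f"
proof -
  have SE: "S \<subseteq> EE n"
    using assms(1) openin_subset by blast
  have "continuous (at x within S) f" if x: "x \<in> S" for x
  proof -
    obtain T where T: "x \<in> T" "openin (Euclidean_space n) T" "Ck_on n 0 T f"
      using assms(2) x by blast
    obtain T' where T': "open T'" "T = EE n \<inter> T'"
      using T(2)[unfolded openin_Euclidean_space_iff] by (auto simp: openin_open)
    have "continuous_on T f"
      using T T' by (simp add: continuous_map_Euclidean_iff Int_assoc[symmetric])
    then have "continuous_on (S \<inter> T') f"
      using SE T' by (auto intro: continuous_on_subset)
    then have "continuous (at x within S \<inter> T') f"
      using x T T' by (simp add: continuous_on_eq_continuous_within)
    moreover have "at x within S = at x within S \<inter> T'"
      using x T T' by (intro at_within_nhd[of x T']) auto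
    ultimately show ?thesis
      by (simp add: continuous_within)
  qed
  then have "continuous_on S f"
    by (simp add: continuous_on_eq_continuous_within)
  then show ?thesis
    using SE by (simp add: continuous_map_Euclidean_iff Int_absorb1)
qed

text \<open>Continuity and differentiability are pointwise conditions, and \<open>pd\<close> does
  not refer to a domain, so the local hypothesis is inherited by the partial derivatives.\<close>

lemma Ck_on_local:
  assumes "openin (Euclidean_space n) S"
    and "\<And>x. x \<in> S \<Longrightarrow> \<exists>T. x \<in> T \<and> openin (Euclidean_space n) T \<and> Ck_on n k T f"
  shows "Ck_on n k S f"
  using assms(2)
proof (induction k arbitrary: f)
  case 0
  then show ?case
    by (rule Ck_on_0_local[OF assms(1)])
next
  case (Suc k)
  have cont: "continuous_map (subtopology (Euclidean_space n) S) euclideanreal f"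
  proof -
    have "Ck_on n 0 S f"
      using Suc.prems by (intro Ck_on_0_local[OF assms(1)]) (metis Ck_on.simps(1) Ck_on_continuous)
    then show ?thesis
      by simp
  qed
  have "Ck_on n k S (pd i f)" if "i < n" for i
    using Suc.prems Ck_on_pd[OF _ that] by (intro Suc.IH) metis
  moreover have "(\<lambda>t. f (x(i := t))) differentiable (at (x i))" if "i < n" "x \<in> S" for i x
    using Suc.prems[OF that(2)] that by auto
  ultimately show ?case
    using cont by simp
qed

section \<open>Germs of smooth functions at a point of Euclidean space\<close>

definition smooth_near :: "nat \<Rightarrow> (nat \<Rightarrow> real) \<Rightarrow> ((nat \<Rightarrow> real) \<Rightarrow> real) \<Rightarrow> bool"
  where "smooth_near n x f \<longleftrightarrow> (\<exists>S. x \<in> S \<and> smooth_fun_on n S f)"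

lemma smooth_nearE:
  assumes "smooth_near n x f"
  obtains S where "x \<in> S" "openin (Euclidean_space n) S" "\<And>k. Ck_on n k S f"
  using assms by (auto simp: smooth_near_def smooth_fun_on_def)

lemma smooth_nearI:
  assumes "openin (Euclidean_space n) S" "x \<in> S" "\<And>k. Ck_on n k S f"
  shows "smooth_near n x f"
  using assms by (auto simp: smooth_near_def smooth_fun_on_def)

lemma smooth_fun_on_subset:
  "smooth_fun_on n S f \<Longrightarrow> openin (Euclidean_space n) T \<Longrightarrow> T \<subseteq> S \<Longrightarrow> smooth_fun_on n T f"
  by (auto simp: smooth_fun_on_def intro: Ck_on_subset)

lemma smooth_fun_on_iff:
  assumes "openin (Euclidean_space n) S"
  shows "smooth_fun_on n S f \<longleftrightarrow> (\<forall>x\<in>S. smooth_near n x f)"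
proof
  assume "\<forall>x\<in>S. smooth_near n x f"
  then show "smooth_fun_on n S f"
    using assms by (auto simp: smooth_fun_on_def elim!: smooth_nearE intro!: Ck_on_local)
qed (auto simp: smooth_near_def)

lemma smooth_near_nbhd:
  assumes "smooth_near n x f"
  obtains S where "x \<in> S" "openin (Euclidean_space n) S" "\<And>y. y \<in> S \<Longrightarrow> smooth_near n y f"
  using assms by (metis smooth_nearE smooth_nearI)

lemma smooth_near_cong:
  assumes "openin (Euclidean_space n) S" "x \<in> S" "\<And>y. y \<in> S \<Longrightarrow> f y = g y" "smooth_near n x f"
  shows "smooth_near n x g"
proof -
  obtain T where T: "x \<in> T" "openin (Euclidean_space n) T" "\<And>k. Ck_on n k T f"
    using assms(4) smooth_nearE by blast
  have ST: "openin (Euclidean_space n) (S \<inter> T)"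
    using assms T by auto
  show ?thesis
  proof (rule smooth_nearI[OF ST])
    show "Ck_on n k (S \<inter> T) g" for k
      using assms(3) by (intro Ck_on_cong[OF ST _ Ck_on_subset[OF T(3)]]) auto
  qed (use assms T in auto)
qed

lemma smooth_near_const: "x \<in> EE n \<Longrightarrow> smooth_near n x (\<lambda>y. c)"
  by (rule smooth_nearI[OF openin_topspace]) (auto intro: Ck_on_const)

lemma smooth_near_coordinate: "x \<in> EE n \<Longrightarrow> smooth_near n x (\<lambda>y. y i)"
  by (rule smooth_nearI[OF openin_topspace]) (auto intro: Ck_on_coordinate)

lemma smooth_near_common:
  assumes "smooth_near n x f" "smooth_near n x g"
  obtains S where "x \<in> S" "openin (Euclidean_space n) S" "\<And>k. Ck_on n k S f" "\<And>k. Ck_on n k S g"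
proof -
  obtain S T where S: "x \<in> S" "openin (Euclidean_space n) S" "\<And>k. Ck_on n k S f"
    and T: "x \<in> T" "openin (Euclidean_space n) T" "\<And>k. Ck_on n k T g"
    using assms smooth_nearE by metis
  show thesis
    by (rule that[of "S \<inter> T"]) (use S T in \<open>auto intro: Ck_on_subset\<close>)
qed

lemma smooth_near_add: "smooth_near n x f \<Longrightarrow> smooth_near n x g \<Longrightarrow> smooth_near n x (\<lambda>y. f y + g y)"
  by (erule (1) smooth_near_common) (blast intro: smooth_nearI Ck_on_add)

lemma smooth_near_mult: "smooth_near n x f \<Longrightarrow> smooth_near n x g \<Longrightarrow> smooth_near n x (\<lambda>y. f y * g y)"
  by (erule (1) smooth_near_common) (blast intro: smooth_nearI Ck_on_mult)

lemma smooth_near_sum: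
  assumes "x \<in> EE n" "\<And>i. i \<in> I \<Longrightarrow> smooth_near n x (f i)"
  shows "smooth_near n x (\<lambda>y. \<Sum>i\<in>I. f i y)"
proof (cases "finite I")
  case True
  then show ?thesis
    using assms(2) by (induction I) (auto intro: smooth_near_const smooth_near_add assms(1))
qed (use assms(1) in \<open>auto intro: smooth_near_const\<close>)

lemma smooth_near_pd: "smooth_near n x f \<Longrightarrow> i < n \<Longrightarrow> smooth_near n x (pd i f)"
  by (erule smooth_nearE) (blast intro: smooth_nearI Ck_on_pd)

lemma smooth_near_DERIV:
  assumes "smooth_near n x f" "i < n"
  shows "((\<lambda>t. f (x(i := t))) has_real_derivative pd i f x) (at (x i))"
  using assms(1) by (rule smooth_nearE) (rule Ck_on_DERIV[OF _ assms(2)])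

lemma pd_add:
  assumes "smooth_near n x f" "smooth_near n x g" "i < n"
  shows "pd i (\<lambda>y. f y + g y) x = pd i f x + pd i g x"
  by (rule pd_eqI, rule DERIV_add) (rule smooth_near_DERIV[OF assms(1,3)], rule smooth_near_DERIV[OF assms(2,3)])

lemma pd_mult:
  assumes "smooth_near n x f" "smooth_near n x g" "i < n"
  shows "pd i (\<lambda>y. f y * g y) x = pd i f x * g x + f x * pd i g x"
  using DERIV_mult[OF smooth_near_DERIV[OF assms(1,3)] smooth_near_DERIV[OF assms(2,3)]]
  by (intro pd_eqI) (simp add: fun_upd_def algebra_simps)

lemma pd_const: "pd i (\<lambda>y. c) x = 0"
  by (simp add: pd_def)

lemma pd_coordinate: "pd i (\<lambda>y. y j) x = (if i = j then 1 else 0)"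
  by (rule pd_eqI) (auto intro!: derivative_eq_intros)

lemma openin_preimage_EE:
  assumes "openin (Euclidean_space m) T" "g ` T \<subseteq> EE n" "openin (Euclidean_space n) S"
    and "\<And>i. i < n \<Longrightarrow> continuous_map (subtopology (Euclidean_space m) T) euclideanreal (\<lambda>x. g x i)"
  shows "openin (Euclidean_space m) {x \<in> T. g x \<in> S}"
proof -
  have top: "topspace (subtopology (Euclidean_space m) T) = T"
    using openin_subset[OF assms(1)] by auto
  \<comment> \<open>The componentwise criterion concerns maps written with an explicit zero tail; on
    \<open>T\<close> this map is \<open>g\<close>, whose values lie in \<open>EE n\<close>.\<close>
  have "continuous_map (subtopology (Euclidean_space m) T) (Euclidean_space n)
      (\<lambda>x i. if i < n then g x i else 0)"
    using assms(4) by (simp add: continuous_map_componentwise_Euclidean_space)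
  moreover have "(\<lambda>i. if i < n then g x i else 0) = g x" if "x \<in> T" for x
    using that assms(2) by (fastforce simp: EE_iff fun_eq_iff image_subset_iff)
  ultimately have "continuous_map (subtopology (Euclidean_space m) T) (Euclidean_space n) g"
    using continuous_map_eq top by (metis (no_types, lifting))
  from openin_continuous_map_preimage[OF this assms(3)] show ?thesis
    unfolding top using assms(1) by (rule openin_trans_full)
qed

text \<open>Each germ provides one neighbourhood for all orders of differentiation, so a finite
  intersection serves every \<open>i\<close> and every \<open>k\<close> at once.\<close>

lemma smooth_near_finite:
  assumes "openin (Euclidean_space m) T" "x \<in> T" "\<And>i. i < (n::nat) \<Longrightarrow> smooth_near m x (g i)"
  obtains S where "x \<in> S" "openin (Euclidean_space m) S" "S \<subseteq> T" "\<And>i k. i < n \<Longrightarrow> Ck_on m k S (g i)"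
proof -
  have "\<exists>S. x \<in> S \<and> openin (Euclidean_space m) S \<and> S \<subseteq> T \<and> (\<forall>i<n. \<forall>k. Ck_on m k S (g i))"
    using assms(3)
  proof (induction n)
    case 0
    then show ?case
      using assms by auto
  next
    case (Suc n)
    then obtain S where S: "x \<in> S" "openin (Euclidean_space m) S" "S \<subseteq> T" "\<forall>i<n. \<forall>k. Ck_on m k S (g i)"
      by auto
    obtain S' where S': "x \<in> S'" "openin (Euclidean_space m) S'" "\<And>k. Ck_on m k S' (g n)"
      using Suc.prems smooth_nearE by blast
    show ?case
    proof (intro exI[of _ "S \<inter> S'"] conjI allI impI)
      show "Ck_on m k (S \<inter> S') (g i)" if "i < Suc n" for i k
        using that S(4) S'(3) Ck_on_subset[of m k _ "g i" "S \<inter> S'"] by (auto simp: less_Suc_eq)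
    qed (use S S' in auto)
  qed
  then show thesis
    using that by metis
qed

text \<open>Shrinking to a preimage of \<open>S\<close> makes the composition meaningful on a whole
  open set. Smoothness of composites and the chain rule both start from these data.\<close>

lemma smooth_near_compose_nbhd:
  assumes "smooth_near n (g x) f" "openin (Euclidean_space m) T" "x \<in> T" "g ` T \<subseteq> EE n"
    and "\<And>i. i < n \<Longrightarrow> smooth_near m x (\<lambda>y. g y i)"
  obtains S U where "openin (Euclidean_space n) S" "\<And>k. Ck_on n k S f"
    "openin (Euclidean_space m) U" "x \<in> U" "g ` U \<subseteq> S"
    "\<And>i k. i < n \<Longrightarrow> Ck_on m k U (\<lambda>y. g y i)"
proof -
  obtain S where S: "g x \<in> S" "openin (Euclidean_space n) S" "\<And>k. Ck_on n k S f"
    using assms(1) smooth_nearE by blast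
  obtain R where R: "x \<in> R" "openin (Euclidean_space m) R" "R \<subseteq> T" "\<And>i k. i < n \<Longrightarrow> Ck_on m k R (\<lambda>y. g y i)"
    using smooth_near_finite[OF assms(2,3), of n "\<lambda>i y. g y i"] assms(5) by blast
  let ?U = "{y \<in> R. g y \<in> S}"
  have U: "openin (Euclidean_space m) ?U"
    using assms(4) R Ck_on_continuous by (intro openin_preimage_EE[OF R(2) _ S(2)]) blast+
  show thesis
  proof (rule that[OF S(2,3) U])
    show "Ck_on m k ?U (\<lambda>y. g y i)" if "i < n" for i k
      using R(4)[OF that] by (rule Ck_on_subset) auto
  qed (use S R in auto)
qed

lemma smooth_near_compose:
  assumes "smooth_near n (g x) f" "openin (Euclidean_space m) T" "x \<in> T" "g ` T \<subseteq> EE n"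
    and "\<And>i. i < n \<Longrightarrow> smooth_near m x (\<lambda>y. g y i)"
  shows "smooth_near m x (\<lambda>y. f (g y))"
proof -
  obtain S U where *: "openin (Euclidean_space n) S" "\<And>k. Ck_on n k S f"
    "openin (Euclidean_space m) U" "x \<in> U" "g ` U \<subseteq> S" "\<And>i k. i < n \<Longrightarrow> Ck_on m k U (\<lambda>y. g y i)"
    using smooth_near_compose_nbhd[OF assms] by blast
  show ?thesis
    by (rule smooth_nearI[OF *(3,4)]) (rule Ck_on_compose[OF *(1,3,5,2,6)])
qed

lemma pd_compose:
  assumes "smooth_near n (g x) f" "openin (Euclidean_space m) T" "x \<in> T" "g ` T \<subseteq> EE n"
    and "\<And>i. i < n \<Longrightarrow> smooth_near m x (\<lambda>y. g y i)" and "j < m"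
  shows "pd j (\<lambda>y. f (g y)) x = (\<Sum>i<n. pd j (\<lambda>y. g y i) x * pd i f (g x))"
proof -
  obtain S U where *: "openin (Euclidean_space n) S" "\<And>k. Ck_on n k S f"
    "openin (Euclidean_space m) U" "x \<in> U" "g ` U \<subseteq> S" "\<And>i k. i < n \<Longrightarrow> Ck_on m k U (\<lambda>y. g y i)"
    using smooth_near_compose_nbhd[OF assms(1-5)] by blast
  show ?thesis
    by (rule pd_eqI, rule DERIV_compose_EE[OF *(1,3,2,6,5) assms(6) *(4)])
qed

lemma smooth_near_DERIV_curve:
  assumes "smooth_near n (c t0) f" "\<forall>\<^sub>F t in at t0. c t \<in> EE n"
    and "\<And>i. i < n \<Longrightarrow> ((\<lambda>t. c t i) has_real_derivative c' i) (at t0)"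
  shows "((\<lambda>t. f (c t)) has_real_derivative (\<Sum>i<n. c' i * pd i f (c t0))) (at t0)"
  using assms(1)
proof (rule smooth_nearE)
  fix S assume "c t0 \<in> S" "openin (Euclidean_space n) S" "\<And>k. Ck_on n k S f"
  then show ?thesis
    using assms(2,3) by (intro DERIV_along_curve[of n S])
qed

section \<open>Manifolds in coordinates\<close>

lemma smooth_transitionD:
  assumes "smooth_transition n (D, \<phi>) (D', \<phi>')"
  shows "openin (Euclidean_space n) (\<phi> ` (D \<inter> D'))"
    and "i < n \<Longrightarrow> smooth_fun_on n (\<phi> ` (D \<inter> D')) (\<lambda>x. \<phi>' (inv_into D \<phi> x) i)"
  using assms by (auto simp: smooth_transition_def)

lemma coordinate_chartD:
  assumes "coordinate_chart N D \<phi>"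
  shows "D \<subseteq> pts N" "inj_on \<phi> D" "openin (Euclidean_space (mdim N)) (\<phi> ` D)"
    and "c \<in> charts N \<Longrightarrow> smooth_transition (mdim N) (D, \<phi>) c"
    and "c \<in> charts N \<Longrightarrow> smooth_transition (mdim N) c (D, \<phi>)"
  using assms by (auto simp: coordinate_chart_def)

text \<open>Near \<open>p\<close> the expression of \<open>f\<close> in \<phi> is its expression in
  \<open>\<phi>'\<close> composed with the transition map, whose components are smooth.\<close>

lemma smooth_near_transition:
  assumes tr: "smooth_transition n (D, \<phi>) (D', \<phi>')"
    and inj: "inj_on \<phi> D" "inj_on \<phi>' D'" and EE: "\<phi>' ` D' \<subseteq> EE n" and p: "p \<in> D" "p \<in> D'"
    and f: "smooth_near n (\<phi>' p) (f \<circ> inv_into D' \<phi>')"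
  shows "smooth_near n (\<phi> p) (f \<circ> inv_into D \<phi>)"
proof -
  let ?T = "\<phi> ` (D \<inter> D')" and ?g = "\<lambda>x. \<phi>' (inv_into D \<phi> x)"
  have g: "?g (\<phi> q) = \<phi>' q" if "q \<in> D" for q
    using that inj by simp
  have pT: "\<phi> p \<in> ?T"
    using p by blast
  have h: "smooth_near n (\<phi> p) (\<lambda>y. (f \<circ> inv_into D' \<phi>') (?g y))"
  proof (rule smooth_near_compose[where g = ?g and f = "f \<circ> inv_into D' \<phi>'", OF _ smooth_transitionD(1)[OF tr] pT])
    show "smooth_near n (?g (\<phi> p)) (f \<circ> inv_into D' \<phi>')"
      using f g p by simp
    show "?g ` ?T \<subseteq> EE n"
      using EE g by (auto simp: image_subset_iff)
    show "smooth_near n (\<phi> p) (\<lambda>y. ?g y i)" if "i < n" for i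
      using smooth_transitionD[OF tr] that pT by (auto simp: smooth_fun_on_iff)
  qed
  show ?thesis
    by (rule smooth_near_cong[OF smooth_transitionD(1)[OF tr] pT _ h]) (use inj in auto)
qed

text \<open>Records the compatibility of the charts, which can be checked directly for the total
  spaces as well as for a \<open>smooth_manifold\<close>.\<close>

locale manifold_atlas =
  fixes N :: "'p mfd"
  assumes charts: "(D, \<phi>) \<in> charts N \<Longrightarrow> coordinate_chart N D \<phi>"

locale manifold_chart = manifold_atlas +
  fixes D :: "'p set" and \<Phi> :: "'p \<Rightarrow> nat \<Rightarrow> real"
  assumes chart: "coordinate_chart N D \<Phi>"
begin

abbreviation "d \<equiv> mdim N"
abbreviation "\<Phi>i \<equiv> inv_into D \<Phi>"

lemmas chartD = coordinate_chartD[OF chart]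

lemma inv_chart [simp]: "p \<in> D \<Longrightarrow> \<Phi>i (\<Phi> p) = p"
  using chartD by simp

lemma image_EE: "\<Phi> ` D \<subseteq> EE d"
  using chartD(3) openin_subset by blast

lemma chart_EE: "p \<in> D \<Longrightarrow> \<Phi> p \<in> EE d"
  using image_EE by blast

text \<open>One atlas chart at \<open>p\<close> determines the expression in the given chart, and
  transitions carry it back to every atlas chart. The neighbourhood is finally cut down to the chart
  image, as \<open>smooth_at\<close> requires.\<close>

lemma smooth_at_iff:
  assumes p: "p \<in> D"
  shows "smooth_at N p f \<longleftrightarrow> smooth_near d (\<Phi> p) (f \<circ> \<Phi>i)"
proof
  assume f: "smooth_at N p f"
  obtain D' \<phi>' where c: "(D', \<phi>') \<in> charts N" "p \<in> D'"
    using p chartD(1) by (auto simp: pts_def)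
  have "smooth_near d (\<phi>' p) (f \<circ> inv_into D' \<phi>')"
    using f c by (auto simp: smooth_at_def smooth_near_def)
  then show "smooth_near d (\<Phi> p) (f \<circ> \<Phi>i)"
    using c p coordinate_chartD[OF charts[OF c(1)]] openin_subset
    by (intro smooth_near_transition[OF chartD(4)[OF c(1)] chartD(2)]) blast+
next
  assume f: "smooth_near d (\<Phi> p) (f \<circ> \<Phi>i)"
  have "\<exists>S. \<phi>' p \<in> S \<and> S \<subseteq> \<phi>' ` D' \<and> smooth_fun_on d S (f \<circ> inv_into D' \<phi>')"
    if c: "(D', \<phi>') \<in> charts N" "p \<in> D'" for D' \<phi>'
  proof -
    note c' = coordinate_chartD[OF charts[OF c(1)]]
    have "smooth_near d (\<phi>' p) (f \<circ> inv_into D' \<phi>')"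
      by (rule smooth_near_transition[OF chartD(5)[OF c(1)] c'(2) chartD(2) image_EE c(2) p f])
    then obtain S where S: "\<phi>' p \<in> S" "smooth_fun_on d S (f \<circ> inv_into D' \<phi>')"
      by (auto simp: smooth_near_def)
    have "smooth_fun_on d (S \<inter> \<phi>' ` D') (f \<circ> inv_into D' \<phi>')"
      using S(2) c'(3) by (intro smooth_fun_on_subset[OF S(2)]) (auto simp: smooth_fun_on_def)
    then show ?thesis
      using S c(2) by (intro exI[of _ "S \<inter> \<phi>' ` D'"]) auto
  qed
  then show "smooth_at N p f"
    using p chartD(1) by (auto simp: smooth_at_def)
qed

text \<open>Induction over the generation of \<open>mtop N\<close> from chart preimages: injectivity
  handles intersections, and the image of a generator is a preimage under a transition map.\<close>

lemma open_image:
  assumes "openin (mtop N) W"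
  shows "openin (Euclidean_space d) (\<Phi> ` (D \<inter> W))"
proof -
  let ?B = "{{p \<in> D. \<phi> p \<in> S} | D \<phi> S. (D, \<phi>) \<in> charts N \<and> openin (Euclidean_space (mdim N)) S}"
  have "generate_topology_on ?B W"
    using assms by (simp add: mtop_def openin_topology_generated_by_iff)
  then show ?thesis
  proof (induction rule: generate_topology_on.induct)
    case (Int a b)
    have "\<Phi> ` (D \<inter> (a \<inter> b)) = \<Phi> ` (D \<inter> a) \<inter> \<Phi> ` (D \<inter> b)"
      using chartD(2) by (auto simp: inj_on_def)
    then show ?case
      using Int by auto
  next
    case (UN K)
    have "\<Phi> ` (D \<inter> \<Union>K) = (\<Union>k\<in>K. \<Phi> ` (D \<inter> k))"
      by auto
    then show ?case
      using UN by auto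
  next
    case (Basis s)
    then obtain D' \<phi>' S where s: "(D', \<phi>') \<in> charts N" "openin (Euclidean_space d) S"
      "s = {p \<in> D'. \<phi>' p \<in> S}"
      by auto
    note tr = smooth_transitionD[OF chartD(4)[OF s(1)]]
    have "openin (Euclidean_space d) {x \<in> \<Phi> ` (D \<inter> D'). \<phi>' (\<Phi>i x) \<in> S}"
    proof (rule openin_preimage_EE[OF tr(1) _ s(2)])
      show "(\<lambda>x. \<phi>' (\<Phi>i x)) ` \<Phi> ` (D \<inter> D') \<subseteq> EE d"
        using coordinate_chartD(3)[OF charts[OF s(1)]] openin_subset by (fastforce simp: image_subset_iff)
      show "continuous_map (subtopology (Euclidean_space d) (\<Phi> ` (D \<inter> D'))) euclideanreal (\<lambda>x. \<phi>' (\<Phi>i x) i)"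
        if "i < d" for i
        using tr(2)[OF that] Ck_on_continuous by (auto simp: smooth_fun_on_def)
    qed
    moreover have "{x \<in> \<Phi> ` (D \<inter> D'). \<phi>' (\<Phi>i x) \<in> S} = \<Phi> ` (D \<inter> s)"
      using s(3) by auto
    ultimately show ?case
      by simp
  qed auto
qed

end

lemma openin_chart_domain_basis:
  "(D, \<phi>) \<in> charts N \<Longrightarrow> openin (Euclidean_space (mdim N)) S \<Longrightarrow> openin (mtop N) {p \<in> D. \<phi> p \<in> S}"
  unfolding mtop_def by (rule topology_generated_by_Basis) blast

context manifold_chart
begin

text \<open>The chart may lie outside the atlas, so its preimages are not generators of the
  topology. Around each point an atlas chart is used, in which the corresponding part of the set is
  the preimage of \<open>T\<close> under a transition map.\<close>

lemma open_preimage: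
  assumes T: "openin (Euclidean_space d) T"
  shows "openin (mtop N) {q \<in> D. \<Phi> q \<in> T}"
proof (subst openin_subopen, intro ballI)
  fix q assume q: "q \<in> {q \<in> D. \<Phi> q \<in> T}"
  obtain D' \<phi>' where c: "(D', \<phi>') \<in> charts N" "q \<in> D'"
    using q chartD(1) by (auto simp: pts_def)
  note c' = coordinate_chartD[OF charts[OF c(1)]]
  note tr = smooth_transitionD[OF chartD(5)[OF c(1)]]
  let ?S = "{y \<in> \<phi>' ` (D' \<inter> D). \<Phi> (inv_into D' \<phi>' y) \<in> T}"
  have inv: "inv_into D' \<phi>' (\<phi>' r) = r" if "r \<in> D'" for r
    using that c'(2) by simp
  have "openin (Euclidean_space d) ?S"
  proof (rule openin_preimage_EE[OF tr(1) _ T])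
    show "(\<lambda>y. \<Phi> (inv_into D' \<phi>' y)) ` \<phi>' ` (D' \<inter> D) \<subseteq> EE d"
      using chart_EE inv by auto
    show "continuous_map (subtopology (Euclidean_space d) (\<phi>' ` (D' \<inter> D))) euclideanreal
        (\<lambda>y. \<Phi> (inv_into D' \<phi>' y) i)" if "i < d" for i
      using tr(2)[OF that] Ck_on_continuous by (auto simp: smooth_fun_on_def)
  qed
  then have "openin (mtop N) {r \<in> D'. \<phi>' r \<in> ?S}"
    by (rule openin_chart_domain_basis[OF c(1)])
  moreover have "q \<in> {r \<in> D'. \<phi>' r \<in> ?S}"
    using q c inv by auto
  moreover have "{r \<in> D'. \<phi>' r \<in> ?S} \<subseteq> {q \<in> D. \<Phi> q \<in> T}"
    using inv by (auto dest!: inj_onD[OF c'(2)])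
  ultimately show "\<exists>W. openin (mtop N) W \<and> q \<in> W \<and> W \<subseteq> {q \<in> D. \<Phi> q \<in> T}"
    by blast
qed

lemma open_domain: "openin (mtop N) D"
  using open_preimage[OF chartD(3)] by (simp add: Collect_mem_eq cong: conj_cong)

text \<open>Moves germ statements on the manifold to open sets of Euclidean space, where the
  congruence rules for \<open>smooth_near\<close> and \<open>pd\<close> apply.\<close>

lemma near_iff:
  assumes p: "p \<in> D"
  shows "near N p P \<longleftrightarrow> (\<exists>T. openin (Euclidean_space d) T \<and> \<Phi> p \<in> T \<and> T \<subseteq> \<Phi> ` D \<and> (\<forall>y\<in>T. P (\<Phi>i y)))"
proof
  assume "near N p P"
  then obtain W where "openin (mtop N) W" "p \<in> W" "\<forall>q\<in>W. P q"
    by (auto simp: near_def)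
  then show "\<exists>T. openin (Euclidean_space d) T \<and> \<Phi> p \<in> T \<and> T \<subseteq> \<Phi> ` D \<and> (\<forall>y\<in>T. P (\<Phi>i y))"
    using p open_image by (intro exI[of _ "\<Phi> ` (D \<inter> W)"]) auto
next
  assume "\<exists>T. openin (Euclidean_space d) T \<and> \<Phi> p \<in> T \<and> T \<subseteq> \<Phi> ` D \<and> (\<forall>y\<in>T. P (\<Phi>i y))"
  then obtain T where "openin (Euclidean_space d) T" "\<Phi> p \<in> T" "T \<subseteq> \<Phi> ` D" "\<forall>y\<in>T. P (\<Phi>i y)"
    by blast
  then show "near N p P"
    unfolding near_def using p open_preimage by (intro exI[of _ "{q \<in> D. \<Phi> q \<in> T}"]) fastforce
qed

end

lemma near_mono: "near N p P \<Longrightarrow> (\<And>q. P q \<Longrightarrow> Q q) \<Longrightarrow> near N p Q"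
  unfolding near_def by blast

lemma near_conj: "near N p P \<Longrightarrow> near N p Q \<Longrightarrow> near N p (\<lambda>q. P q \<and> Q q)"
  unfolding near_def by (metis IntD1 IntD2 IntI openin_Int)

lemma near_self: "near N p P \<Longrightarrow> P p"
  unfolding near_def by blast

lemma near_open: "openin (mtop N) W \<Longrightarrow> p \<in> W \<Longrightarrow> near N p (\<lambda>q. q \<in> W)"
  unfolding near_def by blast

context manifold_chart
begin

lemma smooth_at_cong_chart:
  assumes p: "p \<in> D" and fg: "near N p (\<lambda>q. f q = g q)" and f: "smooth_at N p f"
  shows "smooth_at N p g"
proof -
  obtain T where T: "openin (Euclidean_space d) T" "\<Phi> p \<in> T" "\<forall>y\<in>T. f (\<Phi>i y) = g (\<Phi>i y)"
    using near_iff[OF p, THEN iffD1, OF fg] by blast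
  show ?thesis
    using f unfolding smooth_at_iff[OF p] by (rule smooth_near_cong[OF T(1,2), rotated]) (use T(3) in auto)
qed

lemma near_smooth_at_chart:
  assumes p: "p \<in> D" and f: "smooth_at N p f"
  shows "near N p (\<lambda>q. smooth_at N q f)"
proof -
  obtain S where S: "\<Phi> p \<in> S" "openin (Euclidean_space d) S" "\<And>y. y \<in> S \<Longrightarrow> smooth_near d y (f \<circ> \<Phi>i)"
    by (rule smooth_near_nbhd[OF f[unfolded smooth_at_iff[OF p]]]) blast
  have "smooth_at N (\<Phi>i y) f" if "y \<in> S \<inter> \<Phi> ` D" for y
    using S(3)[of y] that by (auto simp: smooth_at_iff)
  then show ?thesis
    unfolding near_iff[OF p] using S p chartD(3) by (intro exI[of _ "S \<inter> \<Phi> ` D"]) auto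
qed

lemma smooth_at_chart_coordinate: "p \<in> D \<Longrightarrow> smooth_at N p (\<lambda>q. \<Phi> q i)"
  unfolding smooth_at_iff
  by (rule smooth_near_cong[OF chartD(3) imageI, of p "\<lambda>y. y i"])
    (simp, fastforce, rule smooth_near_coordinate[OF chart_EE])

end

context manifold_atlas
begin

lemma manifold_chartI: "coordinate_chart N D \<phi> \<Longrightarrow> manifold_chart N D \<phi>"
  by unfold_locales

lemma chart_exists:
  assumes "p \<in> pts N"
  obtains D \<phi> where "manifold_chart N D \<phi>" "p \<in> D"
proof -
  obtain D \<phi> where "(D, \<phi>) \<in> charts N" "p \<in> D"
    using assms by (auto simp: pts_def)
  then show thesis
    using that manifold_chartI[OF charts] by blast
qed

lemma smooth_at_pts: "smooth_at N p f \<Longrightarrow> p \<in> pts N"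
  by (simp add: smooth_at_def)

lemma smooth_at_cong:
  assumes "near N p (\<lambda>q. f q = g q)" "smooth_at N p f"
  shows "smooth_at N p g"
  by (rule chart_exists[OF smooth_at_pts[OF assms(2)]]) (rule manifold_chart.smooth_at_cong_chart[OF _ _ assms])

lemma near_smooth_at:
  assumes "smooth_at N p f"
  shows "near N p (\<lambda>q. smooth_at N q f)"
  by (rule chart_exists[OF smooth_at_pts[OF assms]]) (rule manifold_chart.near_smooth_at_chart[OF _ _ assms])

lemma smooth_at_const:
  assumes "p \<in> pts N"
  shows "smooth_at N p (\<lambda>q. c)"
proof (rule chart_exists[OF assms])
  fix D \<phi> assume c: "manifold_chart N D \<phi>" "p \<in> D"
  then show ?thesis
    using smooth_near_const manifold_chart.chart_EE[OF c]
    by (simp add: manifold_chart.smooth_at_iff[OF c] o_def)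
qed

lemma smooth_at_add:
  assumes "smooth_at N p f" "smooth_at N p g"
  shows "smooth_at N p (\<lambda>q. f q + g q)"
proof (rule chart_exists[OF smooth_at_pts[OF assms(1)]])
  fix D \<phi> assume c: "manifold_chart N D \<phi>" "p \<in> D"
  then show ?thesis
    using assms smooth_near_add by (fastforce simp: manifold_chart.smooth_at_iff[OF c] o_def)
qed

lemma smooth_at_mult:
  assumes "smooth_at N p f" "smooth_at N p g"
  shows "smooth_at N p (\<lambda>q. f q * g q)"
proof (rule chart_exists[OF smooth_at_pts[OF assms(1)]])
  fix D \<phi> assume c: "manifold_chart N D \<phi>" "p \<in> D"
  then show ?thesis
    using assms smooth_near_mult by (fastforce simp: manifold_chart.smooth_at_iff[OF c] o_def)
qed

lemma smooth_at_sum: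
  assumes "p \<in> pts N" "\<And>i. i \<in> I \<Longrightarrow> smooth_at N p (f i)"
  shows "smooth_at N p (\<lambda>q. \<Sum>i\<in>I. f i q)"
proof (cases "finite I")
  case True
  then show ?thesis
    using assms(2) by (induction I) (auto intro: smooth_at_const smooth_at_add assms(1))
qed (use assms(1) in \<open>auto intro: smooth_at_const\<close>)

lemma near_pts: "p \<in> pts N \<Longrightarrow> near N p (\<lambda>q. q \<in> pts N)"
  using near_smooth_at[OF smooth_at_const] by (rule near_mono[OF _ smooth_at_pts])

end

lemma smooth_manifold_atlas: "smooth_manifold N \<Longrightarrow> manifold_atlas N"
  by unfold_locales (fastforce simp: smooth_manifold_def coordinate_chart_def pts_def)

section \<open>The real line\<close>

abbreviation real_chart :: "real \<Rightarrow> nat \<Rightarrow> real"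
  where "real_chart \<equiv> \<lambda>t i. if i = 0 then t else 0"

lemma real_chart_EE: "real_chart t \<in> EE 1"
  by (auto simp: EE_iff)

lemma real_chart_image: "range real_chart = EE 1"
proof -
  have "y \<in> range real_chart" if "y \<in> EE 1" for y
    using that by (intro image_eqI[of _ _ "y 0"]) (auto simp: EE_iff fun_eq_iff)
  then show ?thesis
    using real_chart_EE by blast
qed

lemma inj_real_chart: "inj real_chart"
  by (rule injI) (metis (full_types))

lemma inv_real_chart: "y \<in> EE 1 \<Longrightarrow> inv_into UNIV real_chart y = y 0"
proof -
  assume "y \<in> EE 1"
  then obtain t where y: "y = real_chart t"
    unfolding real_chart_image[symmetric] by blast
  show ?thesis
    unfolding y inv_f_f[OF inj_real_chart] by simp
qed

lemma coordinate_chart_real_line: "coordinate_chart real_line UNIV real_chart"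
proof -
  have sm: "smooth_fun_on (Suc 0) (EE (Suc 0)) (\<lambda>x. real_chart (inv_into UNIV real_chart x) i)" for i
    unfolding smooth_fun_on_def
  proof (intro conjI allI)
    show "Ck_on (Suc 0) k (EE (Suc 0)) (\<lambda>x. real_chart (inv_into UNIV real_chart x) i)" for k
    proof (rule Ck_on_cong[OF openin_topspace _ Ck_on_coordinate[OF openin_topspace, of _ _ i]])
      fix x assume "x \<in> EE (Suc 0)"
      then show "x i = real_chart (inv_into UNIV real_chart x) i"
        using inv_real_chart by (auto simp: EE_iff)
    qed
  qed auto
  show ?thesis
    using real_chart_image inj_real_chart sm[of 0]
    by (auto simp: coordinate_chart_def real_line_def pts_def smooth_transition_def)
qed

interpretation real_line: manifold_chart real_line UNIV real_chart
proof
  show "coordinate_chart real_line D \<phi>" if "(D, \<phi>) \<in> charts real_line" for D \<phi>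
    using that coordinate_chart_real_line by (simp add: real_line_def)
qed (rule coordinate_chart_real_line)

lemma mdim_real_line: "mdim real_line = 1"
  by (simp add: real_line_def)

lemma smooth_at_real_line_iff:
  "smooth_at real_line t h \<longleftrightarrow> smooth_near 1 (real_chart t) (\<lambda>y. h (y 0))"
proof -
  have "smooth_near 1 (real_chart t) (h \<circ> inv_into UNIV real_chart) \<longleftrightarrow>
      smooth_near 1 (real_chart t) (\<lambda>y. h (y 0))"
    using smooth_near_cong[OF openin_topspace real_chart_EE, of "h \<circ> inv_into UNIV real_chart" "\<lambda>y. h (y 0)"]
      smooth_near_cong[OF openin_topspace real_chart_EE, of "\<lambda>y. h (y 0)" "h \<circ> inv_into UNIV real_chart"]
      inv_real_chart by auto
  then show ?thesis
    using real_line.smooth_at_iff[of t h] by (simp add: mdim_real_line)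
qed

lemma smooth_at_real_line_differentiable:
  assumes "smooth_at real_line t h"
  shows "h differentiable (at t)"
proof -
  have "((\<lambda>u. (\<lambda>y. h (y 0)) ((real_chart t)(0 := u))) has_real_derivative
      pd 0 (\<lambda>y. h (y 0)) (real_chart t)) (at (real_chart t 0))"
    using assms by (intro smooth_near_DERIV) (auto simp: smooth_at_real_line_iff)
  then show ?thesis
    using real_differentiable_def by auto
qed

context manifold_atlas
begin

lemma smooth_curve_in_open:
  assumes \<gamma>: "smooth_map_at real_line N \<gamma> 0" and W: "openin (mtop N) W" "\<gamma> 0 \<in> W"
  shows "\<forall>\<^sub>F t in nhds 0. \<gamma> t \<in> W"
proof -
  \<comment> \<open>The indicator function of \<open>W\<close> is smooth at \<open>\<gamma> 0\<close>, and continuity along \<open>\<gamma>\<close> keeps its value near 1.\<close>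
  let ?h = "\<lambda>q. if q \<in> W then 1 else (0::real)"
  have \<gamma>0: "\<gamma> 0 \<in> pts N"
    using \<gamma> near_self[of real_line 0 "\<lambda>t. \<gamma> t \<in> pts N"] by (simp add: smooth_map_at_def)
  have "near N (\<gamma> 0) (\<lambda>q. 1 = ?h q)"
    using near_open[OF W] by (rule near_mono) simp
  then have "smooth_at N (\<gamma> 0) ?h"
    by (rule smooth_at_cong[OF _ smooth_at_const[OF \<gamma>0]])
  then have "smooth_at real_line 0 (?h \<circ> \<gamma>)"
    using \<gamma> by (simp add: smooth_map_at_def)
  then have "isCont (?h \<circ> \<gamma>) 0"
    using smooth_at_real_line_differentiable differentiable_imp_continuous_within by blast
  then have lim: "((?h \<circ> \<gamma>) \<longlongrightarrow> (?h \<circ> \<gamma>) 0) (nhds 0)"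
    by (simp only: isCont_def tendsto_at_iff_tendsto_nhds)
  have "\<forall>\<^sub>F t in nhds 0. 1 / 2 < (?h \<circ> \<gamma>) t"
    by (rule order_tendstoD(1)[OF lim]) (use W in simp)
  then show ?thesis
    by (rule eventually_mono) (simp split: if_splits)
qed

end

section \<open>Tangent vectors and vector fields in a chart\<close>

context manifold_chart
begin

text \<open>Asks only for coordinates differentiable at the time \<open>t\<close>, so that it serves
  smooth curves and also trajectories, for which no smoothness is assumed.\<close>

lemma DERIV_in_chart:
  assumes ev: "\<forall>\<^sub>F \<tau> in nhds t. \<gamma> \<tau> \<in> D"
    and c': "\<And>i. i < d \<Longrightarrow> ((\<lambda>\<tau>. \<Phi> (\<gamma> \<tau>) i) has_real_derivative c' i) (at t)"
    and h: "smooth_at N (\<gamma> t) h"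
  shows "((\<lambda>\<tau>. h (\<gamma> \<tau>)) has_real_derivative (\<Sum>i<d. c' i * pd i (h \<circ> \<Phi>i) (\<Phi> (\<gamma> t)))) (at t)"
proof -
  have t: "\<gamma> t \<in> D"
    using ev by (rule eventually_nhds_x_imp_x)
  have "\<forall>\<^sub>F \<tau> in at t. \<Phi> (\<gamma> \<tau>) \<in> EE d"
    using ev chart_EE by (auto simp: eventually_at_filter elim: eventually_mono)
  then have D: "((\<lambda>\<tau>. (h \<circ> \<Phi>i) (\<Phi> (\<gamma> \<tau>))) has_real_derivative
      (\<Sum>i<d. c' i * pd i (h \<circ> \<Phi>i) (\<Phi> (\<gamma> t)))) (at t)"
    using h[unfolded smooth_at_iff[OF t]] c'
    by (intro smooth_near_DERIV_curve[of d "\<lambda>\<tau>. \<Phi> (\<gamma> \<tau>)" t "h \<circ> \<Phi>i" c'])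
  show ?thesis
    by (rule DERIV_cong_ev[THEN iffD1, OF refl _ refl D]) (use ev in \<open>auto elim: eventually_mono\<close>)
qed

text \<open>The tangent vector with components \<open>a\<close>. The value 0 on functions that are
  not smooth follows the convention of \<open>velocity\<close>, \<open>tmap\<close> and
  \<open>coord_vec\<close>, so that vectors can be compared as functions.\<close>

definition tvec :: "(nat \<Rightarrow> real) \<Rightarrow> 'p \<Rightarrow> 'p tvec"
  where "tvec a p = (\<lambda>h. if smooth_at N p h then \<Sum>i<d. a i * pd i (h \<circ> \<Phi>i) (\<Phi> p) else 0)"

lemma tvec_cong: "(\<And>i. i < d \<Longrightarrow> a i = b i) \<Longrightarrow> tvec a p = tvec b p"
  by (simp add: tvec_def fun_eq_iff)

lemma velocity_eq_tvec:
  assumes \<gamma>: "smooth_map_at real_line N \<gamma> 0" and p: "\<gamma> 0 \<in> D"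
  shows "velocity N \<gamma> 0 = tvec (\<lambda>i. deriv (\<lambda>\<tau>. \<Phi> (\<gamma> \<tau>) i) 0) (\<gamma> 0)"
proof
  fix h
  have "((\<lambda>\<tau>. \<Phi> (\<gamma> \<tau>) i) has_real_derivative deriv (\<lambda>\<tau>. \<Phi> (\<gamma> \<tau>) i) 0) (at 0)" for i
  proof -
    have "smooth_at real_line 0 ((\<lambda>q. \<Phi> q i) \<circ> \<gamma>)"
      using \<gamma> smooth_at_chart_coordinate[OF p] unfolding smooth_map_at_def by blast
    then show ?thesis
      using smooth_at_real_line_differentiable by (fastforce simp: DERIV_deriv_iff_real_differentiable o_def)
  qed
  then have "((\<lambda>\<tau>. h (\<gamma> \<tau>)) has_real_derivative
      (\<Sum>i<d. deriv (\<lambda>\<tau>. \<Phi> (\<gamma> \<tau>) i) 0 * pd i (h \<circ> \<Phi>i) (\<Phi> (\<gamma> 0)))) (at 0)" if "smooth_at N (\<gamma> 0) h"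
    using that by (rule DERIV_in_chart[OF smooth_curve_in_open[OF \<gamma> open_domain p]])
  then show "velocity N \<gamma> 0 h = tvec (\<lambda>i. deriv (\<lambda>\<tau>. \<Phi> (\<gamma> \<tau>) i) 0) (\<gamma> 0) h"
    by (simp add: velocity_def tvec_def o_def DERIV_imp_deriv)
qed

text \<open>The curve is the coordinate line through \<open>\<Phi> p\<close> in the direction
  \<open>a\<close>, carried back to the manifold by the inverse chart.\<close>

lemma tvec_in_tangent_space:
  assumes p: "p \<in> D"
  shows "tvec a p \<in> tangent_space N p"
proof -
  \<comment> \<open>The zero tail keeps the line inside \<open>EE d\<close> for every
    \<open>t\<close>.\<close>
  define c where "c t = (\<lambda>i. if i < d then \<Phi> p i + t * a i else 0)" for t
  define \<gamma> where "\<gamma> t = \<Phi>i (c t)" for t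
  have c0: "c 0 = \<Phi> p"
    using chart_EE[OF p] by (auto simp: c_def EE_iff fun_eq_iff)
  have \<gamma>0: "\<gamma> 0 = p"
    using p by (simp add: \<gamma>_def c0)
  have cEE: "c t \<in> EE d" for t
    by (auto simp: c_def EE_iff)
  have smooth_c: "smooth_near 1 y (\<lambda>y. c (y 0) i)" if "y \<in> EE 1" for y i
    unfolding c_def using that
    by (cases "i < d")
      (auto intro!: smooth_near_add smooth_near_mult smooth_near_const smooth_near_coordinate)
  \<comment> \<open>The parameters at which the line is still in the chart image; at other
    parameters \<open>\<Phi>i\<close> has unspecified values.\<close>
  define T where "T = {y \<in> EE 1. c (y 0) \<in> \<Phi> ` D}"
  have T: "openin (Euclidean_space 1) T"
    unfolding T_def
  proof (rule openin_preimage_EE[OF openin_topspace _ chartD(3)])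
    show "(\<lambda>y. c (y 0)) ` EE 1 \<subseteq> EE d"
      using cEE by blast
    show "continuous_map (subtopology (Euclidean_space 1) (EE 1)) euclideanreal (\<lambda>y. c (y 0) i)" for i
      using smooth_c Ck_on_continuous smooth_fun_on_iff[OF openin_topspace] unfolding smooth_fun_on_def by blast
  qed
  have smooth: "smooth_map_at real_line N \<gamma> 0"
    unfolding smooth_map_at_def
  proof (intro conjI allI impI)
    show "0 \<in> pts real_line"
      by (simp add: pts_def real_line_def)
    have "\<gamma> (inv_into UNIV real_chart y) \<in> pts N" if "y \<in> T" for y
    proof -
      have "inv_into UNIV real_chart y = y 0"
        using that by (intro inv_real_chart) (simp add: T_def)
      moreover have "\<gamma> (y 0) \<in> D"
        using that unfolding T_def \<gamma>_def by (auto intro: inv_into_into)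
      ultimately show ?thesis
        using chartD(1) by auto
    qed
    moreover have "real_chart 0 \<in> T"
      using real_chart_EE[of 0] p by (auto simp: T_def c0)
    moreover have "T \<subseteq> range real_chart"
      unfolding real_chart_image by (auto simp: T_def)
    ultimately show "near real_line 0 (\<lambda>q. \<gamma> q \<in> pts N)"
      using T unfolding real_line.near_iff[OF UNIV_I] mdim_real_line by blast
    fix h assume "smooth_at N (\<gamma> 0) h"
    then have h: "smooth_near d (c (real_chart 0 0)) (h \<circ> \<Phi>i)"
      using p by (simp add: \<gamma>0 smooth_at_iff c0)
    have "smooth_near 1 (real_chart 0) (\<lambda>y. (h \<circ> \<Phi>i) (c (y 0)))"
      by (rule smooth_near_compose[where g = "\<lambda>y. c (y 0)" and f = "h \<circ> \<Phi>i", OF h openin_topspace real_chart_EE])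
        (use cEE in blast, rule smooth_c[OF real_chart_EE])
    then show "smooth_at real_line 0 (h \<circ> \<gamma>)"
      unfolding smooth_at_real_line_iff by (simp add: \<gamma>_def o_def)
  qed
  have D0: "\<gamma> 0 \<in> D"
    using p \<gamma>0 by simp
  have "deriv (\<lambda>\<tau>. \<Phi> (\<gamma> \<tau>) i) 0 = a i" if i: "i < d" for i
  proof (rule DERIV_imp_deriv)
    have cD: "((\<lambda>\<tau>. c \<tau> i) has_real_derivative a i) (at 0)"
      unfolding c_def using i by (auto intro!: derivative_eq_intros)
    have "((\<lambda>\<tau>. c \<tau> i) \<longlongrightarrow> c 0 i) (nhds 0)" for i
      unfolding c_def by (cases "i < d") (auto intro!: tendsto_eq_intros simp: filterlim_ident)
    then have "\<forall>\<^sub>F \<tau> in nhds 0. c \<tau> \<in> \<Phi> ` D"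
      using p c0 cEE by (intro eventually_in_open[OF chartD(3), of "c 0" c]) auto
    then have ev: "\<forall>\<^sub>F \<tau> in nhds 0. c \<tau> i = \<Phi> (\<gamma> \<tau>) i"
      by (rule eventually_mono) (auto simp: \<gamma>_def)
    show "((\<lambda>\<tau>. \<Phi> (\<gamma> \<tau>) i) has_real_derivative a i) (at 0)"
      by (rule DERIV_cong_ev[THEN iffD1, OF refl ev refl cD])
  qed
  then have "velocity N \<gamma> 0 = tvec a p"
    unfolding velocity_eq_tvec[OF smooth D0] \<gamma>0 by (rule tvec_cong)
  then show ?thesis
    using smooth \<gamma>0 unfolding tangent_space_def by (intro CollectI exI[of _ \<gamma>]) auto
qed

lemma tangent_space_eq:
  assumes p: "p \<in> D"
  shows "tangent_space N p = range (\<lambda>a. tvec a p)"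
proof
  show "tangent_space N p \<subseteq> range (\<lambda>a. tvec a p)"
    using velocity_eq_tvec p by (auto simp: tangent_space_def)
qed (use tvec_in_tangent_space[OF p] in auto)

lemma pd_chart_coordinate:
  assumes "p \<in> D" "i < d"
  shows "pd i ((\<lambda>q. \<Phi> q j) \<circ> \<Phi>i) (\<Phi> p) = (if i = j then 1 else 0)"
proof -
  have "pd i ((\<lambda>q. \<Phi> q j) \<circ> \<Phi>i) (\<Phi> p) = pd i (\<lambda>y. y j) (\<Phi> p)"
    by (rule pd_cong[OF chartD(3) _ assms(2)]) (use assms in auto)
  then show ?thesis
    by (simp add: pd_coordinate)
qed

lemma tvec_coordinate:
  assumes "p \<in> D" "i < d"
  shows "tvec a p (\<lambda>q. \<Phi> q i) = a i"
proof -
  have "(\<Sum>j<d. a j * pd j ((\<lambda>q. \<Phi> q i) \<circ> \<Phi>i) (\<Phi> p)) = (\<Sum>j<d. if j = i then a j else 0)"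
    by (rule sum.cong) (use assms in \<open>auto simp: pd_chart_coordinate\<close>)
  then show ?thesis
    using assms by (simp add: tvec_def smooth_at_chart_coordinate)
qed

lemma tangent_eq_tvec:
  assumes "p \<in> D" "V \<in> tangent_space N p"
  shows "V = tvec (\<lambda>i. V (\<lambda>q. \<Phi> q i)) p"
proof -
  obtain a where V: "V = tvec a p"
    using assms by (auto simp: tangent_space_eq)
  show ?thesis
    unfolding V by (rule tvec_cong) (simp add: tvec_coordinate assms)
qed

lemma tvec_local:
  assumes p: "p \<in> D" and fg: "near N p (\<lambda>q. f q = g q)"
  shows "tvec a p f = tvec a p g"
proof -
  obtain T where T: "openin (Euclidean_space d) T" "\<Phi> p \<in> T" "\<forall>y\<in>T. f (\<Phi>i y) = g (\<Phi>i y)"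
    using near_iff[OF p, THEN iffD1, OF fg] by blast
  have "pd i (f \<circ> \<Phi>i) (\<Phi> p) = pd i (g \<circ> \<Phi>i) (\<Phi> p)" if "i < d" for i
    by (rule pd_cong[OF T(1,2) that]) (use T(3) in auto)
  \<comment> \<open>Smoothness of the two functions has to be compared as well, because
    \<open>tvec\<close> switches to 0 where it fails.\<close>
  moreover have "near N p (\<lambda>q. g q = f q)"
    using fg by (rule near_mono) simp
  then have "smooth_at N p f \<longleftrightarrow> smooth_at N p g"
    using smooth_at_cong[OF fg] smooth_at_cong by blast
  ultimately show ?thesis
    by (simp add: tvec_def)
qed

lemma tvec_add:
  assumes p: "p \<in> D" and fg: "smooth_at N p f" "smooth_at N p g"
  shows "tvec a p (\<lambda>q. f q + g q) = tvec a p f + tvec a p g"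
proof -
  have "pd i ((\<lambda>q. f q + g q) \<circ> \<Phi>i) (\<Phi> p) = pd i (f \<circ> \<Phi>i) (\<Phi> p) + pd i (g \<circ> \<Phi>i) (\<Phi> p)" if "i < d" for i
    using pd_add[of d "\<Phi> p" "f \<circ> \<Phi>i" "g \<circ> \<Phi>i" i] fg that by (simp add: smooth_at_iff[OF p] o_def)
  then show ?thesis
    using fg smooth_at_add[OF fg] by (simp add: tvec_def sum.distrib algebra_simps)
qed

lemma tvec_mult:
  assumes p: "p \<in> D" and fg: "smooth_at N p f" "smooth_at N p g"
  shows "tvec a p (\<lambda>q. f q * g q) = tvec a p f * g p + f p * tvec a p g"
proof -
  have "pd i ((\<lambda>q. f q * g q) \<circ> \<Phi>i) (\<Phi> p)
      = pd i (f \<circ> \<Phi>i) (\<Phi> p) * g p + f p * pd i (g \<circ> \<Phi>i) (\<Phi> p)" if "i < d" for i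
    using pd_mult[of d "\<Phi> p" "f \<circ> \<Phi>i" "g \<circ> \<Phi>i" i] fg that p by (simp add: smooth_at_iff[OF p] o_def)
  then show ?thesis
    using fg smooth_at_mult[OF fg]
    by (simp add: tvec_def sum.distrib sum_distrib_left sum_distrib_right algebra_simps)
qed

lemma tvec_const: "tvec a p (\<lambda>q. c) = 0"
  by (simp add: tvec_def o_def pd_const)

text \<open>Smooth coefficients suffice, because the coordinate derivatives of a smooth function are
  again smooth near \<open>p\<close>.\<close>

lemma vector_field_atI:
  assumes p: "p \<in> D" and V: "near N p (\<lambda>q. V q = tvec (\<lambda>i. a i q) q)"
    and a: "\<And>i. i < d \<Longrightarrow> smooth_at N p (a i)"
  shows "vector_field_at N p V"
  unfolding vector_field_at_def
proof (intro conjI allI impI)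
  have inD: "near N p (\<lambda>q. q \<in> D)"
    by (rule near_open[OF open_domain p])
  show "near N p (\<lambda>q. V q \<in> tangent_space N q)"
    by (rule near_mono[OF near_conj[OF V inD]]) (auto intro: tvec_in_tangent_space)
  fix f assume f: "smooth_at N p f"
  have pdf: "smooth_at N p (\<lambda>q. pd i (f \<circ> \<Phi>i) (\<Phi> q))" if "i < d" for i
    unfolding smooth_at_iff[OF p]
    by (rule smooth_near_cong[OF chartD(3) imageI[OF p], of "pd i (f \<circ> \<Phi>i)"])
      (simp, fastforce, use f smooth_near_pd[OF _ that] in \<open>simp add: smooth_at_iff[OF p]\<close>)
  have "smooth_at N p (\<lambda>q. \<Sum>i<d. a i q * pd i (f \<circ> \<Phi>i) (\<Phi> q))"
    using p chartD(1) a pdf by (intro smooth_at_sum smooth_at_mult) auto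
  moreover have "near N p (\<lambda>q. (\<Sum>i<d. a i q * pd i (f \<circ> \<Phi>i) (\<Phi> q)) = V q f)"
    by (rule near_mono[OF near_conj[OF V near_smooth_at[OF f]]]) (simp add: tvec_def)
  ultimately show "smooth_at N p (\<lambda>q. V q f)"
    by (rule smooth_at_cong[rotated])
qed

lemma coord_vec_eq_tvec:
  assumes "i < d"
  shows "coord_vec N D \<Phi> i p = tvec (\<lambda>j. if j = i then 1 else 0) p"
proof
  fix h
  have "(\<Sum>j<d. (if j = i then 1 else 0) * pd j (h \<circ> \<Phi>i) (\<Phi> p))
      = (\<Sum>j<d. if j = i then pd j (h \<circ> \<Phi>i) (\<Phi> p) else 0)"
    by (rule sum.cong) auto
  then show "coord_vec N D \<Phi> i p h = tvec (\<lambda>j. if j = i then 1 else 0) p h"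
    using assms by (simp add: coord_vec_def tvec_def)
qed

end

section \<open>Tangent vectors as derivations, and tangent maps between charts\<close>

lemma sum_fun_apply: "(\<Sum>i\<in>I. f i) x = (\<Sum>i\<in>I. f i x)" for f :: "'i \<Rightarrow> 'a \<Rightarrow> 'b::comm_monoid_add"
  by (induction I rule: infinite_finite_induct) auto

context manifold_atlas
begin

lemma tangent_local:
  assumes "p \<in> pts N" "V \<in> tangent_space N p" "near N p (\<lambda>q. f q = g q)"
  shows "V f = V g"
proof (rule chart_exists[OF assms(1)])
  fix D \<phi> assume c: "manifold_chart N D \<phi>" "p \<in> D"
  then show ?thesis
    using assms(2) manifold_chart.tvec_local[OF c assms(3)] by (auto simp: manifold_chart.tangent_space_eq[OF c])
qed

lemma tangent_add:
  assumes "smooth_at N p f" "smooth_at N p g" "V \<in> tangent_space N p"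
  shows "V (\<lambda>q. f q + g q) = V f + V g"
proof (rule chart_exists[OF smooth_at_pts[OF assms(1)]])
  fix D \<phi> assume c: "manifold_chart N D \<phi>" "p \<in> D"
  then show ?thesis
    using assms(3) manifold_chart.tvec_add[OF c assms(1,2)] by (auto simp: manifold_chart.tangent_space_eq[OF c])
qed

lemma tangent_mult:
  assumes "smooth_at N p f" "smooth_at N p g" "V \<in> tangent_space N p"
  shows "V (\<lambda>q. f q * g q) = V f * g p + f p * V g"
proof (rule chart_exists[OF smooth_at_pts[OF assms(1)]])
  fix D \<phi> assume c: "manifold_chart N D \<phi>" "p \<in> D"
  then show ?thesis
    using assms(3) manifold_chart.tvec_mult[OF c assms(1,2)] by (auto simp: manifold_chart.tangent_space_eq[OF c])
qed

lemma tangent_const: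
  assumes "p \<in> pts N" "V \<in> tangent_space N p"
  shows "V (\<lambda>q. c) = 0"
proof (rule chart_exists[OF assms(1)])
  fix D \<phi> assume c: "manifold_chart N D \<phi>" "p \<in> D"
  then show ?thesis
    using assms(2) manifold_chart.tvec_const[OF c(1)] by (auto simp: manifold_chart.tangent_space_eq[OF c])
qed

lemma tangent_sum:
  assumes "p \<in> pts N" "\<And>i. i \<in> I \<Longrightarrow> smooth_at N p (f i)" "V \<in> tangent_space N p"
  shows "V (\<lambda>q. \<Sum>i\<in>I. f i q) = (\<Sum>i\<in>I. V (f i))"
proof (cases "finite I")
  case True
  then show ?thesis
    using assms(2)
  proof (induction I)
    case (insert i I)
    then show ?case
      using tangent_add[OF _ smooth_at_sum[OF assms(1)] assms(3), of "f i" I f] by simp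
  qed (simp add: tangent_const[OF assms(1,3)])
qed (simp add: tangent_const[OF assms(1,3)])

end

text \<open>On a set \<open>T\<close> where the values of \<open>F\<close> stay in
  \<open>D'\<close>, the map is Euclidean and the chain rule applies. Interchanging the two sums
  shows that the pushed-forward vector has the derivatives of the coordinates of \<open>F\<close> as
  its components.\<close>

lemma smooth_at_compose_charts:
  assumes N: "manifold_chart N D \<Phi>" and M: "manifold_chart M D' \<Phi>'"
    and p: "p \<in> D" "near N p (\<lambda>q. F q \<in> D')"
    and F: "\<And>i. i < mdim M \<Longrightarrow> smooth_at N p (\<lambda>q. \<Phi>' (F q) i)"
    and h: "smooth_at M (F p) h"
  shows "smooth_at N p (h \<circ> F)"
    and "manifold_chart.tvec N D \<Phi> a p (h \<circ> F)
      = manifold_chart.tvec M D' \<Phi>' (\<lambda>i. manifold_chart.tvec N D \<Phi> a p (\<lambda>q. \<Phi>' (F q) i)) (F p) h"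
proof -
  interpret N: manifold_chart N D \<Phi> by (rule N)
  interpret M: manifold_chart M D' \<Phi>' by (rule M)
  let ?g = "\<lambda>y. \<Phi>' (F (N.\<Phi>i y))"
  obtain T where T: "openin (Euclidean_space N.d) T" "\<Phi> p \<in> T" "T \<subseteq> \<Phi> ` D" "\<forall>y\<in>T. F (N.\<Phi>i y) \<in> D'"
    using N.near_iff[OF p(1), THEN iffD1, OF p(2)] by blast
  have Fp: "F p \<in> D'"
    by (rule near_self[OF p(2)])
  have "smooth_near M.d (\<Phi>' (F p)) (h \<circ> M.\<Phi>i)"
    using h M.smooth_at_iff[OF Fp] by blast
  then have h': "smooth_near M.d (?g (\<Phi> p)) (h \<circ> M.\<Phi>i)"
    using p by simp
  have g: "?g ` T \<subseteq> EE M.d"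
    using T(4) M.chart_EE by blast
  have gs: "smooth_near N.d (\<Phi> p) (\<lambda>y. ?g y i)" if "i < M.d" for i
    using F[OF that] N.smooth_at_iff[OF p(1)] by (simp add: o_def)
  have eq: "(h \<circ> M.\<Phi>i) (?g y) = (h \<circ> F \<circ> N.\<Phi>i) y" if "y \<in> T" for y
    using that T(4) by simp
  have "smooth_near N.d (\<Phi> p) (\<lambda>y. (h \<circ> M.\<Phi>i) (?g y))"
    by (rule smooth_near_compose[where g = ?g and f = "h \<circ> M.\<Phi>i", OF h' T(1,2) g gs])
  then have "smooth_near N.d (\<Phi> p) (h \<circ> F \<circ> N.\<Phi>i)"
    using smooth_near_cong[OF T(1,2), of "\<lambda>y. (h \<circ> M.\<Phi>i) (?g y)" "h \<circ> F \<circ> N.\<Phi>i", OF eq] by blast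
  then show sm: "smooth_at N p (h \<circ> F)"
    by (simp add: N.smooth_at_iff[OF p(1)])
  have "pd j (h \<circ> F \<circ> N.\<Phi>i) (\<Phi> p) = (\<Sum>i<M.d. pd j ((\<lambda>q. \<Phi>' (F q) i) \<circ> N.\<Phi>i) (\<Phi> p) * pd i (h \<circ> M.\<Phi>i) (\<Phi>' (F p)))"
    if "j < N.d" for j
  proof -
    have "pd j (h \<circ> F \<circ> N.\<Phi>i) (\<Phi> p) = pd j (\<lambda>y. (h \<circ> M.\<Phi>i) (?g y)) (\<Phi> p)"
      by (rule pd_cong[OF T(1,2) that]) (simp only: eq)
    also have "\<dots> = (\<Sum>i<M.d. pd j (\<lambda>y. ?g y i) (\<Phi> p) * pd i (h \<circ> M.\<Phi>i) (?g (\<Phi> p)))"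
      by (rule pd_compose[where g = ?g and f = "h \<circ> M.\<Phi>i", OF h' T(1,2) g gs that])
    finally show ?thesis
      using p by (simp add: o_def)
  qed
  then have "N.tvec a p (h \<circ> F) = (\<Sum>j<N.d. \<Sum>i<M.d. a j * pd j ((\<lambda>q. \<Phi>' (F q) i) \<circ> N.\<Phi>i) (\<Phi> p) * pd i (h \<circ> M.\<Phi>i) (\<Phi>' (F p)))"
    using sm by (simp add: N.tvec_def sum_distrib_left mult.assoc)
  also have "\<dots> = (\<Sum>i<M.d. (\<Sum>j<N.d. a j * pd j ((\<lambda>q. \<Phi>' (F q) i) \<circ> N.\<Phi>i) (\<Phi> p)) * pd i (h \<circ> M.\<Phi>i) (\<Phi>' (F p)))"
    by (subst sum.swap) (simp add: sum_distrib_right)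
  also have "\<dots> = M.tvec (\<lambda>i. N.tvec a p (\<lambda>q. \<Phi>' (F q) i)) (F p) h"
    using h F by (simp add: M.tvec_def N.tvec_def)
  finally show "N.tvec a p (h \<circ> F) = M.tvec (\<lambda>i. N.tvec a p (\<lambda>q. \<Phi>' (F q) i)) (F p) h" .
qed

lemma tmap_tvec:
  assumes N: "manifold_chart N D \<Phi>" and M: "manifold_chart M D' \<Phi>'"
    and p: "p \<in> D" "near N p (\<lambda>q. F q \<in> D')"
    and F: "\<And>i. i < mdim M \<Longrightarrow> smooth_at N p (\<lambda>q. \<Phi>' (F q) i)"
  shows "tmap M F (F p) (manifold_chart.tvec N D \<Phi> a p)
      = manifold_chart.tvec M D' \<Phi>' (\<lambda>i. manifold_chart.tvec N D \<Phi> a p (\<lambda>q. \<Phi>' (F q) i)) (F p)"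
proof
  fix h
  show "tmap M F (F p) (manifold_chart.tvec N D \<Phi> a p) h
      = manifold_chart.tvec M D' \<Phi>' (\<lambda>i. manifold_chart.tvec N D \<Phi> a p (\<lambda>q. \<Phi>' (F q) i)) (F p) h"
    using smooth_at_compose_charts(2)[OF N M p F]
    by (cases "smooth_at M (F p) h") (simp_all add: tmap_def manifold_chart.tvec_def[OF M])
qed

section \<open>Fibered charts\<close>

definition trunc :: "nat \<Rightarrow> (nat \<Rightarrow> real) \<Rightarrow> nat \<Rightarrow> real"
  where "trunc n y = (\<lambda>i. if i < n then y i else 0)"

lemma trunc_EE: "trunc n y \<in> EE n"
  by (simp add: trunc_def EE_iff)

lemma trunc_join: "a \<in> EE n \<Longrightarrow> trunc n (join n a b) = a"
  by (auto simp: trunc_def join_def EE_iff fun_eq_iff)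

lemma join_trunc: "join n (trunc n y) (\<lambda>i. y (n + i)) = y"
  by (auto simp: trunc_def join_def fun_eq_iff)

lemma join_EE: "b \<in> EE k \<Longrightarrow> join n a b \<in> EE (n + k)"
  by (simp add: join_def EE_iff)

lemma shift_EE: "y \<in> EE (n + k) \<Longrightarrow> (\<lambda>i. y (n + i)) \<in> EE k"
  by (simp add: EE_iff)

lemma openin_trunc_preimage:
  assumes "openin (Euclidean_space n) S"
  shows "openin (Euclidean_space (n + k)) {y \<in> EE (n + k). trunc n y \<in> S}"
proof (rule openin_preimage_EE[OF openin_topspace _ assms])
  show "continuous_map (subtopology (Euclidean_space (n + k)) (EE (n + k))) euclideanreal (\<lambda>y. trunc n y i)"
    if "i < n" for i
    using that Ck_on_continuous[OF Ck_on_coordinate[OF openin_topspace]] by (simp add: trunc_def)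
qed (use trunc_EE in blast)

lemma smooth_near_trunc:
  assumes "y \<in> EE (n + k)" "smooth_near n (trunc n y) f"
  shows "smooth_near (n + k) y (\<lambda>y. f (trunc n y))"
proof (rule smooth_near_compose[where g = "trunc n", OF assms(2) openin_topspace assms(1)])
  show "smooth_near (n + k) y (\<lambda>y. trunc n y i)" if "i < n" for i
    using that smooth_near_coordinate[OF assms(1)] by (simp add: trunc_def)
qed (use trunc_EE in blast)

text \<open>A common form for the chart domains of \<open>total_mfd\<close>, \<open>dual_mfd\<close>
  and \<open>dual_times_mfd\<close>: \<pi> is the bundle projection, and \<open>F\<close> says that
  the vector part lies in the fibre over its base point.\<close>

definition fibset :: "('q \<Rightarrow> 'm) \<Rightarrow> ('q \<Rightarrow> bool) \<Rightarrow> 'm set \<Rightarrow> 'q set"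
  where "fibset \<pi> F X = {q. \<pi> q \<in> X \<and> F q}"

definition fibchart :: "nat \<Rightarrow> ('q \<Rightarrow> 'm) \<Rightarrow> ('m \<Rightarrow> nat \<Rightarrow> real) \<Rightarrow> ('q \<Rightarrow> nat \<Rightarrow> real) \<Rightarrow> 'q \<Rightarrow> nat \<Rightarrow> real"
  where "fibchart n \<pi> \<phi> \<beta> q = join n (\<phi> (\<pi> q)) (\<beta> q)"

definition fiber_coords ::
  "'m mfd \<Rightarrow> ('q \<Rightarrow> 'm) \<Rightarrow> ('q \<Rightarrow> bool) \<Rightarrow> nat \<Rightarrow> 'm set \<Rightarrow> ('q \<Rightarrow> nat \<Rightarrow> real) \<Rightarrow> bool"
  where "fiber_coords M \<pi> F k U \<beta> \<longleftrightarrow> openin (mtop M) U \<and>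
    (\<forall>p\<in>U. bij_betw \<beta> {q. \<pi> q = p \<and> F q} (EE k))"

text \<open>A transition that is linear in the fibre with coefficients smooth on the base. The
  condition is directed; the inverse transition is the condition for the swapped pair.\<close>

definition fiber_compat ::
  "'m mfd \<Rightarrow> ('q \<Rightarrow> 'm) \<Rightarrow> ('q \<Rightarrow> bool) \<Rightarrow> nat \<Rightarrow> 'm set \<times> ('q \<Rightarrow> nat \<Rightarrow> real) \<Rightarrow> 'm set \<times> ('q \<Rightarrow> nat \<Rightarrow> real) \<Rightarrow> bool"
  where "fiber_compat M \<pi> F k = (\<lambda>(U, \<beta>) (U', \<beta>'). \<exists>T.
    (\<forall>p\<in>U \<inter> U'. \<forall>i<k. \<forall>j<k. smooth_at M p (T j i)) \<and>
    (\<forall>q\<in>fibset \<pi> F (U \<inter> U'). \<forall>j<k. \<beta>' q j = (\<Sum>i<k. T j i (\<pi> q) * \<beta> q i)))"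

context manifold_chart
begin

text \<open>Fibre coordinates fill all of \<open>EE k\<close>, so the image is the full cylinder
  over the image of \<open>X\<close>. Openness is thereby reduced to the base.\<close>

lemma fibchart_image:
  assumes \<beta>: "fiber_coords N \<pi> F k U \<beta>" and X: "X \<subseteq> D \<inter> U"
  shows "fibchart d \<pi> \<Phi> \<beta> ` fibset \<pi> F X = {y \<in> EE (d + k). trunc d y \<in> \<Phi> ` X}"
proof (intro equalityI subsetI)
  fix y assume "y \<in> fibchart d \<pi> \<Phi> \<beta> ` fibset \<pi> F X"
  then obtain q where q: "\<pi> q \<in> X" "F q" "y = join d (\<Phi> (\<pi> q)) (\<beta> q)"
    by (auto simp: fibset_def fibchart_def)
  moreover have "\<beta> q \<in> EE k"
    using \<beta> X q by (auto simp: fiber_coords_def bij_betw_def)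
  ultimately show "y \<in> {y \<in> EE (d + k). trunc d y \<in> \<Phi> ` X}"
    using X chart_EE[of "\<pi> q"] by (auto simp: join_EE trunc_join)
next
  fix y assume "y \<in> {y \<in> EE (d + k). trunc d y \<in> \<Phi> ` X}"
  then obtain p where y: "y \<in> EE (d + k)" "trunc d y = \<Phi> p" "p \<in> X"
    by auto
  then have "(\<lambda>i. y (d + i)) \<in> \<beta> ` {q. \<pi> q = p \<and> F q}"
    using \<beta> X shift_EE by (auto simp: fiber_coords_def bij_betw_def)
  then obtain q where q: "\<pi> q = p" "F q" "(\<lambda>i. y (d + i)) = \<beta> q"
    by auto
  have "fibchart d \<pi> \<Phi> \<beta> q = y"
    using join_trunc[of d y] by (simp add: fibchart_def q(1) y(2)[symmetric] q(3)[symmetric])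
  then show "y \<in> fibchart d \<pi> \<Phi> \<beta> ` fibset \<pi> F X"
    using q y by (auto simp: fibset_def)
qed

lemma inj_on_fibchart:
  assumes \<beta>: "fiber_coords N \<pi> F k U \<beta>" and X: "X \<subseteq> D \<inter> U"
  shows "inj_on (fibchart d \<pi> \<Phi> \<beta>) (fibset \<pi> F X)"
proof (rule inj_onI)
  fix q q' assume q: "q \<in> fibset \<pi> F X" "q' \<in> fibset \<pi> F X" "fibchart d \<pi> \<Phi> \<beta> q = fibchart d \<pi> \<Phi> \<beta> q'"
  then have D: "\<pi> q \<in> D \<inter> U" "\<pi> q' \<in> D \<inter> U"
    using X by (auto simp: fibset_def)
  have "trunc d (fibchart d \<pi> \<Phi> \<beta> q) = trunc d (fibchart d \<pi> \<Phi> \<beta> q')"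
    using q by simp
  then have "\<Phi> (\<pi> q) = \<Phi> (\<pi> q')"
    using D chart_EE by (simp add: fibchart_def trunc_join)
  then have \<pi>: "\<pi> q = \<pi> q'"
    using D chartD(2) by (auto dest: inj_onD)
  have "\<beta> q i = \<beta> q' i" for i
    using fun_cong[OF q(3), of "d + i"] by (simp add: fibchart_def join_def)
  then have "\<beta> q = \<beta> q'"
    by blast
  moreover have "inj_on \<beta> {r. \<pi> r = \<pi> q \<and> F r}"
    using \<beta> D by (auto simp: fiber_coords_def bij_betw_def)
  ultimately show "q = q'"
    using q \<pi> by (auto simp: fibset_def dest: inj_onD)
qed

lemma openin_fibchart_image:
  assumes \<beta>: "fiber_coords N \<pi> F k U \<beta>" and X: "X \<subseteq> D \<inter> U" and O: "openin (mtop N) W" "X = D \<inter> W"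
  shows "openin (Euclidean_space (d + k)) (fibchart d \<pi> \<Phi> \<beta> ` fibset \<pi> F X)"
  unfolding fibchart_image[OF \<beta> X]
  by (rule openin_trunc_preimage) (use open_image[OF O(1)] O(2) in simp)

text \<open>The base components are the base transition after projection; the fibre components are
  sums of smooth base functions times fibre coordinates. Both are smooth in all variables
  jointly.\<close>

lemma fibchart_transition:
  assumes \<beta>: "fiber_coords N \<pi> F k U \<beta>" and U': "openin (mtop N) U'" and D': "openin (mtop N) D'"
    and tr: "smooth_transition d (D, \<Phi>) (D', \<phi>')"
    and comp: "fiber_compat N \<pi> F k (U, \<beta>) (U', \<beta>')"
  shows "smooth_transition (d + k) (fibset \<pi> F (D \<inter> U), fibchart d \<pi> \<Phi> \<beta>)
      (fibset \<pi> F (D' \<inter> U'), fibchart d \<pi> \<phi>' \<beta>')"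
proof -
  define X where "X = D \<inter> (U \<inter> (D' \<inter> U'))"
  let ?Q = "fibset \<pi> F (D \<inter> U)" and ?\<Psi> = "fibchart d \<pi> \<Phi> \<beta>"
  have X: "X \<subseteq> D \<inter> U"
    by (auto simp: X_def)
  have int: "fibset \<pi> F (D \<inter> U) \<inter> fibset \<pi> F (D' \<inter> U') = fibset \<pi> F X"
    by (auto simp: fibset_def X_def)
  have U: "openin (mtop N) U"
    using \<beta> by (simp add: fiber_coords_def)
  then have op: "openin (Euclidean_space (d + k)) (?\<Psi> ` fibset \<pi> F X)"
    using U' D' by (intro openin_fibchart_image[OF \<beta> X _ X_def]) auto
  have inv: "inv_into ?Q ?\<Psi> (?\<Psi> q) = q" if "q \<in> fibset \<pi> F X" for q
    using inj_on_fibchart[OF \<beta> subset_refl] that X by (intro inv_into_f_f) (auto simp: fibset_def)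
  obtain T where T0: "\<forall>p\<in>U \<inter> U'. \<forall>i<k. \<forall>j<k. smooth_at N p (T j i)"
    "\<forall>q\<in>fibset \<pi> F (U \<inter> U'). \<forall>j<k. \<beta>' q j = (\<Sum>i<k. T j i (\<pi> q) * \<beta> q i)"
    using comp unfolding fiber_compat_def by blast
  have T: "smooth_at N p (T j i)" if "p \<in> U \<inter> U'" "i < k" "j < k" for p i j
    using T0(1) that by blast
  have T': "\<beta>' q j = (\<Sum>i<k. T j i (\<pi> q) * \<beta> q i)" if "q \<in> fibset \<pi> F (U \<inter> U')" "j < k" for q j
    using T0(2) that by blast
  have "smooth_fun_on (d + k) (?\<Psi> ` fibset \<pi> F X) (\<lambda>y. fibchart d \<pi> \<phi>' \<beta>' (inv_into ?Q ?\<Psi> y) i)"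
    if i: "i < d + k" for i
    unfolding smooth_fun_on_iff[OF op]
  proof
    fix y assume y: "y \<in> ?\<Psi> ` fibset \<pi> F X"
    then have y': "y \<in> EE (d + k)" "trunc d y \<in> \<Phi> ` X"
      unfolding fibchart_image[OF \<beta> X] by auto
    have tr_pt: "trunc d (?\<Psi> q) = \<Phi> (\<pi> q)" if "q \<in> fibset \<pi> F X" for q
      using that chart_EE by (auto simp: fibset_def X_def fibchart_def trunc_join)
    show "smooth_near (d + k) y (\<lambda>y. fibchart d \<pi> \<phi>' \<beta>' (inv_into ?Q ?\<Psi> y) i)"
    proof (cases "i < d")
      case True
      have "smooth_near d (trunc d y) (\<lambda>z. \<phi>' (\<Phi>i z) i)"
        using smooth_transitionD[OF tr] True y'(2) by (auto simp: smooth_fun_on_iff X_def)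
      from smooth_near_trunc[OF y'(1) this]
      show ?thesis
      proof (rule smooth_near_cong[OF op y, rotated])
        fix z assume "z \<in> ?\<Psi> ` fibset \<pi> F X"
        then obtain q where q: "q \<in> fibset \<pi> F X" "z = ?\<Psi> q"
          by blast
        then have "\<pi> q \<in> D"
          by (simp add: fibset_def X_def)
        then show "\<phi>' (\<Phi>i (trunc d z)) i = fibchart d \<pi> \<phi>' \<beta>' (inv_into ?Q ?\<Psi> z) i"
          unfolding q(2) inv[OF q(1)] tr_pt[OF q(1)] using True by (simp add: fibchart_def join_def)
      qed
    next
      case False
      define j where "j = i - d"
      have j: "j < k" "i = d + j"
        using i False by (auto simp: j_def)
      obtain p where p: "p \<in> X" "trunc d y = \<Phi> p"
        using y'(2) by blast
      have Tl: "smooth_near (d + k) y (\<lambda>y. (T j l \<circ> \<Phi>i) (trunc d y))" if l: "l < k" for l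
      proof (rule smooth_near_trunc[OF y'(1)])
        have pD: "p \<in> D" "p \<in> U \<inter> U'"
          using p(1) by (auto simp: X_def)
        show "smooth_near d (trunc d y) (T j l \<circ> \<Phi>i)"
          using T[OF pD(2) l j(1)] unfolding smooth_at_iff[OF pD(1)] p(2) .
      qed
      have "smooth_near (d + k) y (\<lambda>y. \<Sum>l<k. (T j l \<circ> \<Phi>i) (trunc d y) * y (d + l))"
        using y'(1) Tl by (intro smooth_near_sum smooth_near_mult smooth_near_coordinate) auto
      then show ?thesis
      proof (rule smooth_near_cong[OF op y, rotated])
        fix z assume "z \<in> ?\<Psi> ` fibset \<pi> F X"
        then obtain q where q: "q \<in> fibset \<pi> F X" "z = ?\<Psi> q"
          by blast
        then have "\<pi> q \<in> D" "q \<in> fibset \<pi> F (U \<inter> U')"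
          by (auto simp: fibset_def X_def)
        moreover have "?\<Psi> q (d + l) = \<beta> q l" for l
          by (simp add: fibchart_def join_def)
        ultimately show "(\<Sum>l<k. (T j l \<circ> \<Phi>i) (trunc d z) * z (d + l)) = fibchart d \<pi> \<phi>' \<beta>' (inv_into ?Q ?\<Psi> z) i"
          unfolding q(2) inv[OF q(1)] tr_pt[OF q(1)] using j T' by (simp add: fibchart_def join_def)
      qed
    qed
  qed
  then show ?thesis
    using op by (simp add: smooth_transition_def int)
qed

end

locale fibered_mfd = base: manifold_atlas M for M :: "'m mfd" +
  fixes N :: "'q mfd" and \<pi> :: "'q \<Rightarrow> 'm" and F :: "'q \<Rightarrow> bool" and k :: nat
    and \<F> :: "('m set \<times> ('q \<Rightarrow> nat \<Rightarrow> real)) set"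
  assumes mdim: "mdim N = mdim M + k"
    and charts_iff: "\<And>c. c \<in> charts N \<longleftrightarrow> (\<exists>D \<phi> U \<beta>. (D, \<phi>) \<in> charts M \<and> (U, \<beta>) \<in> \<F> \<and>
      c = (fibset \<pi> F (D \<inter> U), fibchart (mdim M) \<pi> \<phi> \<beta>))"
    and fiber_coords: "\<And>U \<beta>. (U, \<beta>) \<in> \<F> \<Longrightarrow> fiber_coords M \<pi> F k U \<beta>"
    and cover: "\<And>p. p \<in> pts M \<Longrightarrow> \<exists>U \<beta>. (U, \<beta>) \<in> \<F> \<and> p \<in> U"
    and compat: "\<And>b b'. b \<in> \<F> \<Longrightarrow> b' \<in> \<F> \<Longrightarrow> fiber_compat M \<pi> F k b b'"
begin

text \<open>Here the pair of \<open>U\<close> and \<beta> may lie outside \<F>: this is what makes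
  the coordinates of an arbitrary compatible frame a chart of the total space.\<close>

lemma coordinate_chart_fibchart:
  assumes D: "coordinate_chart M D \<phi>" and U: "fiber_coords M \<pi> F k U \<beta>"
    and comp: "\<And>b. b \<in> \<F> \<Longrightarrow> fiber_compat M \<pi> F k (U, \<beta>) b \<and> fiber_compat M \<pi> F k b (U, \<beta>)"
  shows "coordinate_chart N (fibset \<pi> F (D \<inter> U)) (fibchart (mdim M) \<pi> \<phi> \<beta>)"
  unfolding coordinate_chart_def
proof (intro conjI ballI)
  interpret D: manifold_chart M D \<phi>
    by (rule base.manifold_chartI[OF D])
  have Uo: "openin (mtop M) U"
    using U by (simp add: fiber_coords_def)
  show "fibset \<pi> F (D \<inter> U) \<subseteq> pts N"
  proof
    fix q assume q: "q \<in> fibset \<pi> F (D \<inter> U)"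
    then have "\<pi> q \<in> pts M"
      using D.chartD(1) by (auto simp: fibset_def)
    then obtain D' \<phi>' U' \<beta>' where "(D', \<phi>') \<in> charts M" "\<pi> q \<in> D'" "(U', \<beta>') \<in> \<F>" "\<pi> q \<in> U'"
      using cover unfolding pts_def by blast
    then have "(fibset \<pi> F (D' \<inter> U'), fibchart (mdim M) \<pi> \<phi>' \<beta>') \<in> charts N" "q \<in> fibset \<pi> F (D' \<inter> U')"
      using q unfolding charts_iff by (blast, simp add: fibset_def)
    then show "q \<in> pts N"
      unfolding pts_def by blast
  qed
  show "inj_on (fibchart (mdim M) \<pi> \<phi> \<beta>) (fibset \<pi> F (D \<inter> U))"
    by (rule D.inj_on_fibchart[OF U subset_refl])
  show "openin (Euclidean_space (mdim N)) (fibchart (mdim M) \<pi> \<phi> \<beta> ` fibset \<pi> F (D \<inter> U))"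
    unfolding mdim by (rule D.openin_fibchart_image[OF U subset_refl Uo refl])
  fix c assume "c \<in> charts N"
  then obtain D' \<phi>' U' \<beta>' where c: "(D', \<phi>') \<in> charts M" "(U', \<beta>') \<in> \<F>"
    "c = (fibset \<pi> F (D' \<inter> U'), fibchart (mdim M) \<pi> \<phi>' \<beta>')"
    unfolding charts_iff by blast
  interpret D': manifold_chart M D' \<phi>'
    by (rule base.manifold_chartI[OF base.charts[OF c(1)]])
  note U' = fiber_coords[OF c(2)]
  then have U'o: "openin (mtop M) U'"
    by (simp add: fiber_coords_def)
  show "smooth_transition (mdim N) (fibset \<pi> F (D \<inter> U), fibchart (mdim M) \<pi> \<phi> \<beta>) c"
    unfolding c(3) mdim
    by (rule D.fibchart_transition[OF U U'o D'.open_domain D.chartD(4)[OF c(1)]]) (use comp[OF c(2)] in blast)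
  show "smooth_transition (mdim N) c (fibset \<pi> F (D \<inter> U), fibchart (mdim M) \<pi> \<phi> \<beta>)"
    unfolding c(3) mdim
    by (rule D'.fibchart_transition[OF U' Uo D.open_domain D.chartD(5)[OF c(1)]]) (use comp[OF c(2)] in blast)
qed

lemma manifold_atlas_total: "manifold_atlas N"
proof
  fix P \<Phi> assume "(P, \<Phi>) \<in> charts N"
  then obtain D \<phi> U \<beta> where c: "(D, \<phi>) \<in> charts M" "(U, \<beta>) \<in> \<F>"
    "P = fibset \<pi> F (D \<inter> U)" "\<Phi> = fibchart (mdim M) \<pi> \<phi> \<beta>"
    unfolding charts_iff by blast
  show "coordinate_chart N P \<Phi>"
    unfolding c(3,4) using compat c(2)
    by (intro coordinate_chart_fibchart base.charts[OF c(1)] fiber_coords[OF c(2)]) blast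
qed

end

section \<open>Bases, coefficients and dual coordinates\<close>

text \<open>\<open>is_basis\<close> speaks of the set of basis vectors while the sums run over
  indices. Injectivity of \<open>b\<close> moves the coefficients to the vectors, where linear
  independence is formulated.\<close>

lemma is_basis_independent:
  assumes b: "is_basis r b V" and eq: "(\<Sum>k<r. c k *\<^sub>R b k) = (\<Sum>k<r. c' k *\<^sub>R b k)" and k: "k < r"
  shows "c k = c' k"
proof (rule ccontr)
  assume ne: "c k \<noteq> c' k"
  have inj: "inj_on b {..<r}" and ind: "independent (b ` {..<r})"
    using b by (auto simp: is_basis_def)
  define u where "u v = c (inv_into {..<r} b v) - c' (inv_into {..<r} b v)" for v
  have u: "u (b i) = c i - c' i" if "i < r" for i
    using that inj by (simp add: u_def)
  have "(\<Sum>v\<in>b ` {..<r}. u v *\<^sub>R v) = (\<Sum>i<r. u (b i) *\<^sub>R b i)"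
    by (simp add: sum.reindex[OF inj])
  also have "\<dots> = (\<Sum>i<r. c i *\<^sub>R b i - c' i *\<^sub>R b i)"
    by (rule sum.cong) (auto simp: u scaleR_diff_left)
  also have "\<dots> = 0"
    using eq by (simp add: sum_subtractf)
  finally have "(\<Sum>v\<in>b ` {..<r}. u v *\<^sub>R v) = 0" .
  moreover have "\<exists>v\<in>b ` {..<r}. u v \<noteq> 0"
    using ne u[OF k] k by (intro bexI[of _ "b k"]) auto
  ultimately have "dependent (b ` {..<r})"
    by (subst dependent_finite) (simp, intro exI[of _ u] conjI)
  then show False
    using ind by simp
qed

lemma basis_subspace: "is_basis r b V \<Longrightarrow> subspace V"
  by (auto simp: is_basis_def)

lemma basis_mem: "is_basis r b V \<Longrightarrow> k < r \<Longrightarrow> b k \<in> V"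
  unfolding is_basis_def by (metis imageI lessThan_iff span_base)

lemma basis_combination: "is_basis r b V \<Longrightarrow> (\<Sum>k<r. c k *\<^sub>R b k) \<in> V"
  by (intro subspace_sum subspace_scale basis_subspace basis_mem) auto

lemma basis_expansion_exists:
  assumes b: "is_basis r b V" and v: "v \<in> V"
  shows "\<exists>c. (\<forall>k\<ge>r. c k = 0) \<and> v = (\<Sum>k<r. c k *\<^sub>R b k)"
proof -
  have inj: "inj_on b {..<r}"
    using b by (simp add: is_basis_def)
  have "v \<in> span (b ` {..<r})"
    using b v by (simp add: is_basis_def)
  then obtain u where "v = (\<Sum>w\<in>b ` {..<r}. u w *\<^sub>R w)"
    by (auto simp: span_finite)
  then have "v = (\<Sum>k<r. u (b k) *\<^sub>R b k)"
    by (simp add: sum.reindex[OF inj])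
  then show ?thesis
    by (intro exI[of _ "\<lambda>k. if k < r then u (b k) else 0"]) simp
qed

text \<open>The zero tail in \<open>coeffs\<close> is what determines the coefficient function at
  every index, including those without a basis vector.\<close>

lemma coeffs_unique:
  assumes b: "is_basis r b V" and c: "\<forall>k\<ge>r. c k = 0" "v = (\<Sum>k<r. c k *\<^sub>R b k)"
  shows "coeffs r b v = c"
  unfolding coeffs_def
proof (rule the_equality)
  show "(\<forall>k\<ge>r. c k = 0) \<and> v = (\<Sum>k<r. c k *\<^sub>R b k)"
    using c by blast
  fix c' assume c': "(\<forall>k\<ge>r. c' k = 0) \<and> v = (\<Sum>k<r. c' k *\<^sub>R b k)"
  have "c' k = c k" for k
    using is_basis_independent[OF b, of c' c k] c c' by (cases "k < r") auto
  then show "c' = c"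
    by blast
qed

lemma coeffs_expansion:
  assumes "is_basis r b V" "v \<in> V"
  shows "v = (\<Sum>k<r. coeffs r b v k *\<^sub>R b k)" "\<forall>k\<ge>r. coeffs r b v k = 0"
proof -
  obtain c where c: "\<forall>k\<ge>r. c k = 0" "v = (\<Sum>k<r. c k *\<^sub>R b k)"
    using basis_expansion_exists[OF assms] by blast
  show "v = (\<Sum>k<r. coeffs r b v k *\<^sub>R b k)" "\<forall>k\<ge>r. coeffs r b v k = 0"
    unfolding coeffs_unique[OF assms(1) c] by (rule c)+
qed

lemma coeffs_combination:
  assumes "is_basis r b V" "k < r"
  shows "coeffs r b (\<Sum>k<r. c k *\<^sub>R b k) k = c k"
proof -
  have "coeffs r b (\<Sum>k<r. c k *\<^sub>R b k) = (\<lambda>k. if k < r then c k else 0)"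
    by (rule coeffs_unique[OF assms(1)]) (auto intro: sum.cong)
  then show ?thesis
    using assms(2) by simp
qed

lemma coeffs_sum:
  assumes b: "is_basis r b V" and v: "\<And>i. i \<in> I \<Longrightarrow> v i \<in> V"
  shows "coeffs r b (\<Sum>i\<in>I. a i *\<^sub>R v i) k = (\<Sum>i\<in>I. a i * coeffs r b (v i) k)"
proof -
  have "(\<Sum>i\<in>I. a i *\<^sub>R v i) = (\<Sum>i\<in>I. a i *\<^sub>R (\<Sum>k<r. coeffs r b (v i) k *\<^sub>R b k))"
    by (rule sum.cong) (use coeffs_expansion(1)[OF b v] in auto)
  also have "\<dots> = (\<Sum>k<r. (\<Sum>i\<in>I. a i * coeffs r b (v i) k) *\<^sub>R b k)"
    by (simp add: scaleR_sum_right scaleR_sum_left) (rule sum.swap)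
  finally have "coeffs r b (\<Sum>i\<in>I. a i *\<^sub>R v i) = (\<lambda>k. \<Sum>i\<in>I. a i * coeffs r b (v i) k)"
    by (intro coeffs_unique[OF b]) (use coeffs_expansion(2)[OF b v] in auto)
  then show ?thesis
    by simp
qed

lemma coeffs_EE: "is_basis r b V \<Longrightarrow> v \<in> V \<Longrightarrow> coeffs r b v \<in> EE r"
  using coeffs_expansion(2)[of r b V v] by (simp add: EE_iff)

lemma bij_betw_coeffs:
  assumes b: "is_basis r b V"
  shows "bij_betw (coeffs r b) V (EE r)"
  unfolding bij_betw_def
proof (intro conjI subset_antisym subsetI inj_onI)
  show "v = w" if "v \<in> V" "w \<in> V" "coeffs r b v = coeffs r b w" for v w
    using that coeffs_expansion(1)[OF b] by metis
  show "c \<in> coeffs r b ` V" if "c \<in> EE r" for c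
    using that coeffs_unique[OF b, of c "\<Sum>k<r. c k *\<^sub>R b k"] basis_combination[OF b, of c]
    by (auto simp: EE_iff intro!: image_eqI)
qed (use coeffs_EE[OF b] in auto)

lemma linear_on_set_sum:
  assumes V: "subspace V" and f: "linear_on_set V f" and v: "\<And>i. i \<in> I \<Longrightarrow> v i \<in> V"
  shows "f (\<Sum>i\<in>I. a i *\<^sub>R v i) = (\<Sum>i\<in>I. a i *\<^sub>R f (v i))"
proof -
  have lin: "f (a *\<^sub>R v + b *\<^sub>R w) = a *\<^sub>R f v + b *\<^sub>R f w" if "v \<in> V" "w \<in> V" for a b v w
    using f that by (simp add: linear_on_set_def)
  have f0: "f 0 = 0"
    using lin[of 0 0 0 0] V by (simp add: subspace_0)
  show ?thesis
  proof (cases "finite I")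
    case True
    then show ?thesis
      using v
    proof (induction I)
      case (insert i I)
      have "(\<Sum>i\<in>I. a i *\<^sub>R v i) \<in> V"
        using insert by (intro subspace_sum[OF V] subspace_scale[OF V]) auto
      then show ?case
        using insert lin[of "v i" "\<Sum>i\<in>I. a i *\<^sub>R v i" "a i" 1] by simp
    qed (simp add: f0)
  qed (simp add: f0)
qed

lemma dual_of_sum:
  assumes "is_basis r b V" "\<eta> \<in> dual_of V" "\<And>i. i \<in> I \<Longrightarrow> v i \<in> V"
  shows "\<eta> (\<Sum>i\<in>I. a i *\<^sub>R v i) = (\<Sum>i\<in>I. a i * \<eta> (v i))"
  using linear_on_set_sum[OF basis_subspace[OF assms(1)], of \<eta> I v a] assms by (simp add: dual_of_def)

lemma dual_of_expansion:
  assumes b: "is_basis r b V" and \<eta>: "\<eta> \<in> dual_of V" and v: "v \<in> V"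
  shows "\<eta> v = (\<Sum>k<r. coeffs r b v k * \<eta> (b k))"
proof -
  have "\<eta> v = \<eta> (\<Sum>k<r. coeffs r b v k *\<^sub>R b k)"
    using coeffs_expansion(1)[OF b v] by (rule arg_cong)
  also have "\<dots> = (\<Sum>k<r. coeffs r b v k * \<eta> (b k))"
    by (rule dual_of_sum[OF b \<eta>]) (simp add: basis_mem[OF b])
  finally show ?thesis .
qed

lemma dual_coords_EE: "dual_coords r b \<eta> \<in> EE r"
  by (simp add: dual_coords_def EE_iff)

lemma bij_betw_dual_coords:
  assumes b: "is_basis r b V"
  shows "bij_betw (dual_coords r b) (dual_of V) (EE r)"
  unfolding bij_betw_def
proof (intro conjI subset_antisym subsetI inj_onI)
  fix \<eta> \<eta>' assume \<eta>: "\<eta> \<in> dual_of V" "\<eta>' \<in> dual_of V" "dual_coords r b \<eta> = dual_coords r b \<eta>'"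
  have "\<eta> (b k) = \<eta>' (b k)" if "k < r" for k
    using fun_cong[OF \<eta>(3), of k] that by (simp add: dual_coords_def)
  then have "\<eta> v = \<eta>' v" if "v \<in> V" for v
    using dual_of_expansion[OF b \<eta>(1) that] dual_of_expansion[OF b \<eta>(2) that] by simp
  then show "\<eta> = \<eta>'"
    using \<eta>(1,2) by (fastforce simp: dual_of_def)
next
  fix c assume c: "c \<in> EE r"
  \<comment> \<open>The functional with prescribed values \<open>c\<close> on the basis, set to 0
    off \<open>V\<close> as \<open>dual_of\<close> demands.\<close>
  define \<eta> where "\<eta> v = (if v \<in> V then \<Sum>k<r. coeffs r b v k * c k else 0)" for v
  have "\<eta> (s *\<^sub>R v + t *\<^sub>R w) = s *\<^sub>R \<eta> v + t *\<^sub>R \<eta> w" if "v \<in> V" "w \<in> V" for s t v w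
  proof -
    have "s *\<^sub>R v + t *\<^sub>R w \<in> V"
      using that basis_subspace[OF b] by (intro subspace_add subspace_scale)
    \<comment> \<open>The rule for finite sums is applied with the two truth values as index set,
      one for each summand.\<close>
    moreover have "coeffs r b (s *\<^sub>R v + t *\<^sub>R w) k = s * coeffs r b v k + t * coeffs r b w k" for k
      using coeffs_sum[OF b, of UNIV "\<lambda>i. if i then v else w" "\<lambda>i. if i then s else t" k] that
      by (simp add: UNIV_bool algebra_simps)
    ultimately show ?thesis
      using that by (simp add: \<eta>_def sum.distrib sum_distrib_left algebra_simps)
  qed
  then have "\<eta> \<in> dual_of V"
    by (auto simp: dual_of_def linear_on_set_def \<eta>_def)
  moreover have "dual_coords r b \<eta> = c"
  proof
    fix i
    have "coeffs r b (b i) = (\<lambda>k. if k = i then 1 else 0)" if "i < r"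
      using that by (intro coeffs_unique[OF b]) (auto simp: if_distrib[of "\<lambda>x. x *\<^sub>R _"] cong: if_cong)
    moreover have "(\<Sum>k<r. (if k = i then 1 else 0) * c k) = c i" if "i < r"
      using that by (simp add: if_distrib[of "\<lambda>x. x * _"] cong: if_cong)
    ultimately show "dual_coords r b \<eta> i = c i"
      using c basis_mem[OF b] by (auto simp: dual_coords_def \<eta>_def EE_iff)
  qed
  ultimately show "c \<in> dual_coords r b ` dual_of V"
    by blast
qed (use dual_coords_EE in auto)

section \<open>Vector bundles in local frames\<close>

locale vbundle_over = manifold_atlas M for M :: "'m mfd" +
  fixes E :: "('m, 'a::real_vector, 'z) vbundle_scheme"
  assumes vb: "vector_bundle M E"
begin

lemma frames_local_frame: "(U, e) \<in> frames E \<Longrightarrow> local_frame M E (vrank E) U e"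
  using vb by (auto simp: vector_bundle_def)

lemma frames_cover: "p \<in> pts M \<Longrightarrow> \<exists>U e. (U, e) \<in> frames E \<and> p \<in> U"
  using vb by (fastforce simp: vector_bundle_def)

lemma frames_domain: "(U, e) \<in> frames E \<Longrightarrow> p \<in> U \<Longrightarrow> p \<in> pts M"
  using vb by (fastforce simp: vector_bundle_def)

end

lemma local_frameD:
  assumes "local_frame M E r U e"
  shows "vrank E = r" "openin (mtop M) U"
    and "p \<in> U \<Longrightarrow> is_basis r (\<lambda>k. e k p) (fib E p)"
    and "p \<in> U \<Longrightarrow> k < r \<Longrightarrow> smooth_section_at M E p (e k)"
    and "p \<in> U \<Longrightarrow> (U', e') \<in> frames E \<Longrightarrow> p \<in> U' \<Longrightarrow> j < r \<Longrightarrow> k < r \<Longrightarrow>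
      smooth_at M p (\<lambda>q. coeffs r (\<lambda>i. e i q) (e' j q) k)"
  using assms unfolding local_frame_def by blast+

locale local_frame_on = vbundle_over M E
  for M :: "'m mfd" and E :: "('m, 'a::real_vector, 'z) vbundle_scheme" +
  fixes r :: nat and U :: "'m set" and e :: "nat \<Rightarrow> 'm \<Rightarrow> 'a"
  assumes frame: "local_frame M E r U e"
begin

lemmas frameD = local_frameD[OF frame]
lemmas basis = frameD(3)

abbreviation "cf q v \<equiv> coeffs r (\<lambda>i. e i q) v"

text \<open>The transition clause of \<open>local_frame\<close> expands atlas frames in
  \<open>e\<close>; the opposite expansion is contained in the smoothness of the sections
  \<open>e j\<close>. Compatibility of charts uses both directions.\<close>

lemma frame_section_coeffs:
  "p \<in> U \<Longrightarrow> (U', e') \<in> frames E \<Longrightarrow> p \<in> U' \<Longrightarrow> j < r \<Longrightarrow> k < r \<Longrightarrow>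
    smooth_at M p (\<lambda>q. coeffs r (\<lambda>i. e' i q) (e j q) k)"
  using frameD(4)[of p j] frameD(1) unfolding smooth_section_at_def by blast

lemma near_U: "p \<in> U \<Longrightarrow> near M p (\<lambda>q. q \<in> U)"
  by (rule near_open[OF frameD(2)])

text \<open>Smoothness of a section is tested in atlas frames. Multiplying those coefficients by the
  transition coefficients gives the coefficients in \<open>e\<close>.\<close>

lemma smooth_section_coeffs:
  assumes p: "p \<in> U" and \<sigma>: "smooth_section_at M E p \<sigma>" and k: "k < r"
  shows "smooth_at M p (\<lambda>q. cf q (\<sigma> q) k)"
proof -
  have pM: "p \<in> pts M"
    using \<sigma> by (simp add: smooth_section_at_def)
  obtain U' e' where e': "(U', e') \<in> frames E" "p \<in> U'"
    using frames_cover[OF pM] by blast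
  have lf: "local_frame M E r U' e'"
    using frames_local_frame[OF e'(1)] frameD(1) by simp
  have "smooth_at M p (\<lambda>q. \<Sum>j<r. coeffs r (\<lambda>i. e' i q) (\<sigma> q) j * cf q (e' j q) k)"
    using \<sigma> e' frameD(1) frameD(5)[OF p e' _ k]
    by (intro smooth_at_sum[OF pM] smooth_at_mult) (auto simp: smooth_section_at_def)
  moreover have "near M p (\<lambda>q. q \<in> U \<and> q \<in> U' \<and> \<sigma> q \<in> fib E q)"
    using \<sigma> by (intro near_conj near_U[OF p] near_open[OF local_frameD(2)[OF lf] e'(2)]) (simp add: smooth_section_at_def)
  then have "near M p (\<lambda>q. (\<Sum>j<r. coeffs r (\<lambda>i. e' i q) (\<sigma> q) j * cf q (e' j q) k) = cf q (\<sigma> q) k)"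
  proof (rule near_mono)
    fix q assume q: "q \<in> U \<and> q \<in> U' \<and> \<sigma> q \<in> fib E q"
    note b' = local_frameD(3)[OF lf, of q]
    have "cf q (\<sigma> q) k = cf q (\<Sum>j<r. coeffs r (\<lambda>i. e' i q) (\<sigma> q) j *\<^sub>R e' j q) k"
      using coeffs_expansion(1)[OF b', of "\<sigma> q"] q by simp
    also have "\<dots> = (\<Sum>j<r. coeffs r (\<lambda>i. e' i q) (\<sigma> q) j * cf q (e' j q) k)"
      using q basis_mem[OF b'] by (intro coeffs_sum[OF basis]) auto
    finally show "(\<Sum>j<r. coeffs r (\<lambda>i. e' i q) (\<sigma> q) j * cf q (e' j q) k) = cf q (\<sigma> q) k"
      by simp
  qed
  ultimately show ?thesis
    by (rule smooth_at_cong[rotated])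
qed

text \<open>The coefficients in an atlas frame are the given ones times transition coefficients. An
  equality near \<open>p\<close> is enough, since \<open>\<sigma>\<close> is arbitrary
  elsewhere.\<close>

lemma smooth_section_combination:
  assumes p: "p \<in> U" "p \<in> pts M" and \<sigma>: "near M p (\<lambda>q. \<sigma> q = (\<Sum>k<r. c k q *\<^sub>R e k q))"
    and c: "\<And>k. k < r \<Longrightarrow> smooth_at M p (c k)"
  shows "smooth_section_at M E p \<sigma>"
  unfolding smooth_section_at_def
proof (intro conjI ballI, goal_cases)
  case 2
  show ?case
    by (rule near_mono[OF near_conj[OF \<sigma> near_U[OF p(1)]]]) (use basis_combination[OF basis] in auto)
next
  case (3 b)
  obtain U' e' where b: "b = (U', e')"
    by (cases b)
  show ?case
    unfolding b
  proof (clarify)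
    fix k assume k: "k < vrank E" and pU': "p \<in> U'"
    have e': "(U', e') \<in> frames E"
      using 3 b by simp
    have k': "k < r"
      using k frameD(1) by simp
    have lf: "local_frame M E r U' e'"
      using frames_local_frame[OF e'] frameD(1) by simp
    have "smooth_at M p (\<lambda>q. \<Sum>j<r. c j q * coeffs r (\<lambda>i. e' i q) (e j q) k)"
      using c frame_section_coeffs[OF p(1) e' pU' _ k'] by (intro smooth_at_sum[OF p(2)] smooth_at_mult) auto
    moreover have "near M p (\<lambda>q. \<sigma> q = (\<Sum>k<r. c k q *\<^sub>R e k q) \<and> q \<in> U \<and> q \<in> U')"
      by (intro near_conj \<sigma> near_U[OF p(1)] near_open[OF local_frameD(2)[OF lf] pU'])
    then have "near M p (\<lambda>q. (\<Sum>j<r. c j q * coeffs r (\<lambda>i. e' i q) (e j q) k)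
        = coeffs (vrank E) (\<lambda>i. e' i q) (\<sigma> q) k)"
    proof (rule near_mono)
      fix q assume q: "\<sigma> q = (\<Sum>k<r. c k q *\<^sub>R e k q) \<and> q \<in> U \<and> q \<in> U'"
      then have "coeffs r (\<lambda>i. e' i q) (\<sigma> q) k = (\<Sum>j<r. c j q * coeffs r (\<lambda>i. e' i q) (e j q) k)"
        using basis_mem[OF basis[of q]] coeffs_sum[OF local_frameD(3)[OF lf, of q], of "{..<r}" "\<lambda>j. e j q" "\<lambda>j. c j q" k]
        by simp
      then show "(\<Sum>j<r. c j q * coeffs r (\<lambda>i. e' i q) (e j q) k) = coeffs (vrank E) (\<lambda>i. e' i q) (\<sigma> q) k"
        by (simp add: frameD(1))
    qed
    ultimately show "smooth_at M p (\<lambda>q. coeffs (vrank E) (\<lambda>i. e' i q) (\<sigma> q) k)"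
      by (rule smooth_at_cong[rotated])
  qed
qed (rule p(2))

end

section \<open>The bundle, its dual and the product with the control bundle as fibered
  manifolds\<close>

definition total_fc :: "nat \<Rightarrow> (nat \<Rightarrow> 'm \<Rightarrow> 'a::real_vector) \<Rightarrow> 'm \<times> 'a \<Rightarrow> nat \<Rightarrow> real"
  where "total_fc r e = (\<lambda>(p, v). coeffs r (\<lambda>k. e k p) v)"

definition dual_fc :: "nat \<Rightarrow> (nat \<Rightarrow> 'm \<Rightarrow> 'a) \<Rightarrow> 'm \<times> ('a \<Rightarrow> real) \<Rightarrow> nat \<Rightarrow> real"
  where "dual_fc r e = (\<lambda>(p, \<eta>). dual_coords r (\<lambda>k. e k p) \<eta>)"

definition dual_times_fc ::
  "nat \<Rightarrow> nat \<Rightarrow> (nat \<Rightarrow> 'm \<Rightarrow> 'a) \<Rightarrow> (nat \<Rightarrow> 'm \<Rightarrow> 'c::real_vector) \<Rightarrow> 'm \<times> ('a \<Rightarrow> real) \<times> 'c \<Rightarrow> nat \<Rightarrow> real"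
  where "dual_times_fc r m e s = (\<lambda>(p, \<eta>, u). join r (dual_coords r (\<lambda>k. e k p) \<eta>) (coeffs m (\<lambda>k. s k p) u))"

definition total_fib :: "('m, 'a::real_vector, 'z) vbundle_scheme \<Rightarrow> 'm \<times> 'a \<Rightarrow> bool"
  where "total_fib E = (\<lambda>(p, v). v \<in> fib E p)"

definition dual_fib :: "('m, 'a::real_vector, 'z) vbundle_scheme \<Rightarrow> 'm \<times> ('a \<Rightarrow> real) \<Rightarrow> bool"
  where "dual_fib E = (\<lambda>(p, \<eta>). \<eta> \<in> dual_of (fib E p))"

definition dual_times_fib ::
  "('m, 'a::real_vector, 'z) vbundle_scheme \<Rightarrow> ('m, 'c::real_vector, 'y) vbundle_scheme \<Rightarrow>
    'm \<times> ('a \<Rightarrow> real) \<times> 'c \<Rightarrow> bool"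
  where "dual_times_fib E C = (\<lambda>(p, \<eta>, u). \<eta> \<in> dual_of (fib E p) \<and> u \<in> fib C p)"

lemma total_fibset: "fibset fst (total_fib E) X = {(p, v). p \<in> X \<and> v \<in> fib E p}"
  by (auto simp: fibset_def total_fib_def)

lemma dual_fibset: "fibset fst (dual_fib E) X = {(p, \<eta>). p \<in> X \<and> \<eta> \<in> dual_of (fib E p)}"
  by (auto simp: fibset_def dual_fib_def)

lemma dual_times_fibset: "fibset fst (dual_times_fib E C) X = dual_times_dom E C X"
  by (auto simp: fibset_def dual_times_fib_def dual_times_dom_def)

lemma total_fibchart:
  "fibchart n fst \<phi> (total_fc r e) = (\<lambda>(p, v). join n (\<phi> p) (coeffs r (\<lambda>k. e k p) v))"
  by (auto simp: fibchart_def total_fc_def)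

lemma dual_fibchart:
  "fibchart n fst \<phi> (dual_fc r e) = (\<lambda>(p, \<eta>). join n (\<phi> p) (dual_coords r (\<lambda>k. e k p) \<eta>))"
  by (auto simp: fibchart_def dual_fc_def)

lemma dual_times_fibchart:
  "fibchart n fst \<phi> (dual_times_fc r m e s) = dual_times_chart n r m \<phi> e s"
  by (auto simp: fibchart_def dual_times_fc_def dual_times_chart_def)

lemma total_fiber_coords:
  assumes "openin (mtop M) U" "\<And>p. p \<in> U \<Longrightarrow> is_basis r (\<lambda>k. e k p) (fib E p)"
  shows "fiber_coords M fst (total_fib E) r U (total_fc r e)"
  unfolding fiber_coords_def
proof (intro conjI ballI)
  fix p assume "p \<in> U"
  note b = bij_betw_coeffs[OF assms(2)[OF this]]
  have "{q. fst q = p \<and> total_fib E q} = Pair p ` fib E p"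
    by (auto simp: total_fib_def)
  then show "bij_betw (total_fc r e) {q. fst q = p \<and> total_fib E q} (EE r)"
    using b by (auto simp: bij_betw_def inj_on_def total_fc_def image_image)
qed (rule assms(1))

lemma dual_fiber_coords:
  assumes "openin (mtop M) U" "\<And>p. p \<in> U \<Longrightarrow> is_basis r (\<lambda>k. e k p) (fib E p)"
  shows "fiber_coords M fst (dual_fib E) r U (dual_fc r e)"
  unfolding fiber_coords_def
proof (intro conjI ballI)
  fix p assume "p \<in> U"
  note b = bij_betw_dual_coords[OF assms(2)[OF this]]
  have "{q. fst q = p \<and> dual_fib E q} = Pair p ` dual_of (fib E p)"
    by (auto simp: dual_fib_def)
  then show "bij_betw (dual_fc r e) {q. fst q = p \<and> dual_fib E q} (EE r)"
    using b by (auto simp: bij_betw_def inj_on_def dual_fc_def image_image)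
qed (rule assms(1))

lemma dual_times_fiber_coords:
  assumes "openin (mtop M) U" "\<And>p. p \<in> U \<Longrightarrow> is_basis r (\<lambda>k. e k p) (fib E p)"
    and "\<And>p. p \<in> U \<Longrightarrow> is_basis m (\<lambda>k. s k p) (fib C p)"
  shows "fiber_coords M fst (dual_times_fib E C) (r + m) U (dual_times_fc r m e s)"
  unfolding fiber_coords_def
proof (intro conjI ballI)
  fix p assume p: "p \<in> U"
  let ?b1 = "dual_coords r (\<lambda>k. e k p)" and ?b2 = "coeffs m (\<lambda>k. s k p)"
  have b1: "inj_on ?b1 (dual_of (fib E p))" "?b1 ` dual_of (fib E p) = EE r"
    using bij_betw_dual_coords[OF assms(2)[OF p]] by (auto simp: bij_betw_def)
  have b2: "inj_on ?b2 (fib C p)" "?b2 ` fib C p = EE m"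
    using bij_betw_coeffs[OF assms(3)[OF p]] by (auto simp: bij_betw_def)
  show "bij_betw (dual_times_fc r m e s) {q. fst q = p \<and> dual_times_fib E C q} (EE (r + m))"
    unfolding bij_betw_def
  proof (intro conjI inj_onI subset_antisym subsetI)
    fix q q' assume q: "q \<in> {q. fst q = p \<and> dual_times_fib E C q}" "q' \<in> {q. fst q = p \<and> dual_times_fib E C q}"
      "dual_times_fc r m e s q = dual_times_fc r m e s q'"
    obtain \<eta> u \<eta>' u' where qs: "q = (p, \<eta>, u)" "q' = (p, \<eta>', u')"
      using q(1,2) by (cases q; cases q') auto
    have mem: "\<eta> \<in> dual_of (fib E p)" "\<eta>' \<in> dual_of (fib E p)" "u \<in> fib C p" "u' \<in> fib C p"
      using q(1,2) by (auto simp: qs dual_times_fib_def)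
    have eq: "join r (?b1 \<eta>) (?b2 u) = join r (?b1 \<eta>') (?b2 u')"
      using q(3) by (simp add: qs dual_times_fc_def)
    have "?b1 \<eta> = ?b1 \<eta>'"
      using arg_cong[OF eq, of "trunc r"] by (simp add: trunc_join dual_coords_EE)
    moreover have "?b2 u i = ?b2 u' i" for i
      using fun_cong[OF eq, of "r + i"] by (simp add: join_def)
    ultimately show "q = q'"
      using mem b1(1) b2(1) unfolding qs by (metis ext inj_onD)
  next
    fix y assume "y \<in> dual_times_fc r m e s ` {q. fst q = p \<and> dual_times_fib E C q}"
    then show "y \<in> EE (r + m)"
      using b2(2) by (auto simp: dual_times_fc_def dual_times_fib_def intro: join_EE)
  next
    fix y assume y: "y \<in> EE (r + m)"
    obtain \<eta> where \<eta>: "\<eta> \<in> dual_of (fib E p)" "?b1 \<eta> = trunc r y"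
      using b1(2) trunc_EE[of r y] by (metis imageE)
    obtain u where u: "u \<in> fib C p" "?b2 u = (\<lambda>i. y (r + i))"
      using b2(2) shift_EE[OF y] by (metis imageE)
    have "dual_times_fc r m e s (p, \<eta>, u) = y"
      using join_trunc[of r y] by (simp add: dual_times_fc_def \<eta>(2) u(2))
    then show "y \<in> dual_times_fc r m e s ` {q. fst q = p \<and> dual_times_fib E C q}"
      using \<eta>(1) u(1) by (force simp: dual_times_fib_def)
  qed
qed (rule assms(1))

text \<open>Dual coordinates are values on basis vectors, so it suffices to expand
  \<open>b' j\<close> in \<open>b\<close>. The matrix expresses the new basis in the old one,
  opposite to \<open>coeffs_change\<close>.\<close>

lemma dual_coords_change:
  assumes b: "is_basis r b V" and b': "is_basis r b' V" and \<eta>: "\<eta> \<in> dual_of V" and j: "j < r"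
  shows "dual_coords r b' \<eta> j = (\<Sum>i<r. coeffs r b (b' j) i * dual_coords r b \<eta> i)"
  using dual_of_expansion[OF b \<eta> basis_mem[OF b' j]] j by (simp add: dual_coords_def)

lemma coeffs_change:
  assumes b: "is_basis r b V" and b': "is_basis r b' V" and v: "v \<in> V"
  shows "coeffs r b' v j = (\<Sum>i<r. coeffs r b' (b i) j * coeffs r b v i)"
proof -
  have "coeffs r b' v j = coeffs r b' (\<Sum>i<r. coeffs r b v i *\<^sub>R b i) j"
    using coeffs_expansion(1)[OF b v] by simp
  also have "\<dots> = (\<Sum>i<r. coeffs r b v i * coeffs r b' (b i) j)"
    using basis_mem[OF b] by (intro coeffs_sum[OF b']) auto
  finally show ?thesis
    by (simp add: mult.commute)
qed

lemma total_fiber_compat: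
  assumes b: "\<And>p. p \<in> U \<inter> U' \<Longrightarrow> is_basis r (\<lambda>k. e k p) (fib E p)"
    and b': "\<And>p. p \<in> U \<inter> U' \<Longrightarrow> is_basis r (\<lambda>k. e' k p) (fib E p)"
    and T: "\<And>p i j. p \<in> U \<inter> U' \<Longrightarrow> i < r \<Longrightarrow> j < r \<Longrightarrow> smooth_at M p (\<lambda>q. coeffs r (\<lambda>k. e' k q) (e i q) j)"
  shows "fiber_compat M fst (total_fib E) r (U, total_fc r e) (U', total_fc r e')"
  unfolding fiber_compat_def prod.case
proof (intro exI[of _ "\<lambda>j i q. coeffs r (\<lambda>k. e' k q) (e i q) j"] conjI ballI allI impI)
  fix q j assume q: "q \<in> fibset fst (total_fib E) (U \<inter> U')" and j: "j < r"
  obtain p v where pv: "q = (p, v)" "p \<in> U \<inter> U'" "v \<in> fib E p"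
    using q unfolding total_fibset by blast
  show "total_fc r e' q j = (\<Sum>i<r. coeffs r (\<lambda>k. e' k (fst q)) (e i (fst q)) j * total_fc r e q i)"
    using coeffs_change[OF b[OF pv(2)] b'[OF pv(2)] pv(3)] by (simp add: total_fc_def pv(1))
qed (rule T)

lemma dual_fiber_compat:
  assumes b: "\<And>p. p \<in> U \<inter> U' \<Longrightarrow> is_basis r (\<lambda>k. e k p) (fib E p)"
    and b': "\<And>p. p \<in> U \<inter> U' \<Longrightarrow> is_basis r (\<lambda>k. e' k p) (fib E p)"
    and T: "\<And>p i j. p \<in> U \<inter> U' \<Longrightarrow> i < r \<Longrightarrow> j < r \<Longrightarrow> smooth_at M p (\<lambda>q. coeffs r (\<lambda>k. e k q) (e' j q) i)"
  shows "fiber_compat M fst (dual_fib E) r (U, dual_fc r e) (U', dual_fc r e')"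
  unfolding fiber_compat_def prod.case
proof (intro exI[of _ "\<lambda>j i q. coeffs r (\<lambda>k. e k q) (e' j q) i"] conjI ballI allI impI)
  fix q j assume "q \<in> fibset fst (dual_fib E) (U \<inter> U')" and j: "j < r"
  then obtain p \<eta> where pv: "q = (p, \<eta>)" "p \<in> U \<inter> U'" "\<eta> \<in> dual_of (fib E p)"
    unfolding dual_fibset by blast
  show "dual_fc r e' q j = (\<Sum>i<r. coeffs r (\<lambda>k. e k (fst q)) (e' j (fst q)) i * dual_fc r e q i)"
    using dual_coords_change[OF b[OF pv(2)] b'[OF pv(2)] pv(3) j] by (simp add: dual_fc_def pv(1))
qed (rule T)

lemma sum_lessThan_add: "(\<Sum>i<r + (m::nat). g i) = (\<Sum>i<r. g i) + (\<Sum>i<m. g (r + i))" for g :: "nat \<Rightarrow> 'x::comm_monoid_add"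
  by (induction m) (auto simp: add.assoc)

lemma (in manifold_atlas) dual_times_fiber_compat:
  assumes b: "\<And>p. p \<in> U \<inter> U' \<Longrightarrow> is_basis r (\<lambda>k. e k p) (fib E p)"
    and b': "\<And>p. p \<in> U \<inter> U' \<Longrightarrow> is_basis r (\<lambda>k. e' k p) (fib E p)"
    and s: "\<And>p. p \<in> U \<inter> U' \<Longrightarrow> is_basis m (\<lambda>k. s k p) (fib C p)"
    and s': "\<And>p. p \<in> U \<inter> U' \<Longrightarrow> is_basis m (\<lambda>k. s' k p) (fib C p)"
    and T: "\<And>p i j. p \<in> U \<inter> U' \<Longrightarrow> i < r \<Longrightarrow> j < r \<Longrightarrow> smooth_at N p (\<lambda>q. coeffs r (\<lambda>k. e k q) (e' j q) i)"
    and T': "\<And>p i j. p \<in> U \<inter> U' \<Longrightarrow> i < m \<Longrightarrow> j < m \<Longrightarrow> smooth_at N p (\<lambda>q. coeffs m (\<lambda>k. s' k q) (s i q) j)"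
    and U: "U \<inter> U' \<subseteq> pts N"
  shows "fiber_compat N fst (dual_times_fib E C) (r + m) (U, dual_times_fc r m e s) (U', dual_times_fc r m e' s')"
proof -
  \<comment> \<open>A block diagonal transition matrix: covector coordinates and control coordinates
    change separately.\<close>
  define T1 where "T1 j i q = (if j < r then (if i < r then coeffs r (\<lambda>k. e k q) (e' j q) i else 0)
    else (if i < r then 0 else coeffs m (\<lambda>k. s' k q) (s (i - r) q) (j - r)))" for j i q
  have "smooth_at N p (T1 j i)" if "p \<in> U \<inter> U'" "i < r + m" "j < r + m" for p i j
    using that U T[of p i j] T'[of p "i - r" "j - r"] smooth_at_const[of p 0]
    unfolding T1_def by (cases "j < r"; cases "i < r") auto
  moreover have "dual_times_fc r m e' s' q j = (\<Sum>i<r + m. T1 j i (fst q) * dual_times_fc r m e s q i)"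
    if q: "q \<in> fibset fst (dual_times_fib E C) (U \<inter> U')" and j: "j < r + m" for q j
  proof -
    obtain p \<eta> u where pv: "q = (p, \<eta>, u)" "p \<in> U \<inter> U'" "\<eta> \<in> dual_of (fib E p)" "u \<in> fib C p"
      using q unfolding dual_times_fibset dual_times_dom_def by blast
    show ?thesis
    proof (cases "j < r")
      case True
      then show ?thesis
        using dual_coords_change[OF b[OF pv(2)] b'[OF pv(2)] pv(3) True]
        by (simp add: sum_lessThan_add T1_def dual_times_fc_def pv(1) join_def)
    next
      case False
      then show ?thesis
        using coeffs_change[OF s[OF pv(2)] s'[OF pv(2)] pv(4), of "j - r"]
        by (simp add: sum_lessThan_add T1_def dual_times_fc_def pv(1) join_def)
    qed
  qed
  ultimately show ?thesis
    unfolding fiber_compat_def by (auto intro!: exI[of _ T1])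
qed

context vbundle_over
begin

lemma total_fibered: "fibered_mfd M (total_mfd M E) fst (total_fib E) (vrank E)
  {(U, total_fc (vrank E) e) | U e. (U, e) \<in> frames E}"
proof
  have ch: "charts (total_mfd M E) = {(fibset fst (total_fib E) (D \<inter> U), fibchart (mdim M) fst \<phi> (total_fc (vrank E) e)) |
      D \<phi> U e. (D, \<phi>) \<in> charts M \<and> (U, e) \<in> frames E}"
    by (simp only: total_fibset total_fibchart total_mfd_def mfd.simps)
  show "mdim (total_mfd M E) = mdim M + vrank E"
    by (simp add: total_mfd_def)
  show "\<exists>U \<beta>. (U, \<beta>) \<in> {(U, total_fc (vrank E) e) | U e. (U, e) \<in> frames E} \<and> p \<in> U" if "p \<in> pts M" for p
    using frames_cover[OF that] by blast
  show "c \<in> charts (total_mfd M E) \<longleftrightarrow> (\<exists>D \<phi> U \<beta>. (D, \<phi>) \<in> charts M \<and>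
      (U, \<beta>) \<in> {(U, total_fc (vrank E) e) | U e. (U, e) \<in> frames E} \<and>
      c = (fibset fst (total_fib E) (D \<inter> U), fibchart (mdim M) fst \<phi> \<beta>))" for c
    unfolding ch by blast
  show "fiber_coords M fst (total_fib E) (vrank E) U \<beta>"
    if "(U, \<beta>) \<in> {(U, total_fc (vrank E) e) | U e. (U, e) \<in> frames E}" for U \<beta>
    using that local_frameD[OF frames_local_frame] by (auto intro!: total_fiber_coords)
  show "fiber_compat M fst (total_fib E) (vrank E) b b'"
    if "b \<in> {(U, total_fc (vrank E) e) | U e. (U, e) \<in> frames E}" "b' \<in> {(U, total_fc (vrank E) e) | U e. (U, e) \<in> frames E}" for b b'
    using that local_frameD[OF frames_local_frame] by (auto intro!: total_fiber_compat)
qed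

lemma dual_fibered: "fibered_mfd M (dual_mfd M E) fst (dual_fib E) (vrank E)
  {(U, dual_fc (vrank E) e) | U e. (U, e) \<in> frames E}"
proof
  have ch: "charts (dual_mfd M E) = {(fibset fst (dual_fib E) (D \<inter> U), fibchart (mdim M) fst \<phi> (dual_fc (vrank E) e)) |
      D \<phi> U e. (D, \<phi>) \<in> charts M \<and> (U, e) \<in> frames E}"
    by (simp only: dual_fibset dual_fibchart dual_mfd_def mfd.simps)
  show "mdim (dual_mfd M E) = mdim M + vrank E"
    by (simp add: dual_mfd_def)
  show "\<exists>U \<beta>. (U, \<beta>) \<in> {(U, dual_fc (vrank E) e) | U e. (U, e) \<in> frames E} \<and> p \<in> U" if "p \<in> pts M" for p
    using frames_cover[OF that] by blast
  show "c \<in> charts (dual_mfd M E) \<longleftrightarrow> (\<exists>D \<phi> U \<beta>. (D, \<phi>) \<in> charts M \<and>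
      (U, \<beta>) \<in> {(U, dual_fc (vrank E) e) | U e. (U, e) \<in> frames E} \<and>
      c = (fibset fst (dual_fib E) (D \<inter> U), fibchart (mdim M) fst \<phi> \<beta>))" for c
    unfolding ch by blast
  show "fiber_coords M fst (dual_fib E) (vrank E) U \<beta>"
    if "(U, \<beta>) \<in> {(U, dual_fc (vrank E) e) | U e. (U, e) \<in> frames E}" for U \<beta>
    using that local_frameD[OF frames_local_frame] by (auto intro!: dual_fiber_coords)
  show "fiber_compat M fst (dual_fib E) (vrank E) b b'"
    if "b \<in> {(U, dual_fc (vrank E) e) | U e. (U, e) \<in> frames E}" "b' \<in> {(U, dual_fc (vrank E) e) | U e. (U, e) \<in> frames E}" for b b'
    using that local_frameD[OF frames_local_frame] by (auto intro!: dual_fiber_compat)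
qed

end

context local_frame_on
begin

lemma total_chart:
  assumes "coordinate_chart M D \<phi>"
  shows "manifold_chart (total_mfd M E) {(p, v). p \<in> D \<inter> U \<and> v \<in> fib E p}
    (\<lambda>(p, v). join (mdim M) (\<phi> p) (coeffs r (\<lambda>k. e k p) v))"
proof -
  interpret F: fibered_mfd M "total_mfd M E" fst "total_fib E" "vrank E"
      "{(U, total_fc (vrank E) e) | U e. (U, e) \<in> frames E}"
    by (rule total_fibered)
  have "fiber_compat M fst (total_fib E) r (U, total_fc r e) (U', total_fc r e')"
    "fiber_compat M fst (total_fib E) r (U', total_fc r e') (U, total_fc r e)"
    if "(U', e') \<in> frames E" for U' e'
    using local_frameD(3)[OF frames_local_frame[OF that]] that basis frame_section_coeffs frameD(1,5)
    by (auto intro!: total_fiber_compat)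
  then have "coordinate_chart (total_mfd M E) (fibset fst (total_fib E) (D \<inter> U)) (fibchart (mdim M) fst \<phi> (total_fc r e))"
    using frameD(1) total_fiber_coords[OF frameD(2) basis]
    by (intro F.coordinate_chart_fibchart[OF assms]) auto
  then show ?thesis
    unfolding total_fibset total_fibchart
    using manifold_atlas.manifold_chartI[OF F.manifold_atlas_total] by blast
qed

lemma dual_chart:
  assumes "coordinate_chart M D \<phi>"
  shows "manifold_chart (dual_mfd M E) {(p, \<eta>). p \<in> D \<inter> U \<and> \<eta> \<in> dual_of (fib E p)}
    (\<lambda>(p, \<eta>). join (mdim M) (\<phi> p) (dual_coords r (\<lambda>k. e k p) \<eta>))"
proof -
  interpret F: fibered_mfd M "dual_mfd M E" fst "dual_fib E" "vrank E"
      "{(U, dual_fc (vrank E) e) | U e. (U, e) \<in> frames E}"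
    by (rule dual_fibered)
  have "fiber_compat M fst (dual_fib E) r (U, dual_fc r e) (U', dual_fc r e')"
    "fiber_compat M fst (dual_fib E) r (U', dual_fc r e') (U, dual_fc r e)"
    if "(U', e') \<in> frames E" for U' e'
    using local_frameD(3)[OF frames_local_frame[OF that]] that basis frame_section_coeffs frameD(1,5)
    by (auto intro!: dual_fiber_compat)
  then have "coordinate_chart (dual_mfd M E) (fibset fst (dual_fib E) (D \<inter> U)) (fibchart (mdim M) fst \<phi> (dual_fc r e))"
    using frameD(1) dual_fiber_coords[OF frameD(2) basis]
    by (intro F.coordinate_chart_fibchart[OF assms]) auto
  then show ?thesis
    unfolding dual_fibset dual_fibchart
    using manifold_atlas.manifold_chartI[OF F.manifold_atlas_total] by blast
qed

end

locale vbundle_pair = E: vbundle_over M E + C: vbundle_over M C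
  for M :: "'m mfd" and E :: "('m, 'a::real_vector, 'z) vbundle_scheme"
    and C :: "('m, 'c::real_vector, 'y) vbundle_scheme"
begin

abbreviation "dual_times_frames \<equiv>
  {(U \<inter> U', dual_times_fc (vrank E) (vrank C) e s) | U e U' s. (U, e) \<in> frames E \<and> (U', s) \<in> frames C}"

text \<open>Covectors and controls change by opposite kinds of matrices, so each direction combines
  \<open>frameD(5)\<close> for one bundle with \<open>frame_section_coeffs\<close> for the
  other.\<close>

lemma dual_times_fiber_compat_frames:
  assumes e: "local_frame M E (vrank E) U e" and s: "local_frame M C (vrank C) V s"
    and e': "(U', e') \<in> frames E" and s': "(V', s') \<in> frames C"
  shows "fiber_compat M fst (dual_times_fib E C) (vrank E + vrank C)
      (U \<inter> V, dual_times_fc (vrank E) (vrank C) e s) (U' \<inter> V', dual_times_fc (vrank E) (vrank C) e' s')"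
    and "fiber_compat M fst (dual_times_fib E C) (vrank E + vrank C)
      (U' \<inter> V', dual_times_fc (vrank E) (vrank C) e' s') (U \<inter> V, dual_times_fc (vrank E) (vrank C) e s)"
proof -
  interpret e: local_frame_on M E "vrank E" U e
    by unfold_locales (rule e)
  interpret s: local_frame_on M C "vrank C" V s
    by unfold_locales (rule s)
  note le = local_frameD(3)[OF E.frames_local_frame[OF e']]
  note ls = local_frameD(3)[OF C.frames_local_frame[OF s']]
  have U': "U' \<subseteq> pts M"
    using E.frames_domain[OF e'] by blast
  show "fiber_compat M fst (dual_times_fib E C) (vrank E + vrank C)
      (U \<inter> V, dual_times_fc (vrank E) (vrank C) e s) (U' \<inter> V', dual_times_fc (vrank E) (vrank C) e' s')"
    by (rule E.dual_times_fiber_compat)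
      (use U' le ls e.basis s.basis e.frameD(5) s.frame_section_coeffs e' s' in auto)
  show "fiber_compat M fst (dual_times_fib E C) (vrank E + vrank C)
      (U' \<inter> V', dual_times_fc (vrank E) (vrank C) e' s') (U \<inter> V, dual_times_fc (vrank E) (vrank C) e s)"
    by (rule E.dual_times_fiber_compat)
      (use U' le ls e.basis s.basis s.frameD(5) e.frame_section_coeffs e' s' in auto)
qed

lemma dual_times_fiber_coords_frames:
  assumes e: "local_frame M E (vrank E) U e" and s: "local_frame M C (vrank C) V s"
  shows "fiber_coords M fst (dual_times_fib E C) (vrank E + vrank C) (U \<inter> V) (dual_times_fc (vrank E) (vrank C) e s)"
  using local_frameD(2,3)[OF e] local_frameD(2,3)[OF s] by (intro dual_times_fiber_coords) auto

lemma dual_times_fibered: "fibered_mfd M (dual_times_mfd M E C) fst (dual_times_fib E C) (vrank E + vrank C) dual_times_frames"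
proof
  have ch: "charts (dual_times_mfd M E C) = {(fibset fst (dual_times_fib E C) (D \<inter> (U \<inter> U')),
      fibchart (mdim M) fst \<phi> (dual_times_fc (vrank E) (vrank C) e s)) |
      D \<phi> U e U' s. (D, \<phi>) \<in> charts M \<and> (U, e) \<in> frames E \<and> (U', s) \<in> frames C}"
    by (simp only: dual_times_fibset dual_times_fibchart dual_times_mfd_def mfd.simps Int_assoc)
  show "mdim (dual_times_mfd M E C) = mdim M + (vrank E + vrank C)"
    by (simp add: dual_times_mfd_def)
  show "\<exists>U \<beta>. (U, \<beta>) \<in> dual_times_frames \<and> p \<in> U" if "p \<in> pts M" for p
    using E.frames_cover[OF that] C.frames_cover[OF that] by blast
  show "c \<in> charts (dual_times_mfd M E C) \<longleftrightarrow> (\<exists>D \<phi> U \<beta>. (D, \<phi>) \<in> charts M \<and>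
      (U, \<beta>) \<in> dual_times_frames \<and>
      c = (fibset fst (dual_times_fib E C) (D \<inter> U), fibchart (mdim M) fst \<phi> \<beta>))" for c
    unfolding ch by blast
  show "fiber_coords M fst (dual_times_fib E C) (vrank E + vrank C) U \<beta>"
    if "(U, \<beta>) \<in> dual_times_frames" for U \<beta>
    using that dual_times_fiber_coords_frames[OF E.frames_local_frame C.frames_local_frame] by auto
  show "fiber_compat M fst (dual_times_fib E C) (vrank E + vrank C) b b'"
    if "b \<in> dual_times_frames" "b' \<in> dual_times_frames" for b b'
    using that dual_times_fiber_compat_frames(1)[OF E.frames_local_frame C.frames_local_frame] by auto
qed

lemma dual_times_manifold_chart:
  assumes D: "coordinate_chart M D \<phi>" and e: "local_frame M E (vrank E) U e" and s: "local_frame M C (vrank C) V s"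
  shows "manifold_chart (dual_times_mfd M E C) (dual_times_dom E C (D \<inter> (U \<inter> V)))
    (dual_times_chart (mdim M) (vrank E) (vrank C) \<phi> e s)"
proof -
  interpret F: fibered_mfd M "dual_times_mfd M E C" fst "dual_times_fib E C" "vrank E + vrank C" dual_times_frames
    by (rule dual_times_fibered)
  have "coordinate_chart (dual_times_mfd M E C) (fibset fst (dual_times_fib E C) (D \<inter> (U \<inter> V)))
      (fibchart (mdim M) fst \<phi> (dual_times_fc (vrank E) (vrank C) e s))"
    using dual_times_fiber_compat_frames[OF e s]
    by (intro F.coordinate_chart_fibchart[OF D dual_times_fiber_coords_frames[OF e s]]) auto
  then show ?thesis
    unfolding dual_times_fibset dual_times_fibchart
    using manifold_atlas.manifold_chartI[OF F.manifold_atlas_total] by blast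
qed

end

section \<open>Lie algebroids in local coordinates\<close>

text \<open>One open set carries both the chart and the frame. The structure functions are tied to
  the algebroid by equations on \<open>U\<close>; the smoothness of \<rho> there is derived from
  these.\<close>

locale algebroid_frame = vb: local_frame_on M A r U e + ch: manifold_chart M U x
  for M :: "'m mfd" and A :: "('m, 'a::real_vector) algebroid" and r :: nat and U :: "'m set"
    and e :: "nat \<Rightarrow> 'm \<Rightarrow> 'a" and x :: "'m \<Rightarrow> nat \<Rightarrow> real" +
  fixes \<rho> :: "nat \<Rightarrow> nat \<Rightarrow> 'm \<Rightarrow> real" and K :: "nat \<Rightarrow> nat \<Rightarrow> nat \<Rightarrow> 'm \<Rightarrow> real"
  assumes lie: "lie_algebroid M A"
    and anchor_frame: "\<And>p \<alpha>. p \<in> U \<Longrightarrow> \<alpha> < r \<Longrightarrow>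
      anchor A p (e \<alpha> p) = (\<Sum>i<mdim M. \<rho> i \<alpha> p *\<^sub>R coord_vec M U x i p)"
    and bracket_frame: "\<And>p \<alpha> \<beta>. p \<in> U \<Longrightarrow> \<alpha> < r \<Longrightarrow> \<beta> < r \<Longrightarrow>
      brac A (e \<alpha>) (e \<beta>) p = (\<Sum>c<r. K c \<alpha> \<beta> p *\<^sub>R e c p)"
begin

abbreviation "n \<equiv> mdim M"

lemma U_pts: "p \<in> U \<Longrightarrow> p \<in> pts M"
  using ch.chartD(1) by blast

lemma anchor_linear: "p \<in> pts M \<Longrightarrow> linear_on_set (fib A p) (anchor A p)"
  using lie by (simp add: lie_algebroid_def)

lemma anchor_tangent: "p \<in> pts M \<Longrightarrow> X \<in> fib A p \<Longrightarrow> anchor A p X \<in> tangent_space M p"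
  using lie by (auto simp: lie_algebroid_def)

lemma anchor_field: "smooth_section_at M A p \<sigma> \<Longrightarrow> vector_field_at M p (\<lambda>q. anchor A q (\<sigma> q))"
  using lie by (simp add: lie_algebroid_def)

lemma brac_axioms:
  assumes "smooth_section_at M A p \<sigma>" "smooth_section_at M A p \<tau>"
  shows "brac A \<sigma> \<tau> p = - brac A \<tau> \<sigma> p"
    and "near M p (\<lambda>q. \<sigma> q = \<sigma>' q) \<Longrightarrow> brac A \<sigma> \<tau> p = brac A \<sigma>' \<tau> p"
    and "smooth_at M p h \<Longrightarrow> brac A \<sigma> (\<lambda>q. h q *\<^sub>R \<tau> q) p = h p *\<^sub>R brac A \<sigma> \<tau> p + anchor A p (\<sigma> p) h *\<^sub>R \<tau> p"
  using lie assms unfolding lie_algebroid_def by blast+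

lemma brac_add:
  "smooth_section_at M A p \<sigma> \<Longrightarrow> smooth_section_at M A p \<tau> \<Longrightarrow> smooth_section_at M A p \<upsilon> \<Longrightarrow>
    brac A \<sigma> (\<lambda>q. \<tau> q + \<upsilon> q) p = brac A \<sigma> \<tau> p + brac A \<sigma> \<upsilon> p"
  using lie unfolding lie_algebroid_def by blast

lemma section_fib: "smooth_section_at M A p \<sigma> \<Longrightarrow> \<sigma> p \<in> fib A p"
  unfolding smooth_section_at_def using near_self[of M p "\<lambda>q. \<sigma> q \<in> fib A q"] by blast

lemma anchor_frame_coordinate:
  assumes p: "p \<in> U" and "\<alpha> < r" and i: "i < n"
  shows "anchor A p (e \<alpha> p) (\<lambda>q. x q i) = \<rho> i \<alpha> p"
proof -
  have "coord_vec M U x j p (\<lambda>q. x q i) = (if i = j then 1 else 0)" if "j < n" for j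
    using ch.coord_vec_eq_tvec[OF that] ch.tvec_coordinate[OF p i] by simp
  then have "(\<Sum>j<n. \<rho> j \<alpha> p * coord_vec M U x j p (\<lambda>q. x q i)) = (\<Sum>j<n. if i = j then \<rho> j \<alpha> p else 0)"
    by (intro sum.cong) auto
  then show ?thesis
    using i by (simp add: anchor_frame assms sum_fun_apply scaleR_fun_def)
qed

lemma anchor_expansion:
  assumes p: "p \<in> U" and X: "X \<in> fib A p"
  shows "anchor A p X h = (\<Sum>\<alpha><r. vb.cf p X \<alpha> * anchor A p (e \<alpha> p) h)"
proof -
  have "anchor A p X = anchor A p (\<Sum>\<alpha><r. vb.cf p X \<alpha> *\<^sub>R e \<alpha> p)"
    using coeffs_expansion(1)[OF vb.basis[OF p] X] by (rule arg_cong)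
  also have "\<dots> = (\<Sum>\<alpha><r. vb.cf p X \<alpha> *\<^sub>R anchor A p (e \<alpha> p))"
    by (rule linear_on_set_sum[OF basis_subspace[OF vb.basis[OF p]] anchor_linear[OF U_pts[OF p]]])
      (use basis_mem[OF vb.basis[OF p]] in auto)
  finally show ?thesis
    by (simp add: sum_fun_apply scaleR_fun_def)
qed

lemma anchor_coordinate:
  assumes p: "p \<in> U" and X: "X \<in> fib A p" and i: "i < n"
  shows "anchor A p X (\<lambda>q. x q i) = (\<Sum>\<alpha><r. vb.cf p X \<alpha> * \<rho> i \<alpha> p)"
  using anchor_expansion[OF p X] anchor_frame_coordinate[OF p _ i] by simp

text \<open>On \<open>U\<close> this function is the anchor of \<open>e \<alpha>\<close> applied to
  a coordinate function, and the anchor turns smooth sections into smooth vector fields.\<close>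

lemma smooth_anchor_coefficient:
  assumes p: "p \<in> U" and \<alpha>: "\<alpha> < r" and i: "i < n"
  shows "smooth_at M p (\<rho> i \<alpha>)"
proof (rule vb.smooth_at_cong)
  show "smooth_at M p (\<lambda>q. anchor A q (e \<alpha> q) (\<lambda>q. x q i))"
    using anchor_field[OF vb.frameD(4)[OF p \<alpha>]] ch.smooth_at_chart_coordinate[OF p]
    unfolding vector_field_at_def by blast
  show "near M p (\<lambda>q. anchor A q (e \<alpha> q) (\<lambda>q. x q i) = \<rho> i \<alpha> q)"
    using vb.near_U[OF p] by (rule near_mono) (rule anchor_frame_coordinate[OF _ \<alpha> i])
qed

lemma K_antisym:
  assumes p: "p \<in> U" and "\<alpha> < r" "\<beta> < r" "c < r"
  shows "K c \<alpha> \<beta> p = - K c \<beta> \<alpha> p"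
proof (rule is_basis_independent[OF vb.basis[OF p] _ \<open>c < r\<close>])
  have "brac A (e \<alpha>) (e \<beta>) p = - brac A (e \<beta>) (e \<alpha>) p"
    using assms by (intro brac_axioms vb.frameD(4))
  then show "(\<Sum>c<r. K c \<alpha> \<beta> p *\<^sub>R e c p) = (\<Sum>c<r. - K c \<beta> \<alpha> p *\<^sub>R e c p)"
    using assms by (simp add: bracket_frame sum_negf)
qed

text \<open>Stated for partial sums because the expansion of the bracket proceeds by induction on
  the number of summands; the missing coefficients are filled with 0.\<close>

lemma partial_section:
  assumes p: "p \<in> U" and t: "\<And>\<beta>. \<beta> < r \<Longrightarrow> smooth_at M p (t \<beta>)" and k: "k \<le> r"
  shows "smooth_section_at M A p (\<lambda>q. \<Sum>\<beta><k. t \<beta> q *\<^sub>R e \<beta> q)"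
proof (rule vb.smooth_section_combination[OF p U_pts[OF p]])
  have "(\<Sum>\<beta><k. t \<beta> q *\<^sub>R e \<beta> q) = (\<Sum>\<beta><r. (if \<beta> < k then t \<beta> q else 0) *\<^sub>R e \<beta> q)" for q
    using k by (intro sum.mono_neutral_cong_left) auto
  then show "near M p (\<lambda>q. (\<Sum>\<beta><k. t \<beta> q *\<^sub>R e \<beta> q) = (\<Sum>\<beta><r. (if \<beta> < k then t \<beta> q else 0) *\<^sub>R e \<beta> q))"
    using vb.near_U[OF p] by (rule near_mono[rotated])
  show "smooth_at M p (\<lambda>q. if \<beta> < k then t \<beta> q else 0)" if "\<beta> < r" for \<beta>
    using t[OF that] vb.smooth_at_const[OF U_pts[OF p]] by (cases "\<beta> < k") auto
qed

text \<open>Additivity and the Leibniz rule are axioms for the right argument, which is therefore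
  expanded there, one summand at a time.\<close>

lemma brac_right_combination:
  assumes p: "p \<in> U" and \<sigma>: "smooth_section_at M A p \<sigma>"
    and t: "\<And>\<beta>. \<beta> < r \<Longrightarrow> smooth_at M p (t \<beta>)" and k: "k \<le> r"
  shows "brac A \<sigma> (\<lambda>q. \<Sum>\<beta><k. t \<beta> q *\<^sub>R e \<beta> q) p
    = (\<Sum>\<beta><k. t \<beta> p *\<^sub>R brac A \<sigma> (e \<beta>) p + anchor A p (\<sigma> p) (t \<beta>) *\<^sub>R e \<beta> p)"
  using k
proof (induction k)
  case 0
  \<comment> \<open>The zero section is viewed as the constant function 0 times
    \<open>\<sigma>\<close>, so that the Leibniz rule settles the empty sum.\<close>
  have "anchor A p (\<sigma> p) (\<lambda>q. 0) = 0"
    by (rule vb.tangent_const[OF U_pts[OF p] anchor_tangent[OF U_pts[OF p] section_fib[OF \<sigma>]]])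
  then show ?case
    using brac_axioms(3)[OF \<sigma> \<sigma> vb.smooth_at_const[OF U_pts[OF p], of 0]] by simp
next
  case (Suc k)
  have k: "k < r"
    using Suc.prems by simp
  have sec_k: "smooth_section_at M A p (\<lambda>q. t k q *\<^sub>R e k q)"
  proof (rule vb.smooth_section_combination[OF p U_pts[OF p]])
    have "t k q *\<^sub>R e k q = (\<Sum>\<beta><r. (if \<beta> = k then t k q else 0) *\<^sub>R e \<beta> q)" for q
    proof -
      have "(\<Sum>\<beta><r. (if \<beta> = k then t k q else 0) *\<^sub>R e \<beta> q) = (\<Sum>\<beta><r. if \<beta> = k then t k q *\<^sub>R e \<beta> q else 0)"
        by (rule sum.cong) auto
      then show ?thesis
        using k by simp
    qed
    then show "near M p (\<lambda>q. t k q *\<^sub>R e k q = (\<Sum>\<beta><r. (if \<beta> = k then t k q else 0) *\<^sub>R e \<beta> q))"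
      using vb.near_U[OF p] by (rule near_mono[rotated])
    show "smooth_at M p (\<lambda>q. if \<beta> = k then t k q else 0)" if "\<beta> < r" for \<beta>
      using t[OF k] vb.smooth_at_const[OF U_pts[OF p]] by (cases "\<beta> = k") auto
  qed
  have "brac A \<sigma> (\<lambda>q. \<Sum>\<beta><Suc k. t \<beta> q *\<^sub>R e \<beta> q) p
      = brac A \<sigma> (\<lambda>q. \<Sum>\<beta><k. t \<beta> q *\<^sub>R e \<beta> q) p + brac A \<sigma> (\<lambda>q. t k q *\<^sub>R e k q) p"
    using brac_add[OF \<sigma> partial_section[OF p t less_imp_le[OF k]] sec_k] by simp
  then show ?case
    using Suc brac_axioms(3)[OF \<sigma> vb.frameD(4)[OF p k] t[OF k]] by simp
qed

lemma section_near_combination: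
  assumes p: "p \<in> U" and \<sigma>: "smooth_section_at M A p \<sigma>"
  shows "near M p (\<lambda>q. \<sigma> q = (\<Sum>\<beta><r. vb.cf q (\<sigma> q) \<beta> *\<^sub>R e \<beta> q))"
proof -
  have "near M p (\<lambda>q. q \<in> U \<and> \<sigma> q \<in> fib A q)"
    using vb.near_U[OF p] \<sigma> by (intro near_conj) (auto simp: smooth_section_at_def)
  then show ?thesis
    by (rule near_mono) (use coeffs_expansion(1)[OF vb.basis] in blast)
qed

text \<open>Locality is an axiom for the left argument, while \<open>\<tau>\<close> stands on the
  right and equals its expansion only near \<open>p\<close>. Antisymmetry moves it to the left and
  back.\<close>

lemma brac_right_expansion:
  assumes p: "p \<in> U" and \<sigma>: "smooth_section_at M A p \<sigma>" and \<tau>: "smooth_section_at M A p \<tau>"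
  shows "brac A \<sigma> \<tau> p = (\<Sum>\<beta><r. vb.cf p (\<tau> p) \<beta> *\<^sub>R brac A \<sigma> (e \<beta>) p
      + anchor A p (\<sigma> p) (\<lambda>q. vb.cf q (\<tau> q) \<beta>) *\<^sub>R e \<beta> p)"
proof -
  let ?t = "\<lambda>\<beta> q. vb.cf q (\<tau> q) \<beta>"
  have t: "smooth_at M p (?t \<beta>)" if "\<beta> < r" for \<beta>
    by (rule vb.smooth_section_coeffs[OF p \<tau> that])
  note sec = partial_section[OF p t order_refl]
  have "brac A \<sigma> \<tau> p = - brac A \<tau> \<sigma> p"
    by (rule brac_axioms(1)[OF \<sigma> \<tau>])
  also have "\<dots> = - brac A (\<lambda>q. \<Sum>\<beta><r. ?t \<beta> q *\<^sub>R e \<beta> q) \<sigma> p"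
    by (simp only: brac_axioms(2)[OF \<tau> \<sigma> section_near_combination[OF p \<tau>]])
  also have "\<dots> = brac A \<sigma> (\<lambda>q. \<Sum>\<beta><r. ?t \<beta> q *\<^sub>R e \<beta> q) p"
    by (rule brac_axioms(1)[OF \<sigma> sec, symmetric])
  also have "\<dots> = (\<Sum>\<beta><r. ?t \<beta> p *\<^sub>R brac A \<sigma> (e \<beta>) p + anchor A p (\<sigma> p) (?t \<beta>) *\<^sub>R e \<beta> p)"
    by (rule brac_right_combination[OF p \<sigma> t order_refl])
  finally show ?thesis .
qed

lemma dual_of_add:
  assumes "subspace V" "\<eta> \<in> dual_of V" "v \<in> V" "w \<in> V"
  shows "\<eta> (v + w) = \<eta> v + \<eta> w" "\<eta> (a *\<^sub>R v) = a * \<eta> v"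
proof -
  have lin: "\<eta> (a *\<^sub>R v + b *\<^sub>R w) = a *\<^sub>R \<eta> v + b *\<^sub>R \<eta> w" if "v \<in> V" "w \<in> V" for a b v w
    using that assms(2) by (simp add: dual_of_def linear_on_set_def)
  show "\<eta> (v + w) = \<eta> v + \<eta> w" "\<eta> (a *\<^sub>R v) = a * \<eta> v"
    using lin[OF assms(3,4), of 1 1] lin[OF assms(3,3), of a 0] by simp_all
qed

lemma brac_section:
  "smooth_section_at M A p \<sigma> \<Longrightarrow> smooth_section_at M A p \<tau> \<Longrightarrow> smooth_section_at M A p (brac A \<sigma> \<tau>)"
  using lie unfolding lie_algebroid_def by blast

lemmas brac_fib = section_fib[OF brac_section]

lemma pairing_brac_right:
  assumes p: "p \<in> U" and \<sigma>: "smooth_section_at M A p \<sigma>" and \<tau>: "smooth_section_at M A p \<tau>"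
    and \<eta>: "\<eta> \<in> dual_of (fib A p)"
  shows "\<eta> (brac A \<sigma> \<tau> p) = (\<Sum>\<beta><r. vb.cf p (\<tau> p) \<beta> * \<eta> (brac A \<sigma> (e \<beta>) p))
      + (\<Sum>\<beta><r. anchor A p (\<sigma> p) (\<lambda>q. vb.cf q (\<tau> q) \<beta>) * \<eta> (e \<beta> p))"
proof -
  note b = vb.basis[OF p]
  note sub = basis_subspace[OF b]
  let ?a = "\<lambda>\<beta>. vb.cf p (\<tau> p) \<beta>" and ?v = "\<lambda>\<beta>. brac A \<sigma> (e \<beta>) p"
  let ?a' = "\<lambda>\<beta>. anchor A p (\<sigma> p) (\<lambda>q. vb.cf q (\<tau> q) \<beta>)"
  have v: "?v \<beta> \<in> fib A p" if "\<beta> < r" for \<beta>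
    by (rule brac_fib[OF \<sigma> vb.frameD(4)[OF p that]])
  have "(\<Sum>\<beta><r. ?a \<beta> *\<^sub>R ?v \<beta>) \<in> fib A p" "(\<Sum>\<beta><r. ?a' \<beta> *\<^sub>R e \<beta> p) \<in> fib A p"
    using v basis_mem[OF b] by (auto intro!: subspace_sum[OF sub] subspace_scale[OF sub])
  from dual_of_add(1)[OF sub \<eta> this]
  have "\<eta> (brac A \<sigma> \<tau> p) = \<eta> (\<Sum>\<beta><r. ?a \<beta> *\<^sub>R ?v \<beta>) + \<eta> (\<Sum>\<beta><r. ?a' \<beta> *\<^sub>R e \<beta> p)"
    by (simp add: brac_right_expansion[OF p \<sigma> \<tau>] sum.distrib)
  also have "\<eta> (\<Sum>\<beta><r. ?a \<beta> *\<^sub>R ?v \<beta>) = (\<Sum>\<beta><r. ?a \<beta> * \<eta> (?v \<beta>))"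
    by (rule dual_of_sum[OF b \<eta>]) (simp add: v)
  also have "\<eta> (\<Sum>\<beta><r. ?a' \<beta> *\<^sub>R e \<beta> p) = (\<Sum>\<beta><r. ?a' \<beta> * \<eta> (e \<beta> p))"
    by (rule dual_of_sum[OF b \<eta>]) (simp add: basis_mem[OF b])
  finally show ?thesis .
qed

text \<open>Up to sign, the fibre components of the linear Poisson tensor on the dual bundle at the
  covector \<eta>.\<close>

definition twist :: "'m \<Rightarrow> ('a \<Rightarrow> real) \<Rightarrow> nat \<Rightarrow> nat \<Rightarrow> real"
  where "twist p \<eta> \<alpha> \<beta> = (\<Sum>c<r. \<eta> (e c p) * K c \<alpha> \<beta> p)"

lemma pairing_brac_frame:
  assumes p: "p \<in> U" and \<eta>: "\<eta> \<in> dual_of (fib A p)" and "\<alpha> < r" "\<beta> < r"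
  shows "\<eta> (brac A (e \<alpha>) (e \<beta>) p) = twist p \<eta> \<alpha> \<beta>"
  using dual_of_sum[OF vb.basis[OF p] \<eta>, of "{..<r}" "\<lambda>c. e c p" "\<lambda>c. K c \<alpha> \<beta> p"]
    basis_mem[OF vb.basis[OF p]] bracket_frame[OF p assms(3,4)] by (simp add: twist_def mult.commute)

lemma pairing_neg:
  assumes p: "p \<in> U" and \<eta>: "\<eta> \<in> dual_of (fib A p)" and v: "v \<in> fib A p"
  shows "\<eta> (- v) = - \<eta> v"
  using dual_of_add(2)[OF basis_subspace[OF vb.basis[OF p]] \<eta> v v, of "-1"] by simp

lemma twist_antisym:
  assumes "p \<in> U" "\<alpha> < r" "\<beta> < r"
  shows "twist p \<eta> \<alpha> \<beta> = - twist p \<eta> \<beta> \<alpha>"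
proof -
  have "twist p \<eta> \<alpha> \<beta> = (\<Sum>c<r. - (\<eta> (e c p) * K c \<beta> \<alpha> p))"
    unfolding twist_def by (rule sum.cong) (use K_antisym[OF assms] in simp_all)
  then show ?thesis
    by (simp add: twist_def sum_negf)
qed

text \<open>The right argument is expanded first. Each remaining bracket with a frame section is
  reversed, so that \<open>\<sigma>\<close> comes to stand on the right and can be expanded by the
  same rule.\<close>

lemma pairing_bracket:
  assumes p: "p \<in> U" and \<sigma>: "smooth_section_at M A p \<sigma>" and \<tau>: "smooth_section_at M A p \<tau>"
    and \<eta>: "\<eta> \<in> dual_of (fib A p)"
  shows "\<eta> (brac A \<sigma> \<tau> p) = (\<Sum>\<alpha><r. \<Sum>\<beta><r. vb.cf p (\<sigma> p) \<alpha> * vb.cf p (\<tau> p) \<beta> * twist p \<eta> \<alpha> \<beta>)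
      + (\<Sum>\<beta><r. anchor A p (\<sigma> p) (\<lambda>q. vb.cf q (\<tau> q) \<beta>) * \<eta> (e \<beta> p))
      - (\<Sum>\<alpha><r. anchor A p (\<tau> p) (\<lambda>q. vb.cf q (\<sigma> q) \<alpha>) * \<eta> (e \<alpha> p))"
proof -
  let ?s = "\<lambda>\<alpha>. vb.cf p (\<sigma> p) \<alpha>" and ?t = "\<lambda>\<beta>. vb.cf p (\<tau> p) \<beta>"
  let ?ds = "\<lambda>v \<alpha>. anchor A p v (\<lambda>q. vb.cf q (\<sigma> q) \<alpha>)"
  have inner: "\<eta> (brac A \<sigma> (e \<beta>) p) = (\<Sum>\<alpha><r. ?s \<alpha> * twist p \<eta> \<alpha> \<beta>) - (\<Sum>\<alpha><r. ?ds (e \<beta> p) \<alpha> * \<eta> (e \<alpha> p))"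
    if \<beta>: "\<beta> < r" for \<beta>
  proof -
    note e\<beta> = vb.frameD(4)[OF p \<beta>]
    have "\<eta> (brac A \<sigma> (e \<beta>) p) = - \<eta> (brac A (e \<beta>) \<sigma> p)"
      unfolding brac_axioms(1)[OF \<sigma> e\<beta>] by (rule pairing_neg[OF p \<eta> brac_fib[OF e\<beta> \<sigma>]])
    also have "\<dots> = - ((\<Sum>\<alpha><r. ?s \<alpha> * \<eta> (brac A (e \<beta>) (e \<alpha>) p)) + (\<Sum>\<alpha><r. ?ds (e \<beta> p) \<alpha> * \<eta> (e \<alpha> p)))"
      unfolding pairing_brac_right[OF p e\<beta> \<sigma> \<eta>] by (rule refl)
    also have "(\<Sum>\<alpha><r. ?s \<alpha> * \<eta> (brac A (e \<beta>) (e \<alpha>) p)) = (\<Sum>\<alpha><r. - (?s \<alpha> * twist p \<eta> \<alpha> \<beta>))"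
    proof (rule sum.cong)
      fix \<alpha> assume "\<alpha> \<in> {..<r}"
      then have "\<alpha> < r"
        by simp
      then show "?s \<alpha> * \<eta> (brac A (e \<beta>) (e \<alpha>) p) = - (?s \<alpha> * twist p \<eta> \<alpha> \<beta>)"
        using pairing_brac_frame[OF p \<eta> \<beta>] twist_antisym[OF p \<beta>] by simp
    qed simp
    finally show ?thesis
      by (simp add: sum_negf)
  qed
  have S: "(\<Sum>\<beta><r. (\<Sum>\<alpha><r. ?s \<alpha> * ?t \<beta> * twist p \<eta> \<alpha> \<beta>) - (\<Sum>\<alpha><r. ?t \<beta> * ?ds (e \<beta> p) \<alpha> * \<eta> (e \<alpha> p)))
      = (\<Sum>\<beta><r. ?t \<beta> * \<eta> (brac A \<sigma> (e \<beta>) p))"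
    by (rule sum.cong) (simp_all add: inner sum_distrib_left right_diff_distrib mult_ac)
  have "(\<Sum>\<beta><r. ?t \<beta> * \<eta> (brac A \<sigma> (e \<beta>) p))
      = (\<Sum>\<beta><r. \<Sum>\<alpha><r. ?s \<alpha> * ?t \<beta> * twist p \<eta> \<alpha> \<beta>) - (\<Sum>\<beta><r. \<Sum>\<alpha><r. ?t \<beta> * ?ds (e \<beta> p) \<alpha> * \<eta> (e \<alpha> p))"
    by (simp only: S[symmetric] sum_subtractf)
  \<comment> \<open>Weighting the anchors of the frame vectors by the coefficients of
    \<open>\<tau>\<close> rebuilds the anchor of \<open>\<tau>\<close>.\<close>
  also have "(\<Sum>\<beta><r. \<Sum>\<alpha><r. ?t \<beta> * ?ds (e \<beta> p) \<alpha> * \<eta> (e \<alpha> p)) = (\<Sum>\<alpha><r. ?ds (\<tau> p) \<alpha> * \<eta> (e \<alpha> p))"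
    unfolding anchor_expansion[OF p section_fib[OF \<tau>]] sum_distrib_right by (rule sum.swap)
  also have "(\<Sum>\<beta><r. \<Sum>\<alpha><r. ?s \<alpha> * ?t \<beta> * twist p \<eta> \<alpha> \<beta>) = (\<Sum>\<alpha><r. \<Sum>\<beta><r. ?s \<alpha> * ?t \<beta> * twist p \<eta> \<alpha> \<beta>)"
    by (rule sum.swap)
  finally show ?thesis
    unfolding pairing_brac_right[OF p \<sigma> \<tau> \<eta>] by simp
qed

end

section \<open>The dual bundle, its prolongation and the differential of the canonical form\<close>

context algebroid_frame
begin

definition dual_dom :: "('m \<times> ('a \<Rightarrow> real)) set"
  where "dual_dom = {(p, \<eta>). p \<in> U \<and> \<eta> \<in> dual_of (fib A p)}"

definition \<Psi> :: "'m \<times> ('a \<Rightarrow> real) \<Rightarrow> nat \<Rightarrow> real"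
  where "\<Psi> = (\<lambda>(p, \<eta>). join n (x p) (dual_coords r (\<lambda>k. e k p) \<eta>))"

end

sublocale algebroid_frame \<subseteq> dual: manifold_chart "dual_mfd M A" dual_dom \<Psi>
  using vb.dual_chart[OF ch.chart] by (simp add: dual_dom_def \<Psi>_def)

context algebroid_frame
begin

abbreviation "N \<equiv> dual_mfd M A"

lemma mdim_dual: "mdim N = n + r"
  by (simp add: dual_mfd_def vb.frameD(1))

lemma dual_chart_base: "i < n \<Longrightarrow> \<Psi> q i = x (fst q) i"
  by (simp add: \<Psi>_def join_def split: prod.split)

lemma dual_chart_fiber: "\<alpha> < r \<Longrightarrow> \<Psi> q (n + \<alpha>) = snd q (e \<alpha> (fst q))"
  by (simp add: \<Psi>_def join_def dual_coords_def split: prod.split)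

lemma dual_dom_iff: "q \<in> dual_dom \<longleftrightarrow> fst q \<in> U \<and> snd q \<in> dual_of (fib A (fst q))"
  by (simp add: dual_dom_def split: prod.split)

lemma near_dual_dom: "q \<in> dual_dom \<Longrightarrow> near N q (\<lambda>q'. q' \<in> dual_dom)"
  by (rule near_open[OF dual.open_domain])

lemma near_fst_U: "q \<in> dual_dom \<Longrightarrow> near N q (\<lambda>q'. fst q' \<in> U)"
  by (rule near_mono[OF near_dual_dom]) (simp_all add: dual_dom_iff)

lemma smooth_base_coordinate:
  assumes "q \<in> dual_dom" "i < n"
  shows "smooth_at N q (\<lambda>q. x (fst q) i)"
  using dual.smooth_at_chart_coordinate[OF assms(1), of i] unfolding dual_chart_base[OF assms(2)] .

lemma smooth_at_fst:
  assumes "q \<in> dual_dom" "smooth_at M (fst q) h"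
  shows "smooth_at N q (h \<circ> fst)"
  by (rule smooth_at_compose_charts(1)[OF dual.manifold_chart_axioms ch.manifold_chart_axioms assms(1)
        near_fst_U[OF assms(1)] smooth_base_coordinate[OF assms(1)] assms(2)])

lemma tmap_fst:
  assumes q: "q \<in> dual_dom"
  shows "tmap M fst (fst q) (dual.tvec a q) = ch.tvec a (fst q)"
proof -
  have "dual.tvec a q (\<lambda>q. x (fst q) i) = a i" if i: "i < n" for i
    using dual.tvec_coordinate[OF q, of i a] i unfolding dual_chart_base[OF i] by (simp add: mdim_dual)
  then have "ch.tvec (\<lambda>i. dual.tvec a q (\<lambda>q. x (fst q) i)) (fst q) = ch.tvec a (fst q)"
    by (rule ch.tvec_cong)
  then show ?thesis
    using tmap_tvec[OF dual.manifold_chart_axioms ch.manifold_chart_axioms q near_fst_U[OF q]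
        smooth_base_coordinate[OF q], of a] by simp
qed

abbreviation "prol q \<equiv> prolongation M A N fst q"

lemma prol_iff:
  "(X, V) \<in> prol q \<longleftrightarrow> X \<in> fib A (fst q) \<and> V \<in> tangent_space N q \<and> anchor A (fst q) X = tmap M fst (fst q) V"
  by (simp add: prolongation_def)

lemma anchor_eq_tvec:
  assumes "p \<in> U" "X \<in> fib A p"
  shows "anchor A p X = ch.tvec (\<lambda>i. \<Sum>\<alpha><r. vb.cf p X \<alpha> * \<rho> i \<alpha> p) p"
  using ch.tangent_eq_tvec[OF assms(1) anchor_tangent[OF U_pts[OF assms(1)] assms(2)]]
    ch.tvec_cong[OF anchor_coordinate[OF assms]] by simp

text \<open>The projection keeps the first \<open>n\<close> components, so the anchor of
  \<open>X\<close> fixes these and leaves the fibre components free. That freedom is what later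
  permits the comparison of coefficients.\<close>

lemma tvec_in_prol_iff:
  assumes q: "q \<in> dual_dom" and X: "X \<in> fib A (fst q)"
  shows "(X, dual.tvec a q) \<in> prol q \<longleftrightarrow> (\<forall>i<n. a i = (\<Sum>\<alpha><r. vb.cf (fst q) X \<alpha> * \<rho> i \<alpha> (fst q)))"
proof -
  have p: "fst q \<in> U"
    using q by (simp add: dual_dom_iff)
  let ?b = "\<lambda>i. \<Sum>\<alpha><r. vb.cf (fst q) X \<alpha> * \<rho> i \<alpha> (fst q)"
  have "ch.tvec ?b (fst q) = ch.tvec a (fst q) \<longleftrightarrow> (\<forall>i<n. a i = ?b i)"
  proof
    assume eq: "ch.tvec ?b (fst q) = ch.tvec a (fst q)"
    show "\<forall>i<n. a i = ?b i"
    proof (intro allI impI)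
      fix i assume i: "i < n"
      show "a i = ?b i"
        using fun_cong[OF eq, of "\<lambda>q. x q i"] by (simp add: ch.tvec_coordinate[OF p i])
    qed
  qed (rule ch.tvec_cong, simp)
  then show ?thesis
    using dual.tvec_in_tangent_space[OF q] X
    by (simp add: prol_iff tmap_fst[OF q] anchor_eq_tvec[OF p X])
qed

lemma prol_pullback:
  assumes "(X, V) \<in> prol q" "smooth_at M (fst q) h"
  shows "V (h \<circ> fst) = anchor A (fst q) X h"
  using assms by (simp add: prol_iff tmap_def)

lemma smooth_fiber_coordinate:
  assumes "q \<in> dual_dom" "\<alpha> < r"
  shows "smooth_at N q (\<lambda>q. snd q (e \<alpha> (fst q)))"
  using dual.smooth_at_chart_coordinate[OF assms(1), of "n + \<alpha>"] unfolding dual_chart_fiber[OF assms(2)] .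

text \<open>Continuity of the bundle projection, seen in the chart: the preimage of \<open>W\<close>
  corresponds to the cylinder over the image of \<open>U \<inter> W\<close>.\<close>

lemma near_fst:
  assumes q: "q \<in> dual_dom" and P: "near M (fst q) P"
  shows "near N q (\<lambda>q'. P (fst q'))"
proof -
  obtain W where W: "openin (mtop M) W" "fst q \<in> W" "\<forall>p\<in>W. P p"
    using P unfolding near_def by blast
  let ?S = "{y \<in> EE (n + r). trunc n y \<in> x ` (U \<inter> W)}"
  have "openin (mtop N) {q' \<in> dual_dom. \<Psi> q' \<in> ?S}"
    using openin_trunc_preimage[OF ch.open_image[OF W(1)], of r] by (intro dual.open_preimage) (simp add: mdim_dual)
  moreover have "\<Psi> q' \<in> ?S \<longleftrightarrow> fst q' \<in> W" if q': "q' \<in> dual_dom" for q'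
  proof -
    have U: "fst q' \<in> U"
      using q' by (simp add: dual_dom_iff)
    have "trunc n (\<Psi> q') = x (fst q')"
      unfolding \<Psi>_def by (cases q') (use trunc_join[OF ch.chart_EE[OF U]] in simp)
    moreover have "\<Psi> q' \<in> EE (n + r)"
      using dual.chart_EE[OF q'] by (simp add: mdim_dual)
    ultimately show ?thesis
      using U by (auto dest: inj_onD[OF ch.chartD(2)])
  qed
  ultimately have "openin (mtop N) {q' \<in> dual_dom. fst q' \<in> W}"
    by (simp cong: conj_cong)
  then show ?thesis
    unfolding near_def using q W by (intro exI[of _ "{q' \<in> dual_dom. fst q' \<in> W}"]) auto
qed

abbreviation fcoord :: "nat \<Rightarrow> 'm \<times> ('a \<Rightarrow> real) \<Rightarrow> real"
  where "fcoord \<alpha> \<equiv> \<lambda>q. snd q (e \<alpha> (fst q))"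

text \<open>Near \<open>q\<close> the function is a sum of fibre coordinates times pulled-back
  coefficients. The product rule gives the two sums, since \<open>V\<close> acts on functions of the
  base point through the anchor of \<open>X\<close>.\<close>

lemma canonical_derivative:
  assumes q: "q \<in> dual_dom" and z: "(X, V) \<in> prol q" and \<sigma>: "smooth_section_at M A (fst q) \<sigma>"
  shows "V (\<lambda>q'. snd q' (\<sigma> (fst q'))) = (\<Sum>\<alpha><r. V (fcoord \<alpha>) * vb.cf (fst q) (\<sigma> (fst q)) \<alpha>)
    + (\<Sum>\<alpha><r. anchor A (fst q) X (\<lambda>p. vb.cf p (\<sigma> p) \<alpha>) * snd q (e \<alpha> (fst q)))"
proof -
  let ?s = "\<lambda>\<alpha> p. vb.cf p (\<sigma> p) \<alpha>"
  have p: "fst q \<in> U"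
    using q by (simp add: dual_dom_iff)
  have qN: "q \<in> pts N"
    using q dual.chartD(1) by blast
  have V: "V \<in> tangent_space N q"
    using z by (simp add: prol_iff)
  have s: "smooth_at M (fst q) (?s \<alpha>)" if "\<alpha> < r" for \<alpha>
    by (rule vb.smooth_section_coeffs[OF p \<sigma> that])
  note s' = smooth_at_fst[OF q s]
  note f = smooth_fiber_coordinate[OF q]
  have "near N q (\<lambda>q'. \<sigma> (fst q') \<in> fib A (fst q'))"
    using \<sigma> by (intro near_fst[OF q]) (simp add: smooth_section_at_def)
  then have "near N q (\<lambda>q'. \<sigma> (fst q') \<in> fib A (fst q') \<and> q' \<in> dual_dom)"
    using near_dual_dom[OF q] by (rule near_conj)
  then have "near N q (\<lambda>q'. snd q' (\<sigma> (fst q')) = (\<Sum>\<alpha><r. fcoord \<alpha> q' * (?s \<alpha> \<circ> fst) q'))"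
  proof (rule near_mono)
    fix q' assume q': "\<sigma> (fst q') \<in> fib A (fst q') \<and> q' \<in> dual_dom"
    then show "snd q' (\<sigma> (fst q')) = (\<Sum>\<alpha><r. fcoord \<alpha> q' * (?s \<alpha> \<circ> fst) q')"
      using dual_of_expansion[OF vb.basis, of "fst q'" "snd q'" "\<sigma> (fst q')"]
      by (simp add: dual_dom_iff mult.commute)
  qed
  then have "V (\<lambda>q'. snd q' (\<sigma> (fst q'))) = V (\<lambda>q'. \<Sum>\<alpha><r. fcoord \<alpha> q' * (?s \<alpha> \<circ> fst) q')"
    by (rule dual.tangent_local[OF qN V])
  also have "\<dots> = (\<Sum>\<alpha><r. V (\<lambda>q'. fcoord \<alpha> q' * (?s \<alpha> \<circ> fst) q'))"
    by (rule dual.tangent_sum[OF qN _ V], rule dual.smooth_at_mult[OF f s']) auto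
  also have "\<dots> = (\<Sum>\<alpha><r. V (fcoord \<alpha>) * ?s \<alpha> (fst q) + anchor A (fst q) X (?s \<alpha>) * snd q (e \<alpha> (fst q)))"
  proof (rule sum.cong)
    fix \<alpha> assume "\<alpha> \<in> {..<r}"
    then have \<alpha>: "\<alpha> < r"
      by simp
    show "V (\<lambda>q'. fcoord \<alpha> q' * (?s \<alpha> \<circ> fst) q') = V (fcoord \<alpha>) * ?s \<alpha> (fst q) + anchor A (fst q) X (?s \<alpha>) * snd q (e \<alpha> (fst q))"
      unfolding dual.tangent_mult[OF f[OF \<alpha>] s'[OF \<alpha>] V] prol_pullback[OF z s[OF \<alpha>]] by simp
  qed simp
  finally show ?thesis
    by (simp only: sum.distrib)
qed

text \<open>Without an extension, the condition in \<open>prol_d1\<close> would hold vacuously for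
  every number and its definite description would be undetermined.\<close>

lemma projectable_extension:
  assumes q: "q \<in> dual_dom" and z: "(X, V) \<in> prol q"
  shows "\<exists>Z. projectable_at M A N fst q Z \<and> prol_value fst Z q = (X, V)"
proof -
  let ?p = "fst q"
  have p: "?p \<in> U"
    using q by (simp add: dual_dom_iff)
  have X: "X \<in> fib A ?p" and V: "V \<in> tangent_space N q"
    using z by (auto simp: prol_iff)
  \<comment> \<open>The coefficients of \<open>X\<close> and the fibre components of
    \<open>V\<close> are frozen at their values at \<open>q\<close>. The base components in
    \<open>a\<close> must vary with the point, because the anchor condition has to hold at all
    nearby points.\<close>
  define c where "c \<alpha> = vb.cf ?p X \<alpha>" for \<alpha>
  define \<sigma> where "\<sigma> p = (\<Sum>\<alpha><r. c \<alpha> *\<^sub>R e \<alpha> p)" for p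
  define a :: "nat \<Rightarrow> 'm \<times> ('a \<Rightarrow> real) \<Rightarrow> real"
    where "a i q' = (if i < n then \<Sum>\<alpha><r. c \<alpha> * \<rho> i \<alpha> (fst q') else V (\<lambda>q. \<Psi> q i))" for i q'
  define W where "W q' = dual.tvec (\<lambda>i. a i q') q'" for q'
  have \<sigma>p: "\<sigma> ?p = X"
    unfolding \<sigma>_def c_def by (rule coeffs_expansion(1)[OF vb.basis[OF p] X, symmetric])
  have \<sigma>: "smooth_section_at M A ?p \<sigma>"
    unfolding \<sigma>_def by (rule partial_section[OF p vb.smooth_at_const[OF U_pts[OF p]] order_refl])
  have qN: "q \<in> pts N"
    using q dual.chartD(1) by blast
  have "smooth_at N q (a i)" for i
  proof (cases "i < n")
    case True
    have "smooth_at N q (\<lambda>q'. \<Sum>\<alpha><r. c \<alpha> * (\<rho> i \<alpha> \<circ> fst) q')"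
      by (intro dual.smooth_at_sum[OF qN] dual.smooth_at_mult dual.smooth_at_const[OF qN]
          smooth_at_fst[OF q smooth_anchor_coefficient[OF p _ True]]) simp
    then show ?thesis
      using True by (simp add: o_def a_def[abs_def])
  next
    case False
    then have "a i = (\<lambda>q'. V (\<lambda>q. \<Psi> q i))"
      by (simp add: a_def fun_eq_iff)
    then show ?thesis
      using dual.smooth_at_const[OF qN] by simp
  qed
  then have W: "vector_field_at N q W"
    by (intro dual.vector_field_atI[OF q, where a = a]) (simp_all add: W_def near_mono[OF near_dual_dom[OF q]])
  have Wq: "W q = V"
  proof -
    have "V (\<lambda>q. \<Psi> q i) = a i q" if i: "i < n + r" for i
    proof (cases "i < n")
      case True
      have "V ((\<lambda>p. x p i) \<circ> fst) = anchor A ?p X (\<lambda>p. x p i)"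
        by (rule prol_pullback[OF z ch.smooth_at_chart_coordinate[OF p]])
      then show ?thesis
        unfolding dual_chart_base[OF True] anchor_coordinate[OF p X True] using True
        by (simp add: a_def c_def o_def)
    qed (simp add: a_def)
    then have "dual.tvec (\<lambda>i. V (\<lambda>q. \<Psi> q i)) q = W q"
      unfolding W_def by (intro dual.tvec_cong) (simp add: mdim_dual)
    then show ?thesis
      using dual.tangent_eq_tvec[OF q V] by simp
  qed
  have near: "near N q (\<lambda>q'. (\<sigma> (fst q'), W q') \<in> prol q')"
  proof (rule near_mono[OF near_dual_dom[OF q]])
    fix q' assume q': "q' \<in> dual_dom"
    then have p': "fst q' \<in> U"
      by (simp add: dual_dom_iff)
    have "\<sigma> (fst q') \<in> fib A (fst q')"
      unfolding \<sigma>_def by (rule basis_combination[OF vb.basis[OF p']])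
    then show "(\<sigma> (fst q'), W q') \<in> prol q'"
      unfolding W_def tvec_in_prol_iff[OF q' \<open>\<sigma> (fst q') \<in> fib A (fst q')\<close>]
      by (simp add: a_def \<sigma>_def coeffs_combination[OF vb.basis[OF p']])
  qed
  show ?thesis
    by (rule exI[of _ "(\<sigma>, W)"]) (simp add: projectable_at_def prol_value_def \<sigma> W near Wq \<sigma>p)
qed

lemma prol_d1_eq:
  assumes q: "q \<in> dual_dom" and z: "(X\<^sub>1, V\<^sub>1) \<in> prol q" "(X\<^sub>2, V\<^sub>2) \<in> prol q"
  shows "prol_d1 M A N fst canonical_form q (X\<^sub>1, V\<^sub>1) (X\<^sub>2, V\<^sub>2)
    = (\<Sum>\<alpha><r. V\<^sub>1 (fcoord \<alpha>) * vb.cf (fst q) X\<^sub>2 \<alpha>) - (\<Sum>\<alpha><r. V\<^sub>2 (fcoord \<alpha>) * vb.cf (fst q) X\<^sub>1 \<alpha>)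
      - (\<Sum>\<alpha><r. \<Sum>\<beta><r. vb.cf (fst q) X\<^sub>1 \<alpha> * vb.cf (fst q) X\<^sub>2 \<beta> * twist (fst q) (snd q) \<alpha> \<beta>)" (is "_ = ?R")
proof -
  have p: "fst q \<in> U" and \<eta>: "snd q \<in> dual_of (fib A (fst q))"
    using q by (simp_all add: dual_dom_iff)
  have eq: "prol_anchor (X\<^sub>1, V\<^sub>1) (\<lambda>q'. canonical_form q' (prol_value fst Z\<^sub>2 q'))
      - prol_anchor (X\<^sub>2, V\<^sub>2) (\<lambda>q'. canonical_form q' (prol_value fst Z\<^sub>1 q'))
      - canonical_form q (prol_value fst (prol_bracket A N Z\<^sub>1 Z\<^sub>2) q) = ?R"
    if Z: "projectable_at M A N fst q Z\<^sub>1" "projectable_at M A N fst q Z\<^sub>2"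
      "prol_value fst Z\<^sub>1 q = (X\<^sub>1, V\<^sub>1)" "prol_value fst Z\<^sub>2 q = (X\<^sub>2, V\<^sub>2)" for Z\<^sub>1 Z\<^sub>2
  proof -
    obtain \<sigma>\<^sub>1 W\<^sub>1 \<sigma>\<^sub>2 W\<^sub>2 where ZZ: "Z\<^sub>1 = (\<sigma>\<^sub>1, W\<^sub>1)" "Z\<^sub>2 = (\<sigma>\<^sub>2, W\<^sub>2)"
      by (cases Z\<^sub>1; cases Z\<^sub>2) auto
    have \<sigma>: "smooth_section_at M A (fst q) \<sigma>\<^sub>1" "smooth_section_at M A (fst q) \<sigma>\<^sub>2"
      using Z(1,2) by (auto simp: ZZ projectable_at_def)
    have v: "\<sigma>\<^sub>1 (fst q) = X\<^sub>1" "\<sigma>\<^sub>2 (fst q) = X\<^sub>2"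
      using Z(3,4) by (auto simp: ZZ prol_value_def)
    show ?thesis
      using canonical_derivative[OF q z(1) \<sigma>(2)] canonical_derivative[OF q z(2) \<sigma>(1)]
        pairing_bracket[OF p \<sigma> \<eta>]
      by (simp add: ZZ prol_anchor_def canonical_form_def prol_value_def prol_bracket_def v)
  qed
  obtain Z\<^sub>1 where Z1: "projectable_at M A N fst q Z\<^sub>1" "prol_value fst Z\<^sub>1 q = (X\<^sub>1, V\<^sub>1)"
    using projectable_extension[OF q z(1)] by blast
  obtain Z\<^sub>2 where Z2: "projectable_at M A N fst q Z\<^sub>2" "prol_value fst Z\<^sub>2 q = (X\<^sub>2, V\<^sub>2)"
    using projectable_extension[OF q z(2)] by blast
  show ?thesis
    unfolding prol_d1_def
  proof (rule the_equality)
    show "\<forall>Z\<^sub>1 Z\<^sub>2. projectable_at M A N fst q Z\<^sub>1 \<and> projectable_at M A N fst q Z\<^sub>2 \<and>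
        prol_value fst Z\<^sub>1 q = (X\<^sub>1, V\<^sub>1) \<and> prol_value fst Z\<^sub>2 q = (X\<^sub>2, V\<^sub>2) \<longrightarrow>
        ?R = prol_anchor (X\<^sub>1, V\<^sub>1) (\<lambda>q'. canonical_form q' (prol_value fst Z\<^sub>2 q'))
          - prol_anchor (X\<^sub>2, V\<^sub>2) (\<lambda>q'. canonical_form q' (prol_value fst Z\<^sub>1 q'))
          - canonical_form q (prol_value fst (prol_bracket A N Z\<^sub>1 Z\<^sub>2) q)"
      using eq by (intro allI impI) (elim conjE, simp only:)
    fix s
    assume s: "\<forall>Z\<^sub>1 Z\<^sub>2. projectable_at M A N fst q Z\<^sub>1 \<and> projectable_at M A N fst q Z\<^sub>2 \<and>
        prol_value fst Z\<^sub>1 q = (X\<^sub>1, V\<^sub>1) \<and> prol_value fst Z\<^sub>2 q = (X\<^sub>2, V\<^sub>2) \<longrightarrow>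
        s = prol_anchor (X\<^sub>1, V\<^sub>1) (\<lambda>q'. canonical_form q' (prol_value fst Z\<^sub>2 q'))
          - prol_anchor (X\<^sub>2, V\<^sub>2) (\<lambda>q'. canonical_form q' (prol_value fst Z\<^sub>1 q'))
          - canonical_form q (prol_value fst (prol_bracket A N Z\<^sub>1 Z\<^sub>2) q)"
    show "s = ?R"
      using s[rule_format, of Z\<^sub>1 Z\<^sub>2] Z1 Z2 eq[of Z\<^sub>1 Z\<^sub>2] by simp
  qed
qed

end

section \<open>The Hamiltonian control system in local coordinates\<close>

locale control_frame = algebroid_frame M A r U e x \<rho> K + cv: local_frame_on M C m U s
  for M :: "'m mfd" and A :: "('m, 'a::real_vector) algebroid" and r :: nat and U :: "'m set"
    and e :: "nat \<Rightarrow> 'm \<Rightarrow> 'a" and x :: "'m \<Rightarrow> nat \<Rightarrow> real"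
    and \<rho> :: "nat \<Rightarrow> nat \<Rightarrow> 'm \<Rightarrow> real" and K :: "nat \<Rightarrow> nat \<Rightarrow> nat \<Rightarrow> 'm \<Rightarrow> real"
    and C :: "('m, 'c::real_vector) vbundle" and m :: nat and s :: "nat \<Rightarrow> 'm \<Rightarrow> 'c" +
  fixes f :: "'m \<times> 'c \<Rightarrow> 'a" and L :: "'m \<times> 'c \<Rightarrow> real"
  assumes control: "control_system M A C f"
    and cost: "\<And>c. c \<in> pts (total_mfd M C) \<Longrightarrow> smooth_at (total_mfd M C) c L"
begin

abbreviation "\<psi> \<equiv> dual_times_chart n r m x e s"
abbreviation "Dt \<equiv> dual_times_dom A C U"
abbreviation "Nt \<equiv> dual_times_mfd M A C"
abbreviation "H \<equiv> control_hamiltonian f L"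

lemma dual_times_chart_axioms: "manifold_chart Nt Dt \<psi>"
proof -
  interpret vbundle_pair M A C
    by unfold_locales
  have "manifold_chart Nt (dual_times_dom A C (U \<inter> (U \<inter> U))) (dual_times_chart n (vrank A) (vrank C) x e s)"
    by (rule dual_times_manifold_chart[OF ch.chart]) (simp_all add: vb.frameD(1) cv.frameD(1) vb.frame cv.frame)
  then show ?thesis
    by (simp add: vb.frameD(1) cv.frameD(1))
qed

end

sublocale control_frame \<subseteq> dt: manifold_chart Nt Dt \<psi>
  by (rule dual_times_chart_axioms)

context control_frame
begin

lemma mdim_dual_times: "mdim Nt = n + (r + m)"
  by (simp add: dual_times_mfd_def vb.frameD(1) cv.frameD(1))

lemma chart_base: "i < n \<Longrightarrow> \<psi> w i = x (fst w) i"
  by (simp add: dual_times_chart_def join_def split: prod.split)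

lemma chart_fiber: "\<alpha> < r \<Longrightarrow> \<psi> w (n + \<alpha>) = fst (snd w) (e \<alpha> (fst w))"
  by (simp add: dual_times_chart_def join_def dual_coords_def split: prod.split)

lemma chart_control: "\<psi> w (n + r + c) = coeffs m (\<lambda>k. s k (fst w)) (snd (snd w)) c"
  by (simp add: dual_times_chart_def join_def split: prod.split)

lemma chart_pr1: "i < n + r \<Longrightarrow> \<Psi> (pr1 w) i = \<psi> w i"
  by (cases "i < n") (auto simp: \<Psi>_def dual_times_chart_def pr1_def join_def split: prod.split)

lemma Dt_iff: "w \<in> Dt \<longleftrightarrow> pr1 w \<in> dual_dom \<and> snd (snd w) \<in> fib C (fst w)"
  by (auto simp: dual_times_dom_def dual_dom_def pr1_def split: prod.splits)

lemma fst_pr1 [simp]: "fst (pr1 w) = fst w"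
  by (simp add: pr1_def split: prod.split)

lemma snd_pr1 [simp]: "snd (pr1 w) = fst (snd w)"
  by (simp add: pr1_def split: prod.split)

lemma Dt_base: "w \<in> Dt \<Longrightarrow> fst w \<in> U"
  by (auto simp: dual_times_dom_def)

lemma near_Dt: "w \<in> Dt \<Longrightarrow> near Nt w (\<lambda>w'. w' \<in> Dt)"
  by (rule near_open[OF dt.open_domain])

lemma near_pr1: "w \<in> Dt \<Longrightarrow> near Nt w (\<lambda>w'. pr1 w' \<in> dual_dom)"
  by (rule near_mono[OF near_Dt]) (simp_all add: Dt_iff)

lemma near_base: "w \<in> Dt \<Longrightarrow> near Nt w (\<lambda>w'. fst w' \<in> U)"
  by (rule near_mono[OF near_Dt]) (simp_all add: Dt_base)

lemma smooth_pr1_coordinate: "w \<in> Dt \<Longrightarrow> i < mdim N \<Longrightarrow> smooth_at Nt w (\<lambda>w. \<Psi> (pr1 w) i)"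
  using dt.smooth_at_chart_coordinate[of w i] by (simp add: mdim_dual chart_pr1)

lemma smooth_fst_coordinate: "w \<in> Dt \<Longrightarrow> i < n \<Longrightarrow> smooth_at Nt w (\<lambda>w. x (fst w) i)"
  using dt.smooth_at_chart_coordinate[of w i] by (simp add: chart_base)

text \<open>The first \<open>n + r\<close> coordinates of \<open>\<psi>\<close> are those of
  \<open>\<Psi>\<close> after \<open>pr1\<close>. The same family \<open>b\<close> thus serves both
  spaces, and its control components drop out below.\<close>

lemma tmap_pr1:
  assumes w: "w \<in> Dt"
  shows "tmap N pr1 (pr1 w) (dt.tvec b w) = dual.tvec b (pr1 w)"
proof -
  have "dt.tvec b w (\<lambda>w. \<Psi> (pr1 w) i) = b i" if i: "i < n + r" for i
    using dt.tvec_coordinate[OF w, of i b] i by (simp add: mdim_dual_times chart_pr1)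
  then have "dual.tvec (\<lambda>i. dt.tvec b w (\<lambda>w. \<Psi> (pr1 w) i)) (pr1 w) = dual.tvec b (pr1 w)"
    by (intro dual.tvec_cong) (simp add: mdim_dual)
  then show ?thesis
    using tmap_tvec[OF dt.manifold_chart_axioms dual.manifold_chart_axioms w near_pr1[OF w]
        smooth_pr1_coordinate[OF w], of b] by simp
qed

lemma tmap_fst_dual_times:
  assumes w: "w \<in> Dt"
  shows "tmap M fst (fst w) (dt.tvec b w) = ch.tvec b (fst w)"
proof -
  have "dt.tvec b w (\<lambda>w. x (fst w) i) = b i" if i: "i < n" for i
    using dt.tvec_coordinate[OF w, of i b] i by (simp add: mdim_dual_times chart_base)
  then have "ch.tvec (\<lambda>i. dt.tvec b w (\<lambda>w. x (fst w) i)) (fst w) = ch.tvec b (fst w)"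
    by (intro ch.tvec_cong)
  then show ?thesis
    using tmap_tvec[OF dt.manifold_chart_axioms ch.manifold_chart_axioms w near_base[OF w]
        smooth_fst_coordinate[OF w], of b] by simp
qed

text \<open>Both conditions involve only the first \<open>n\<close> components of \<open>b\<close>,
  so the control components of a test vector can be chosen freely.\<close>

lemma tvec_in_prol_dual_times_iff:
  assumes w: "w \<in> Dt" and X: "X \<in> fib A (fst w)"
  shows "(X, dt.tvec b w) \<in> prolongation M A Nt fst w \<longleftrightarrow> (X, dual.tvec b (pr1 w)) \<in> prol (pr1 w)"
proof -
  have q: "pr1 w \<in> dual_dom"
    using w by (simp add: Dt_iff)
  have "(X, dt.tvec b w) \<in> prolongation M A Nt fst w \<longleftrightarrow> anchor A (fst w) X = ch.tvec b (fst w)"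
    using X dt.tvec_in_tangent_space[OF w] by (simp add: prolongation_def tmap_fst_dual_times[OF w])
  then show ?thesis
    using X tmap_fst[OF q, of b] dual.tvec_in_tangent_space[OF q, of b] by (simp add: prol_iff)
qed

text \<open>In the frame, \<open>H\<close> is the sum of the coefficients of \<open>f\<close> times
  the fibre coordinates, minus \<open>L\<close>. The coefficients are smooth because
  \<open>f\<close> is smooth into \<open>total_mfd M A\<close>, where they are coordinates in the
  chart defined by the frame.\<close>

lemma smooth_hamiltonian:
  assumes w: "w \<in> Dt"
  shows "smooth_at Nt w H"
proof -
  obtain p \<eta> u where w_eq: "w = (p, \<eta>, u)"
    by (cases w)
  have p: "p \<in> U" and u: "u \<in> fib C p"
    using w by (auto simp: w_eq dual_times_dom_def)
  interpret tA: manifold_chart "total_mfd M A" "{(p, v). p \<in> U \<and> v \<in> fib A p}"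
      "\<lambda>(p, v). join n (x p) (coeffs r (\<lambda>k. e k p) v)"
    using vb.total_chart[OF ch.chart] by simp
  interpret tC: manifold_chart "total_mfd M C" "{(p, v). p \<in> U \<and> v \<in> fib C p}"
      "\<lambda>(p, v). join n (x p) (coeffs m (\<lambda>k. s k p) v)"
    using cv.total_chart[OF ch.chart] by simp
  have mC: "mdim (total_mfd M C) = n + m"
    by (simp add: total_mfd_def cv.frameD(1))
  have puC: "(p, u) \<in> pts (total_mfd M C)"
    using tC.chartD(1) p u by blast
  have fib: "f (p', u') \<in> fib A p'" if "p' \<in> U" "u' \<in> fib C p'" for p' u'
    using control tC.chartD(1) that unfolding control_system_def by blast
  \<comment> \<open>The coefficients of \<open>f\<close> and the cost \<open>L\<close> live on the
    control bundle and are pulled back along the map that forgets the covector.\<close>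
  let ?F = "\<lambda>w. (fst w, snd (snd w))"
  have wN: "w \<in> pts Nt"
    using dt.chartD(1) w by blast
  have F_dom: "near Nt w (\<lambda>w'. ?F w' \<in> {(p, v). p \<in> U \<and> v \<in> fib C p})"
    by (rule near_mono[OF near_Dt[OF w]]) (auto simp: dual_times_dom_def)
  have F_smooth: "smooth_at Nt w (\<lambda>w'. (\<lambda>(p, v). join n (x p) (coeffs m (\<lambda>k. s k p) v)) (?F w') i)"
    if "i < mdim (total_mfd M C)" for i
  proof (cases "i < n")
    case True
    then show ?thesis
      using smooth_fst_coordinate[OF w True] by (simp add: join_def)
  next
    case False
    then show ?thesis
      using dt.smooth_at_chart_coordinate[OF w, of "n + r + (i - n)"] unfolding chart_control by (simp add: join_def)
  qed
  have pull: "smooth_at Nt w (h \<circ> ?F)" if "smooth_at (total_mfd M C) (p, u) h" for h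
    by (rule smooth_at_compose_charts(1)[OF dt.manifold_chart_axioms tC.manifold_chart_axioms w F_dom F_smooth])
      (use that in \<open>simp_all add: w_eq\<close>)
  have fs: "smooth_at Nt w ((\<lambda>c. vb.cf (fst c) (f c) \<alpha>) \<circ> ?F)" for \<alpha>
  proof (rule pull)
    have "smooth_at (total_mfd M A) (p, f (p, u)) (\<lambda>c. (\<lambda>(p, v). join n (x p) (coeffs r (\<lambda>k. e k p) v)) c (n + \<alpha>))"
      using p fib[OF p u] by (intro tA.smooth_at_chart_coordinate) simp
    moreover have "smooth_map_at (total_mfd M C) (total_mfd M A) (\<lambda>(p, u). (p, f (p, u))) (p, u)"
      using control puC by (auto simp: control_system_def smooth_map_def)
    ultimately have "smooth_at (total_mfd M C) (p, u)
        ((\<lambda>c. (\<lambda>(p, v). join n (x p) (coeffs r (\<lambda>k. e k p) v)) c (n + \<alpha>)) \<circ> (\<lambda>(p, u). (p, f (p, u))))"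
      by (simp add: smooth_map_at_def)
    moreover have "((\<lambda>c. (\<lambda>(p, v). join n (x p) (coeffs r (\<lambda>k. e k p) v)) c (n + \<alpha>)) \<circ> (\<lambda>(p, u). (p, f (p, u))))
        = (\<lambda>c. vb.cf (fst c) (f c) \<alpha>)"
      by (auto simp: join_def)
    ultimately show "smooth_at (total_mfd M C) (p, u) (\<lambda>c. vb.cf (fst c) (f c) \<alpha>)"
      by simp
  qed
  have "smooth_at Nt w (\<lambda>w. (\<Sum>\<alpha><r. ((\<lambda>c. vb.cf (fst c) (f c) \<alpha>) \<circ> ?F) w * \<psi> w (n + \<alpha>)) + (- 1) * (L \<circ> ?F) w)"
    by (intro dt.smooth_at_add dt.smooth_at_mult dt.smooth_at_sum[OF wN] dt.smooth_at_const[OF wN] fs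
        pull[OF cost[OF puC]] dt.smooth_at_chart_coordinate[OF w])
  moreover have "near Nt w (\<lambda>w. (\<Sum>\<alpha><r. ((\<lambda>c. vb.cf (fst c) (f c) \<alpha>) \<circ> ?F) w * \<psi> w (n + \<alpha>)) + (- 1) * (L \<circ> ?F) w = H w)"
  proof (rule near_mono[OF near_Dt[OF w]])
    fix w' assume w': "w' \<in> Dt"
    obtain p' \<eta>' u' where w'_eq: "w' = (p', \<eta>', u')"
      by (cases w')
    have *: "p' \<in> U" "u' \<in> fib C p'" "\<eta>' \<in> dual_of (fib A p')"
      using w' by (auto simp: w'_eq dual_times_dom_def)
    show "(\<Sum>\<alpha><r. ((\<lambda>c. vb.cf (fst c) (f c) \<alpha>) \<circ> ?F) w' * \<psi> w' (n + \<alpha>)) + (- 1) * (L \<circ> ?F) w' = H w'"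
      using dual_of_expansion[OF vb.basis[OF *(1)] *(3) fib[OF *(1,2)]]
      by (simp add: w'_eq chart_fiber control_hamiltonian_def)
  qed
  ultimately show ?thesis
    by (rule dt.smooth_at_cong[rotated])
qed

section \<open>The symplectic equation and its integral curves in coordinates\<close>

definition grad :: "'m \<times> ('a \<Rightarrow> real) \<times> 'c \<Rightarrow> nat \<Rightarrow> real"
  where "grad w i = pd i (H \<circ> inv_into Dt \<psi>) (\<psi> w)"

lemma sum_split: "(\<Sum>i<n + (r + m). g i) = (\<Sum>i<n. g i) + (\<Sum>\<alpha><r. g (n + \<alpha>)) + (\<Sum>c<m. g (n + r + c))"
  for g :: "nat \<Rightarrow> real"
  by (simp add: sum_lessThan_add add.assoc)

lemma dH_eq:
  assumes "w \<in> Dt"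
  shows "prol_d0 H (X, dt.tvec b w) = (\<Sum>i<n. b i * grad w i) + (\<Sum>\<alpha><r. b (n + \<alpha>) * grad w (n + \<alpha>))
    + (\<Sum>c<m. b (n + r + c) * grad w (n + r + c))"
  using smooth_hamiltonian[OF assms]
  by (simp add: prol_d0_def prol_anchor_def dt.tvec_def mdim_dual_times sum_split grad_def)

lemma symplectic_eq:
  assumes q: "q \<in> dual_dom" and z: "(X, dual.tvec a q) \<in> prol q" "(X', dual.tvec b q) \<in> prol q"
  shows "canonical_symplectic M A q (X, dual.tvec a q) (X', dual.tvec b q)
    = (\<Sum>\<alpha><r. b (n + \<alpha>) * vb.cf (fst q) X \<alpha>) - (\<Sum>\<alpha><r. a (n + \<alpha>) * vb.cf (fst q) X' \<alpha>)
      + (\<Sum>\<beta><r. (\<Sum>\<alpha><r. vb.cf (fst q) X \<alpha> * twist (fst q) (snd q) \<alpha> \<beta>) * vb.cf (fst q) X' \<beta>)"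
proof -
  have "dual.tvec c q (fcoord \<alpha>) = c (n + \<alpha>)" if "\<alpha> < r" for c \<alpha>
    using dual.tvec_coordinate[OF q, of "n + \<alpha>" c] that unfolding dual_chart_fiber[OF that] by (simp add: mdim_dual)
  moreover have "(\<Sum>\<alpha><r. \<Sum>\<beta><r. vb.cf (fst q) X \<alpha> * vb.cf (fst q) X' \<beta> * twist (fst q) (snd q) \<alpha> \<beta>)
      = (\<Sum>\<beta><r. (\<Sum>\<alpha><r. vb.cf (fst q) X \<alpha> * twist (fst q) (snd q) \<alpha> \<beta>) * vb.cf (fst q) X' \<beta>)"
    by (subst sum.swap) (simp add: sum_distrib_left sum_distrib_right mult_ac)
  ultimately show ?thesis
    unfolding canonical_symplectic_def prol_d1_eq[OF q z] by simp
qed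

definition xdot :: "'m \<times> ('a \<Rightarrow> real) \<times> 'c \<Rightarrow> nat \<Rightarrow> real"
  where "xdot w i = (\<Sum>\<alpha><r. \<rho> i \<alpha> (fst w) * grad w (n + \<alpha>))"

definition etadot :: "'m \<times> ('a \<Rightarrow> real) \<times> 'c \<Rightarrow> nat \<Rightarrow> real"
  where "etadot w \<alpha> = - ((\<Sum>i<n. \<rho> i \<alpha> (fst w) * grad w i)
    + (\<Sum>\<beta><r. twist (fst w) (fst (snd w)) \<alpha> \<beta> * grad w (n + \<beta>)))"

text \<open>The algebroid part of the solution: the fibre derivative of \<open>H\<close>, whose
  anchor has the components \<open>xdot\<close>.\<close>

definition hsection :: "'m \<times> ('a \<Rightarrow> real) \<times> 'c \<Rightarrow> 'a"
  where "hsection w = (\<Sum>\<alpha><r. grad w (n + \<alpha>) *\<^sub>R e \<alpha> (fst w))"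

definition hvec :: "'m \<times> ('a \<Rightarrow> real) \<times> 'c \<Rightarrow> nat \<Rightarrow> real"
  where "hvec w i = (if i < n then xdot w i else etadot w (i - n))"

text \<open>The base components of a test vector are not independent: the anchor condition expresses
  them through \<open>X'\<close>, which moves the base derivatives of \<open>H\<close> into the
  coefficients of \<open>X'\<close>. What remains is a linear form in free data.\<close>

lemma hamiltonian_equation_iff:
  assumes w: "w \<in> Dt" and X: "X \<in> fib A (fst w)" and z: "(X, dual.tvec a (pr1 w)) \<in> prol (pr1 w)"
  shows "(\<forall>(X', W) \<in> prolongation M A Nt fst w.
      canonical_symplectic M A (pr1 w) (X, dual.tvec a (pr1 w)) (X', tmap N pr1 (pr1 w) W) = prol_d0 H (X', W))
    \<longleftrightarrow> (\<forall>\<alpha><r. vb.cf (fst w) X \<alpha> = grad w (n + \<alpha>)) \<and> (\<forall>c<m. grad w (n + r + c) = 0) \<and>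
      (\<forall>\<beta><r. (\<Sum>\<alpha><r. vb.cf (fst w) X \<alpha> * twist (fst w) (fst (snd w)) \<alpha> \<beta>) - a (n + \<beta>)
        = (\<Sum>i<n. \<rho> i \<beta> (fst w) * grad w i))" (is "?L \<longleftrightarrow> ?R")
proof -
  let ?p = "fst w"
  have q: "pr1 w \<in> dual_dom" and p: "?p \<in> U"
    using w Dt_base by (simp_all add: Dt_iff)
  note bas = vb.basis[OF p]
  define Xa where "Xa \<alpha> = vb.cf ?p X \<alpha>" for \<alpha>
  define tw where "tw \<beta> = (\<Sum>\<alpha><r. Xa \<alpha> * twist ?p (fst (snd w)) \<alpha> \<beta>)" for \<beta>
  have eq: "canonical_symplectic M A (pr1 w) (X, dual.tvec a (pr1 w)) (X', tmap N pr1 (pr1 w) (dt.tvec b w))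
      - prol_d0 H (X', dt.tvec b w)
    = (\<Sum>\<alpha><r. b (n + \<alpha>) * (Xa \<alpha> - grad w (n + \<alpha>)))
      + (\<Sum>\<beta><r. (tw \<beta> - a (n + \<beta>) - (\<Sum>i<n. \<rho> i \<beta> ?p * grad w i)) * vb.cf ?p X' \<beta>)
      - (\<Sum>c<m. b (n + r + c) * grad w (n + r + c))"
    if X': "X' \<in> fib A ?p" and zb: "(X', dt.tvec b w) \<in> prolongation M A Nt fst w" for X' b
  proof -
    have zb': "(X', dual.tvec b (pr1 w)) \<in> prol (pr1 w)"
      using zb tvec_in_prol_dual_times_iff[OF w X'] by blast
    have bi: "b i = (\<Sum>\<alpha><r. vb.cf ?p X' \<alpha> * \<rho> i \<alpha> ?p)" if "i < n" for i
      using tvec_in_prol_iff[OF q, of X' b] zb' X' that by simp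
    have "(\<Sum>i<n. b i * grad w i) = (\<Sum>i<n. \<Sum>\<beta><r. \<rho> i \<beta> ?p * grad w i * vb.cf ?p X' \<beta>)"
      by (rule sum.cong) (simp_all add: bi sum_distrib_right sum_distrib_left mult_ac)
    also have "\<dots> = (\<Sum>\<beta><r. (\<Sum>i<n. \<rho> i \<beta> ?p * grad w i) * vb.cf ?p X' \<beta>)"
      by (subst sum.swap) (simp add: sum_distrib_right)
    finally have base: "(\<Sum>i<n. b i * grad w i) = (\<Sum>\<beta><r. (\<Sum>i<n. \<rho> i \<beta> ?p * grad w i) * vb.cf ?p X' \<beta>)" .
    show ?thesis
      unfolding tmap_pr1[OF w] symplectic_eq[OF q z zb'] dH_eq[OF w] base
      by (simp add: Xa_def tw_def left_diff_distrib right_diff_distrib sum_subtractf)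
  qed
  show ?thesis
  proof
    assume L: ?L
    \<comment> \<open>Test vectors are prescribed by the coefficients \<open>X'\<close> and by
      components \<open>b\<close> that obey the anchor condition.\<close>
    have zero: "(\<Sum>\<alpha><r. b (n + \<alpha>) * (Xa \<alpha> - grad w (n + \<alpha>)))
        + (\<Sum>\<beta><r. (tw \<beta> - a (n + \<beta>) - (\<Sum>i<n. \<rho> i \<beta> ?p * grad w i)) * X' \<beta>)
        - (\<Sum>c<m. b (n + r + c) * grad w (n + r + c)) = 0"
      if b: "\<And>i. i < n \<Longrightarrow> b i = (\<Sum>\<alpha><r. X' \<alpha> * \<rho> i \<alpha> ?p)" for b X'
    proof -
      let ?Y = "\<Sum>\<beta><r. X' \<beta> *\<^sub>R e \<beta> ?p"
      have Y: "?Y \<in> fib A ?p"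
        by (rule basis_combination[OF bas])
      have cY: "vb.cf ?p ?Y \<beta> = X' \<beta>" if "\<beta> < r" for \<beta>
        by (rule coeffs_combination[OF bas that])
      have zb: "(?Y, dt.tvec b w) \<in> prolongation M A Nt fst w"
        unfolding tvec_in_prol_dual_times_iff[OF w Y] using tvec_in_prol_iff[OF q, of ?Y b] Y b by (simp add: cY)
      show ?thesis
        using eq[OF Y zb] bspec[OF L zb] by (simp add: cY)
    qed
    \<comment> \<open>Tested with a unit vector in a fibre direction over
      \<open>X' = 0\<close>.\<close>
    have fib: "Xa \<alpha> = grad w (n + \<alpha>)" if \<alpha>: "\<alpha> < r" for \<alpha>
    proof -
      have "(\<Sum>\<alpha>'<r. (if n + \<alpha>' = n + \<alpha> then 1 else 0) * (Xa \<alpha>' - grad w (n + \<alpha>')))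
          = (\<Sum>\<alpha>'<r. if \<alpha>' = \<alpha> then Xa \<alpha>' - grad w (n + \<alpha>') else 0)"
        by (rule sum.cong) auto
      then show ?thesis
        using zero[of "\<lambda>i. if i = n + \<alpha> then 1 else 0" "\<lambda>_. 0"] \<alpha> by simp
    qed
    \<comment> \<open>Tested with a unit vector in a control direction, which \<open>pr1\<close>
      maps to zero; the symplectic side therefore vanishes.\<close>
    have "grad w (n + r + c) = 0" if c: "c < m" for c
    proof -
      have "(\<Sum>c'<m. (if n + r + c' = n + r + c then 1 else 0) * grad w (n + r + c'))
          = (\<Sum>c'<m. if c' = c then grad w (n + r + c') else 0)"
        by (rule sum.cong) auto
      moreover have "(\<Sum>\<alpha><r. (if n + \<alpha> = n + r + c then 1 else 0) * (Xa \<alpha> - grad w (n + \<alpha>))) = 0"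
        by (rule sum.neutral) auto
      ultimately show ?thesis
        using zero[of "\<lambda>i. if i = n + r + c then 1 else 0" "\<lambda>_. 0"] c by simp
    qed
    \<comment> \<open>Here \<open>X'\<close> is the frame vector with index \<beta>: its base
      components are forced to be the entries of \<rho>, and all others are set to 0.\<close>
    moreover have "tw \<beta> - a (n + \<beta>) = (\<Sum>i<n. \<rho> i \<beta> ?p * grad w i)" if \<beta>: "\<beta> < r" for \<beta>
    proof -
      have "(\<Sum>\<beta>'<r. (tw \<beta>' - a (n + \<beta>') - (\<Sum>i<n. \<rho> i \<beta>' ?p * grad w i)) * (if \<beta>' = \<beta> then 1 else 0))
          = (\<Sum>\<beta>'<r. if \<beta>' = \<beta> then tw \<beta>' - a (n + \<beta>') - (\<Sum>i<n. \<rho> i \<beta>' ?p * grad w i) else 0)"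
        by (rule sum.cong) auto
      moreover have "(\<Sum>\<alpha><r. (if \<alpha> = \<beta> then 1 else 0) * \<rho> i \<alpha> ?p) = (\<Sum>\<alpha><r. if \<alpha> = \<beta> then \<rho> i \<alpha> ?p else 0)" for i
        by (rule sum.cong) auto
      ultimately show ?thesis
        using zero[of "\<lambda>i. if i < n then \<rho> i \<beta> ?p else 0" "\<lambda>\<alpha>. if \<alpha> = \<beta> then 1 else 0"] \<beta> by simp
    qed
    ultimately show ?R
      using fib by (simp add: Xa_def tw_def)
  next
    assume R: ?R
    have RT: "tw \<beta> - a (n + \<beta>) = (\<Sum>i<n. \<rho> i \<beta> ?p * grad w i)" if "\<beta> < r" for \<beta>
      using R that unfolding tw_def Xa_def by blast
    show ?L
    proof (intro ballI, clarify)
      fix X' W assume XW: "(X', W) \<in> prolongation M A Nt fst w"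
      then have X': "X' \<in> fib A ?p" and "W \<in> tangent_space Nt w"
        by (auto simp: prolongation_def)
      then obtain b where W: "W = dt.tvec b w"
        using dt.tangent_space_eq[OF w] by auto
      have "(\<Sum>\<alpha><r. b (n + \<alpha>) * (Xa \<alpha> - grad w (n + \<alpha>))) = 0"
        using R by (intro sum.neutral) (simp add: Xa_def)
      moreover have "(\<Sum>\<beta><r. (tw \<beta> - a (n + \<beta>) - (\<Sum>i<n. \<rho> i \<beta> ?p * grad w i)) * vb.cf ?p X' \<beta>) = 0"
        using RT by (intro sum.neutral) simp
      moreover have "(\<Sum>c<m. b (n + r + c) * grad w (n + r + c)) = 0"
        using R by (intro sum.neutral) simp
      ultimately show "canonical_symplectic M A (pr1 w) (X, dual.tvec a (pr1 w)) (X', tmap N pr1 (pr1 w) W) = prol_d0 H (X', W)"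
        using eq[OF X' XW[unfolded W]] by (simp add: W)
    qed
  qed
qed

lemma hamiltonian_control_system_iff:
  assumes w: "w \<in> Dt"
  shows "hamiltonian_control_system M A C H w z \<longleftrightarrow>
    (\<forall>c<m. grad w (n + r + c) = 0) \<and> z = (hsection w, dual.tvec (hvec w) (pr1 w))" (is "?L \<longleftrightarrow> ?R")
proof -
  let ?p = "fst w"
  have q: "pr1 w \<in> dual_dom" and p: "?p \<in> U"
    using w Dt_base by (simp_all add: Dt_iff)
  note bas = vb.basis[OF p]
  \<comment> \<open>The symplectic equation sums over the first index of \<open>twist\<close>, while
    \<open>etadot\<close> sums over the second. Antisymmetry turns one into the other and produces
    the common minus sign.\<close>
  have tw: "(\<Sum>\<alpha><r. grad w (n + \<alpha>) * twist ?p (fst (snd w)) \<alpha> \<beta>)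
      = - (\<Sum>\<alpha><r. twist ?p (fst (snd w)) \<beta> \<alpha> * grad w (n + \<alpha>))" if "\<beta> < r" for \<beta>
    unfolding sum_negf[symmetric]
  proof (rule sum.cong)
    fix \<alpha> assume "\<alpha> \<in> {..<r}"
    then show "grad w (n + \<alpha>) * twist ?p (fst (snd w)) \<alpha> \<beta> = - (twist ?p (fst (snd w)) \<beta> \<alpha> * grad w (n + \<alpha>))"
      using twist_antisym[OF p _ that, of \<alpha> "fst (snd w)"] by simp
  qed simp
  have h: "hsection w \<in> fib A ?p"
    unfolding hsection_def by (rule basis_combination[OF bas])
  have ch: "vb.cf ?p (hsection w) \<alpha> = grad w (n + \<alpha>)" if "\<alpha> < r" for \<alpha>
    unfolding hsection_def by (rule coeffs_combination[OF bas that])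
  show ?thesis
  proof
    assume L: ?L
    obtain X V where z: "z = (X, V)"
      by (cases z)
    have XV: "(X, V) \<in> prol (pr1 w)"
      using L by (simp add: hamiltonian_control_system_def z)
    then have X: "X \<in> fib A ?p" and "V \<in> tangent_space N (pr1 w)"
      by (simp_all add: prol_iff)
    then obtain a where V: "V = dual.tvec a (pr1 w)"
      using dual.tangent_space_eq[OF q] by auto
    note XV' = XV[unfolded V]
    have eqn: "\<forall>(X', W) \<in> prolongation M A Nt fst w. canonical_symplectic M A (pr1 w)
        (X, dual.tvec a (pr1 w)) (X', tmap N pr1 (pr1 w) W) = prol_d0 H (X', W)"
      using L unfolding hamiltonian_control_system_def z V by blast
    have R: "\<forall>\<alpha><r. vb.cf ?p X \<alpha> = grad w (n + \<alpha>)" "\<forall>c<m. grad w (n + r + c) = 0"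
      "\<forall>\<beta><r. (\<Sum>\<alpha><r. vb.cf ?p X \<alpha> * twist ?p (fst (snd w)) \<alpha> \<beta>) - a (n + \<beta>) = (\<Sum>i<n. \<rho> i \<beta> ?p * grad w i)"
      using iffD1[OF hamiltonian_equation_iff[OF w X XV'] eqn] by blast+
    have "X = hsection w"
      using coeffs_expansion(1)[OF bas X] R(1) by (simp add: hsection_def)
    moreover have "V = dual.tvec (hvec w) (pr1 w)"
      unfolding V
    proof (rule dual.tvec_cong)
      fix i assume i: "i < mdim N"
      show "a i = hvec w i"
      proof (cases "i < n")
        case True
        then show ?thesis
          using XV' tvec_in_prol_iff[OF q, of X a] X R(1) by (simp add: hvec_def xdot_def mult.commute)
      next
        case False
        define \<beta> where "\<beta> = i - n"
        have \<beta>: "\<beta> < r" "i = n + \<beta>"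
          using i False by (auto simp: \<beta>_def mdim_dual)
        have "(\<Sum>\<alpha><r. vb.cf ?p X \<alpha> * twist ?p (fst (snd w)) \<alpha> \<beta>) = (\<Sum>\<alpha><r. grad w (n + \<alpha>) * twist ?p (fst (snd w)) \<alpha> \<beta>)"
          using R(1) by simp
        then show ?thesis
          using R(3)[rule_format, OF \<beta>(1)] tw[OF \<beta>(1)] by (simp add: hvec_def etadot_def \<beta>(2))
      qed
    qed
    ultimately show ?R
      using R(2) z by blast
  next
    assume R: ?R
    have zz: "(hsection w, dual.tvec (hvec w) (pr1 w)) \<in> prol (pr1 w)"
      using tvec_in_prol_iff[OF q, of "hsection w" "hvec w"] h by (simp add: ch hvec_def xdot_def mult.commute)
    have "(\<Sum>\<alpha><r. vb.cf ?p (hsection w) \<alpha> * twist ?p (fst (snd w)) \<alpha> \<beta>) - hvec w (n + \<beta>) = (\<Sum>i<n. \<rho> i \<beta> ?p * grad w i)"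
      if "\<beta> < r" for \<beta>
      using tw[OF that] by (simp add: ch hvec_def etadot_def)
    then show ?L
      using R zz hamiltonian_equation_iff[OF w h zz] ch by (simp add: hamiltonian_control_system_def)
  qed
qed

text \<open>Derivatives along all smooth functions carry the same information as those of the
  coordinates: the coordinates are smooth functions themselves, and the chain rule recovers the
  others.\<close>

lemma critical_trajectory_iff:
  assumes J: "open J" and \<gamma>: "\<And>t. t \<in> J \<Longrightarrow> \<gamma> t \<in> Dt"
  shows "critical_trajectory M A C f L J \<gamma> \<longleftrightarrow>
    (\<forall>t\<in>J. (\<forall>i<n. ((\<lambda>\<tau>. \<psi> (\<gamma> \<tau>) i) has_real_derivative xdot (\<gamma> t) i) (at t)) \<and>
      (\<forall>\<alpha><r. ((\<lambda>\<tau>. \<psi> (\<gamma> \<tau>) (n + \<alpha>)) has_real_derivative etadot (\<gamma> t) \<alpha>) (at t)) \<and>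
      (\<forall>c<m. grad (\<gamma> t) (n + r + c) = 0))"
  unfolding critical_trajectory_def
proof (rule ball_cong[OF refl])
  fix t assume t: "t \<in> J"
  let ?w = "\<gamma> t"
  note w = \<gamma>[OF t]
  have q: "pr1 ?w \<in> dual_dom"
    using w by (simp add: Dt_iff)
  have pts: "?w \<in> pts Nt"
    using dt.chartD(1) w by blast
  \<comment> \<open>The curve is constrained on \<open>J\<close> only; openness of \<open>J\<close>
    keeps it in the chart domain for all times near \<open>t\<close>.\<close>
  have ev: "\<forall>\<^sub>F \<tau> in nhds t. (pr1 \<circ> \<gamma>) \<tau> \<in> dual_dom"
    using eventually_nhds_in_open[OF J t] by eventually_elim (use \<gamma> in \<open>simp add: Dt_iff\<close>)
  have coord: "(\<forall>h. smooth_at N (pr1 ?w) h \<longrightarrow>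
        ((h \<circ> pr1 \<circ> \<gamma>) has_real_derivative dual.tvec (hvec ?w) (pr1 ?w) h) (at t)) \<longleftrightarrow>
      (\<forall>i<n + r. ((\<lambda>\<tau>. \<psi> (\<gamma> \<tau>) i) has_real_derivative hvec ?w i) (at t))" (is "?A \<longleftrightarrow> ?B")
  proof
    assume A: ?A
    show ?B
    proof (intro allI impI)
      fix i assume i: "i < n + r"
      have "((\<lambda>q. \<Psi> q i) \<circ> pr1 \<circ> \<gamma>) = (\<lambda>\<tau>. \<psi> (\<gamma> \<tau>) i)"
        by (rule ext) (simp add: chart_pr1[OF i])
      moreover have "dual.tvec (hvec ?w) (pr1 ?w) (\<lambda>q. \<Psi> q i) = hvec ?w i"
        using i by (intro dual.tvec_coordinate[OF q]) (simp add: mdim_dual)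
      ultimately show "((\<lambda>\<tau>. \<psi> (\<gamma> \<tau>) i) has_real_derivative hvec ?w i) (at t)"
        using A[rule_format, OF dual.smooth_at_chart_coordinate[OF q], of i] by simp
    qed
  next
    assume B: ?B
    show ?A
    proof (intro allI impI)
      fix h assume h: "smooth_at N (pr1 ?w) h"
      have "((\<lambda>\<tau>. h ((pr1 \<circ> \<gamma>) \<tau>)) has_real_derivative
          (\<Sum>i<mdim N. hvec ?w i * pd i (h \<circ> inv_into dual_dom \<Psi>) (\<Psi> ((pr1 \<circ> \<gamma>) t)))) (at t)"
      proof (rule dual.DERIV_in_chart[OF ev])
        show "((\<lambda>\<tau>. \<Psi> ((pr1 \<circ> \<gamma>) \<tau>) i) has_real_derivative hvec ?w i) (at t)" if "i < mdim N" for i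
          using B that by (simp add: mdim_dual chart_pr1)
      qed (use h in simp)
      then show "((h \<circ> pr1 \<circ> \<gamma>) has_real_derivative dual.tvec (hvec ?w) (pr1 ?w) h) (at t)"
        using h by (simp add: dual.tvec_def o_def)
    qed
  qed
  have split: "(\<forall>i<n + r. P i) \<longleftrightarrow> (\<forall>i<n. P i) \<and> (\<forall>\<alpha><r. P (n + \<alpha>))" for P
  proof (intro iffI conjI allI impI)
    show "P i" if "(\<forall>i<n. P i) \<and> (\<forall>\<alpha><r. P (n + \<alpha>))" "i < n + r" for i
    proof (cases "i < n")
      case False
      then have "i = n + (i - n)" "i - n < r"
        using that(2) by auto
      then show ?thesis
        using that(1) by metis
    qed (use that in blast)
  qed auto
  have "(\<exists>z. hamiltonian_control_system M A C H ?w z \<and>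
      (\<forall>h. smooth_at N (pr1 ?w) h \<longrightarrow> ((h \<circ> pr1 \<circ> \<gamma>) has_real_derivative prol_anchor z h) (at t))) \<longleftrightarrow>
    (\<forall>c<m. grad ?w (n + r + c) = 0) \<and> ?A"
    unfolding hamiltonian_control_system_iff[OF w] by (auto simp: prol_anchor_def)
  then show "(?w \<in> pts Nt \<and> (\<exists>z. hamiltonian_control_system M A C H ?w z \<and>
      (\<forall>h. smooth_at N (pr1 ?w) h \<longrightarrow> ((h \<circ> pr1 \<circ> \<gamma>) has_real_derivative prol_anchor z h) (at t)))) \<longleftrightarrow>
    (\<forall>i<n. ((\<lambda>\<tau>. \<psi> (\<gamma> \<tau>) i) has_real_derivative xdot ?w i) (at t)) \<and>
    (\<forall>\<alpha><r. ((\<lambda>\<tau>. \<psi> (\<gamma> \<tau>) (n + \<alpha>)) has_real_derivative etadot ?w \<alpha>) (at t)) \<and>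
    (\<forall>c<m. grad ?w (n + r + c) = 0)"
    using pts unfolding coord split by (auto simp: hvec_def)
qed

end

section \<open>The co-adjoint Lie algebroid\<close>

lemma tmap_sum:
  "tmap N F q (\<Sum>i\<in>I. a i *\<^sub>R v i) = (\<Sum>i\<in>I. a i *\<^sub>R tmap N F q (v i))"
  by (auto simp: tmap_def fun_eq_iff sum_fun_apply scaleR_fun_def)

lemma (in vbundle_over) fiber_subspace:
  assumes "p \<in> pts M"
  shows "subspace (fib E p)"
proof -
  obtain U e where "(U, e) \<in> frames E" "p \<in> U"
    using frames_cover[OF assms] by blast
  then show ?thesis
    using basis_subspace[OF local_frameD(3)[OF frames_local_frame]] by blast
qed

text \<open>Composing \<open>src Q\<close> with \<open>coadj\<close> gives \<open>src G\<close>, so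
  the tangent map preserves the kernel of the tangent map of the source along the units.\<close>

lemma tmap_coadj_mem:
  assumes G: "lie_groupoid G" and AG: "lie_algebroid_of G AG" and Q: "coadjoint_groupoid G \<xi> Q"
    and A': "lie_algebroid_of Q A'" and p: "p \<in> pts (base G)" and v: "v \<in> fib AG p"
  shows "tmap (arr Q) (coadj G \<xi>) (gunit Q p) v \<in> fib A' p"
proof -
  interpret arrG: manifold_atlas "arr G"
    using G by (intro smooth_manifold_atlas) (simp add: lie_groupoid_def)
  let ?g = "gunit G p"
  have g: "?g \<in> pts (arr G)" "src G ?g = p"
    using G p by (auto simp: lie_groupoid_def)
  have baseQ: "base Q = base G" and unitQ: "gunit Q p = coadj G \<xi> ?g"
    and sub: "submersion (arr G) (arr Q) (coadj G \<xi>)"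
    and srcQ: "\<And>h. h \<in> pts (arr G) \<Longrightarrow> src Q (coadj G \<xi> h) = src G h"
    using Q p by (auto simp: coadjoint_groupoid_def)
  have v': "v \<in> tangent_space (arr G) ?g" "tmap (base G) (src G) p v = 0"
    using AG p v by (auto simp: lie_algebroid_of_def)
  have "tmap (arr Q) (coadj G \<xi>) (gunit Q p) v \<in> tangent_space (arr Q) (gunit Q p)"
    using sub g v'(1) unfolding submersion_def unitQ by blast
  moreover have "tmap (base Q) (src Q) p (tmap (arr Q) (coadj G \<xi>) (gunit Q p) v) = 0"
  proof
    fix h
    \<comment> \<open>The two composites are known to agree on arrows of \<open>G\<close>, hence
      near the unit, and a tangent vector depends on the germ alone.\<close>
    have "v (h \<circ> src Q \<circ> coadj G \<xi>) = v (h \<circ> src G)"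
    proof (rule arrG.tangent_local[OF g(1) v'(1)])
      show "near (arr G) ?g (\<lambda>k. (h \<circ> src Q \<circ> coadj G \<xi>) k = (h \<circ> src G) k)"
        by (rule near_mono[OF arrG.near_pts[OF g(1)]]) (simp add: srcQ)
    qed
    moreover have "v (h \<circ> src G) = 0" if "smooth_at (base G) p h"
      using fun_cong[OF v'(2), of h] that by (simp add: tmap_def)
    ultimately show "tmap (base Q) (src Q) p (tmap (arr Q) (coadj G \<xi>) (gunit Q p) v) h = 0 h"
      by (simp add: tmap_def baseQ)
  qed
  moreover have "fib A' p = {v \<in> tangent_space (arr Q) (gunit Q p). tmap (base Q) (src Q) p v = 0}"
    using A' p unfolding lie_algebroid_of_def baseQ by blast
  ultimately show ?thesis
    by blast
qed

text \<open>By definition the pairing that defines \<open>ad\<^sup>*\<close> involves the germ of its section, so linearity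
  in the value at one point has to come from the identification of \<open>ad\<^sup>*_X \<xi>\<close> with the image of
  \<open>X\<close> under a tangent map.\<close>

lemma ad_star_pointwise_linear:
  assumes G: "lie_groupoid G" and AG: "lie_algebroid_of G AG" and Q: "coadjoint_groupoid G \<xi> Q"
    and AQ: "coadjoint_algebroid G AG \<xi> Q AQ"
    and X: "smooth_section_at (base G) AG p X"
    and Y: "\<And>i. i \<in> I \<Longrightarrow> smooth_section_at (base G) AG p (Y i)"
    and XY: "X p = (\<Sum>i\<in>I. a i *\<^sub>R Y i p)"
  shows "ad_star G AG \<xi> X p = (\<Sum>i\<in>I. a i *\<^sub>R ad_star G AG \<xi> (Y i) p)"
proof -
  have p: "p \<in> pts (base G)"
    using X by (simp add: smooth_section_at_def)
  obtain A' \<Phi> where A': "lie_algebroid_of Q A'" and iso: "algebroid_iso (base G) A' AQ \<Phi>"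
    and \<Phi>: "\<And>X. smooth_section_at (base G) AG p X \<Longrightarrow>
      \<Phi> p (tmap (arr Q) (coadj G \<xi>) (gunit Q p) (X p)) = ad_star G AG \<xi> X p"
    using AQ unfolding coadjoint_algebroid_def by blast
  have baseQ: "base Q = base G"
    using Q by (simp add: coadjoint_groupoid_def)
  have "lie_algebroid (base G) A'"
    using A' by (simp add: lie_algebroid_of_def baseQ)
  then interpret A': vbundle_over "base G" A'
    by (intro vbundle_over.intro smooth_manifold_atlas vbundle_over_axioms.intro) (auto simp: lie_algebroid_def)
  have mem: "tmap (arr Q) (coadj G \<xi>) (gunit Q p) (Y i p) \<in> fib A' p" if "i \<in> I" for i
  proof (rule tmap_coadj_mem[OF G AG Q A' p])
    show "Y i p \<in> fib AG p"
      using Y[OF that] near_self[of "base G" p "\<lambda>q. Y i q \<in> fib AG q"] by (simp add: smooth_section_at_def)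
  qed
  have lin: "linear_on_set (fib A' p) (\<Phi> p)"
    using iso p by (simp add: algebroid_iso_def)
  have "ad_star G AG \<xi> X p = \<Phi> p (\<Sum>i\<in>I. a i *\<^sub>R tmap (arr Q) (coadj G \<xi>) (gunit Q p) (Y i p))"
    using \<Phi>[OF X] by (simp only: XY tmap_sum)
  also have "\<dots> = (\<Sum>i\<in>I. a i *\<^sub>R \<Phi> p (tmap (arr Q) (coadj G \<xi>) (gunit Q p) (Y i p)))"
    by (rule linear_on_set_sum[OF A'.fiber_subspace[OF p] lin mem])
  also have "\<dots> = (\<Sum>i\<in>I. a i *\<^sub>R ad_star G AG \<xi> (Y i) p)"
    by (rule sum.cong) (simp_all add: \<Phi>[OF Y])
  finally show ?thesis .
qed

theorem mainTheorem5:
  fixes G :: "('g, 'm) groupoid"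
    and AG :: "('m, 'g tvec) algebroid"
    and \<xi> :: "'m \<Rightarrow> 'g tvec \<Rightarrow> real"
    and Q :: "(('g, 'm) coarrow, 'm) groupoid"
    and AQ :: "('m, ('m \<Rightarrow> 'g tvec) \<Rightarrow> real) algebroid"
    and C :: "('m, 'c::real_vector) vbundle"
    and f :: "'m \<times> 'c \<Rightarrow> (('m \<Rightarrow> 'g tvec) \<Rightarrow> real)"
    and L :: "'m \<times> 'c \<Rightarrow> real"
    and U :: "'m set"
    and x :: "'m \<Rightarrow> nat \<Rightarrow> real"
    and e :: "nat \<Rightarrow> 'm \<Rightarrow> 'g tvec"
    and s :: "nat \<Rightarrow> 'm \<Rightarrow> 'c"
    and \<rho> :: "nat \<Rightarrow> nat \<Rightarrow> 'm \<Rightarrow> real"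
    and K :: "nat \<Rightarrow> nat \<Rightarrow> nat \<Rightarrow> 'm \<Rightarrow> real"
    and J :: "real set"
    and \<gamma> :: "real \<Rightarrow> 'm \<times> ((('m \<Rightarrow> 'g tvec) \<Rightarrow> real) \<Rightarrow> real) \<times> 'c"
  defines "M \<equiv> base G"
    and "n \<equiv> mdim (base G)"
    and "r \<equiv> vrank AG"
    and "m \<equiv> vrank C"
    and "e' \<equiv> (\<lambda>\<alpha>. ad_star G AG \<xi> (e \<alpha>))"
  defines "\<psi> \<equiv> dual_times_chart n r m x e' s"
  defines "Hloc \<equiv> control_hamiltonian f L \<circ> inv_into (dual_times_dom AQ C U) \<psi>"
  assumes "lie_groupoid G" and "regular_groupoid G"
    and "lie_algebroid_of G AG" and "nonzero_bracket M AG"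
    and "coadjoint_element G AG \<xi>"
    and "normal_lie_subgroupoid G (stabilizer G \<xi>)"
    and "coadjoint_groupoid G \<xi> Q"
    and "coadjoint_algebroid G AG \<xi> Q AQ"
    and "coordinate_chart M U x"
    and "local_frame M AG r U e"
    and "local_frame M AQ r U e'"
    and "\<And>p \<alpha>. p \<in> U \<Longrightarrow> \<alpha> < r \<Longrightarrow>
           anchor AG p (e \<alpha> p) = (\<Sum>i<n. \<rho> i \<alpha> p *\<^sub>R coord_vec M U x i p)"
    and "\<And>p \<alpha> \<beta>. p \<in> U \<Longrightarrow> \<alpha> < r \<Longrightarrow> \<beta> < r \<Longrightarrow>
           brac AG (e \<alpha>) (e \<beta>) p = (\<Sum>c<r. K c \<alpha> \<beta> p *\<^sub>R e c p)"
    and "vector_bundle M C"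
    and "local_frame M C m U s"
    and "control_system M AQ C f"
    and "\<And>c. c \<in> pts (total_mfd M C) \<Longrightarrow> smooth_at (total_mfd M C) c L"
    and "open J"
    and "\<And>t. t \<in> J \<Longrightarrow> \<gamma> t \<in> dual_times_dom AQ C U"
  shows "critical_trajectory M AQ C f L J \<gamma> \<longleftrightarrow>
    (\<forall>t\<in>J.
      (\<forall>i<n. ((\<lambda>\<tau>. \<psi> (\<gamma> \<tau>) i) has_real_derivative
         (\<Sum>\<alpha><r. \<rho> i \<alpha> (fst (\<gamma> t)) * pd (n + \<alpha>) Hloc (\<psi> (\<gamma> t)))) (at t)) \<and>
      (\<forall>\<alpha><r. ((\<lambda>\<tau>. \<psi> (\<gamma> \<tau>) (n + \<alpha>)) has_real_derivative
         - ((\<Sum>i<n. \<rho> i \<alpha> (fst (\<gamma> t)) * pd i Hloc (\<psi> (\<gamma> t))) +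
            (\<Sum>\<beta><r. \<Sum>c<r. \<psi> (\<gamma> t) (n + c) * K c \<alpha> \<beta> (fst (\<gamma> t)) *
                             pd (n + \<beta>) Hloc (\<psi> (\<gamma> t))))) (at t)) \<and>
      (\<forall>c<m. pd (n + r + c) Hloc (\<psi> (\<gamma> t)) = 0))"
proof -
  note G = \<open>lie_groupoid G\<close> and AG = \<open>lie_algebroid_of G AG\<close> and Q = \<open>coadjoint_groupoid G \<xi> Q\<close>
    and AQ = \<open>coadjoint_algebroid G AG \<xi> Q AQ\<close>
  have lieG: "lie_algebroid M AG" and lieQ: "lie_algebroid M AQ"
    using AG AQ by (simp_all add: lie_algebroid_of_def coadjoint_algebroid_def M_def)
  have atlas: "manifold_atlas M"
    using lieG by (intro smooth_manifold_atlas) (simp add: lie_algebroid_def)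
  have frame: "smooth_section_at M AG p (e \<alpha>)" if "p \<in> U" "\<alpha> < r" for p \<alpha>
    by (rule local_frameD(4)[OF \<open>local_frame M AG r U e\<close> that])
  have anchor: "anchor AQ p (e' \<alpha> p) = (\<Sum>i<mdim M. \<rho> i \<alpha> p *\<^sub>R coord_vec M U x i p)" if "p \<in> U" "\<alpha> < r" for p \<alpha>
  proof -
    have "anchor AQ p (e' \<alpha> p) = anchor AG p (e \<alpha> p)"
      using AQ frame[OF that] by (simp add: coadjoint_algebroid_def e'_def M_def)
    then show ?thesis
      using assms(19)[OF that] by (simp add: n_def M_def)
  qed
  have bracket: "brac AQ (e' \<alpha>) (e' \<beta>) p = (\<Sum>c<r. K c \<alpha> \<beta> p *\<^sub>R e' c p)"
    if p: "p \<in> U" and \<alpha>: "\<alpha> < r" and \<beta>: "\<beta> < r" for p \<alpha> \<beta>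
  proof -
    note sec = frame[OF p \<alpha>] frame[OF p \<beta>]
    have "brac AQ (e' \<alpha>) (e' \<beta>) p = ad_star G AG \<xi> (brac AG (e \<alpha>) (e \<beta>)) p"
      using AQ sec unfolding coadjoint_algebroid_def e'_def M_def by blast
    \<comment> \<open>The bracket is a combination of the \<open>e c\<close> at each point, with no
      smoothness recorded for \<open>K\<close>; linearity in the value at \<open>p\<close> is
      therefore the form needed here.\<close>
    also have "\<dots> = (\<Sum>c<r. K c \<alpha> \<beta> p *\<^sub>R ad_star G AG \<xi> (e c) p)"
    proof (rule ad_star_pointwise_linear[OF G AG Q AQ])
      show "smooth_section_at (base G) AG p (brac AG (e \<alpha>) (e \<beta>))"
        using lieG sec unfolding lie_algebroid_def M_def by blast
      show "smooth_section_at (base G) AG p (e c)" if "c \<in> {..<r}" for c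
        using frame[OF p, of c] that by (simp add: M_def)
    qed (rule assms(20)[OF p \<alpha> \<beta>])
    finally show ?thesis
      by (simp add: e'_def)
  qed
  interpret control_frame M AQ r U e' x \<rho> K C m s f L
  proof (intro control_frame.intro algebroid_frame.intro local_frame_on.intro manifold_chart.intro
      vbundle_over.intro vbundle_over_axioms.intro local_frame_on_axioms.intro manifold_chart_axioms.intro
      algebroid_frame_axioms.intro control_frame_axioms.intro atlas lieQ)
    show "vector_bundle M AQ"
      using lieQ by (simp add: lie_algebroid_def)
  qed (use assms anchor bracket in blast)+
  have \<psi>: "\<psi> = dual_times_chart (mdim M) r m x e' s"
    by (simp add: \<psi>_def n_def M_def)
  have grad: "pd i Hloc (\<psi> w) = grad w i" for w i
    by (simp add: grad_def Hloc_def \<psi>)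
  \<comment> \<open>The coordinate \<open>n + c\<close> of \<open>w\<close> is its covector
    evaluated on \<open>e' c\<close>, so the coordinate expression of the statement is
    \<open>twist\<close> for \<open>AQ\<close>.\<close>
  have twist: "(\<Sum>\<beta><r. \<Sum>c<r. \<psi> w (n + c) * K c \<alpha> \<beta> (fst w) * pd (n + \<beta>) Hloc (\<psi> w))
      = (\<Sum>\<beta><r. twist (fst w) (fst (snd w)) \<alpha> \<beta> * grad w (mdim M + \<beta>))" for w \<alpha>
    unfolding grad twist_def sum_distrib_right
    by (intro sum.cong refl) (use chart_fiber in \<open>simp add: \<psi> n_def M_def\<close>)
  have n: "n = mdim M"
    by (simp add: n_def M_def)
  have "critical_trajectory M AQ C f L J \<gamma> \<longleftrightarrow>
    (\<forall>t\<in>J. (\<forall>i<n. ((\<lambda>\<tau>. \<psi> (\<gamma> \<tau>) i) has_real_derivative xdot (\<gamma> t) i) (at t)) \<and>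
      (\<forall>\<alpha><r. ((\<lambda>\<tau>. \<psi> (\<gamma> \<tau>) (n + \<alpha>)) has_real_derivative etadot (\<gamma> t) \<alpha>) (at t)) \<and>
      (\<forall>c<m. grad (\<gamma> t) (n + r + c) = 0))"
    unfolding n \<psi> by (rule critical_trajectory_iff[OF \<open>open J\<close>]) (rule assms(26))
  then show ?thesis
    unfolding twist unfolding grad xdot_def etadot_def n .
qed

end
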